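(* Let $D\subset\mathbb{C}^n$ be a bounded convex domain and let $X\subset D$ be a subdomain. (1) If $X$ is Lipschitz in $D$, then $X$ is c-Bloch in $D$. (2) If $X$ is 1-Bloch in $D$, then $X$ is Lipschitz in $D$.
   Context: $\mathbb{D}=\{\zeta\in\mathbb{C}:|\zeta|<1\}$. A domain is a connected open set. For a domain $D$, $k_D$ denotes the Kobayashi distance of $D$ and $\kappa_D$ the Kobayashi infinitesimal metric (for $D=\mathbb{D}$ these are the Poincaré distance and metric). Bloch radius: for a domain $D$, $z\in D$ and $r\ge 0$, put $B_D(z,r)=\{w\in D: k_D(w,z)<r\}$. For $X\subset D$ the Bloch radius of $X$ in $D$ is $R(X)=\sup\{r\ge 0: B_D(z,r)\subset X \text{ for some } z\in D\}$. A subdomain $X$ of $D$ is a Bloch subdomain of $D$ if $R(X)<+\infty$. Lipschitz: for a subdomain $Z\subset D$ the hyperbolic Lipschitz constant is $\mu_D(Z):=\sup\left\{\frac{\kappa_D(z;v)}{\kappa_Z(z;v)}: z\in Z,\ v\in T_zZ,\ v\ne 0\right\}$. $Z$ is Lipschitz in $D$ (a Lipschitz subdomain of $D$) if $\mu_D(Z)<1$. Lempert projection devices: let $D\subset\mathbb{C}^n$ be a bounded convex domain. A complex geodesic of $D$ is a holomorphic map $\varphi:\mathbb{D}\to D$ which is an isometry between $k_{\mathbb{D}}$ and $k_D$. A Lempert projection associated to $\varphi$ is a holomorphic map $\rho_\varphi:D\to D$ with $\rho_\varphi(D)=\varphi(\mathbb{D})$, $\rho_\varphi\circ\rho_\varphi=\rho_\varphi$,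 $\rho_\varphi(z)=z$ for all $z\in\varphi(\mathbb{D})$, and such that for every $\zeta\in\mathbb{D}$ the fiber $\rho_\varphi^{-1}(\varphi(\zeta))$ is the intersection of $D$ with a complex (affine) hyperplane. Put $\tilde\rho_\varphi:=\varphi^{-1}\circ\rho_\varphi:D\to\mathbb{D}$ (the left inverse of $\varphi$). A triple $(\varphi,\rho_\varphi,\tilde\rho_\varphi)$ of this kind is a Lempert projection device. 1-Bloch: a subset $X\subset D$ is 1-Bloch in $D$ if there exists $C>0$ such that for every Lempert projection device $(\varphi,\rho_\varphi,\tilde\rho_\varphi)$ of $D$ the set $\tilde\rho_\varphi(X)$ is contained in a Bloch subdomain $U_\varphi$ of $\mathbb{D}$ with Bloch radius (in $\mathbb{D}$) $R(U_\varphi)<C$. c-Bloch: a subdomain $X\subset D$ is c-Bloch in $D$ if there exists $C>0$ such that for every Lempert projection device $(\varphi,\rho_\varphi,\tilde\rho_\varphi)$ of $D$ the (possibly empty) open set $\tilde\rho_\varphi(X\cap\varphi(\mathbb{D}))$ is contained in a Bloch subdomain of $\mathbb{D}$ with Bloch radius (in $\mathbb{D}$) bounded from above by $C$. *)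

theory Defs
  imports "HOL-Complex_Analysis.Complex_Analysis"
begin

abbreviation unit_disc :: "complex set" where
  "unit_disc \<equiv> ball 0 1"

definition is_domain :: "'a::topological_space set \<Rightarrow> bool" where
  "is_domain D \<longleftrightarrow> open D \<and> connected D"

definition subdomain :: "'a::topological_space set \<Rightarrow> 'a set \<Rightarrow> bool" where
  "subdomain X D \<longleftrightarrow> is_domain X \<and> X \<subseteq> D"

text \<open>A map on an open subset of \<open>C\<^sup>n\<close> is holomorphic if it is (real) Frechet differentiable
  with complex-linear derivative at each point.\<close>

definition holomorphic_map_on :: "(complex ^ 'n \<Rightarrow> complex ^ 'm) \<Rightarrow> (complex ^ 'n) set \<Rightarrow> bool" where
  "holomorphic_map_on f D \<longleftrightarrow>
     (\<forall>z\<in>D. \<exists>L. (f has_derivative L) (at z) \<and> (\<forall>c v. L (c *s v) = c *s L v))"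

definition analytic_disc :: "(complex ^ 'n) set \<Rightarrow> (complex \<Rightarrow> complex ^ 'n) \<Rightarrow> bool" where
  "analytic_disc D f \<longleftrightarrow>
     (\<forall>i. (\<lambda>\<zeta>. f \<zeta> $ i) holomorphic_on unit_disc) \<and> f ` unit_disc \<subseteq> D"

definition disc_deriv :: "(complex \<Rightarrow> complex ^ 'n) \<Rightarrow> complex \<Rightarrow> complex ^ 'n" where
  "disc_deriv f \<zeta> = (\<chi> i. deriv (\<lambda>x. f x $ i) \<zeta>)"

text \<open>The Poincare distance, normalised to curvature \<open>-4\<close>, so that the associated
  infinitesimal metric is \<open>|v| / (1 - |\<zeta>|\<^sup>2)\<close>. It is the Kobayashi distance of the unit disc.\<close>

definition poincare_dist :: "complex \<Rightarrow> complex \<Rightarrow> real" where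
  "poincare_dist z w = artanh (cmod ((z - w) / (1 - cnj w * z)))"

text \<open>The Kobayashi distance: infimum of the lengths of chains of analytic discs, where the
  \<open>j\<close>-th disc \<open>f j\<close> joins \<open>p j\<close> to \<open>p (Suc j)\<close>. For a nonempty connected open \<open>D\<close>
  and \<open>z, w\<close> in \<open>D\<close> such chains exist, so the infimum is over a nonempty set.\<close>

definition kobayashi_dist :: "(complex ^ 'n) set \<Rightarrow> complex ^ 'n \<Rightarrow> complex ^ 'n \<Rightarrow> real" where
  "kobayashi_dist D z w = Inf {(\<Sum>j<m. poincare_dist (a j) (b j)) | (m::nat) f p a b.
      p 0 = z \<and> p m = w \<and>
      (\<forall>j<m. analytic_disc D (f j) \<and> a j \<in> unit_disc \<and> b j \<in> unit_disc \<and>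
             f j (a j) = p j \<and> f j (b j) = p (Suc j))}"

definition kobayashi_metric :: "(complex ^ 'n) set \<Rightarrow> complex ^ 'n \<Rightarrow> complex ^ 'n \<Rightarrow> real" where
  "kobayashi_metric D z v =
     Inf {cmod \<xi> | \<xi> f. analytic_disc D f \<and> f 0 = z \<and> \<xi> *s disc_deriv f 0 = v}"

text \<open>Balls and Bloch radii in a domain \<open>D\<close> with respect to its Kobayashi distance, which is
  passed as the argument \<open>k\<close>. Extended reals allow the radius to be infinite.\<close>

definition hyp_ball :: "('a \<Rightarrow> 'a \<Rightarrow> real) \<Rightarrow> 'a set \<Rightarrow> 'a \<Rightarrow> real \<Rightarrow> 'a set" where
  "hyp_ball k D z r = {w \<in> D. k w z < r}"

definition bloch_radius :: "('a \<Rightarrow> 'a \<Rightarrow> real) \<Rightarrow> 'a set \<Rightarrow> 'a set \<Rightarrow> ereal" where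
  "bloch_radius k D X = (SUP r \<in> {r. 0 \<le> r \<and> (\<exists>z\<in>D. hyp_ball k D z r \<subseteq> X)}. ereal r)"

definition bloch_subdomain :: "('a::topological_space \<Rightarrow> 'a \<Rightarrow> real) \<Rightarrow> 'a set \<Rightarrow> 'a set \<Rightarrow> bool" where
  "bloch_subdomain k D X \<longleftrightarrow> subdomain X D \<and> bloch_radius k D X < \<infinity>"

text \<open>If \<open>Z \<subseteq> D\<close> are bounded domains, then \<open>0 < kobayashi_metric Z z v\<close> for \<open>z \<in> Z\<close> and
  \<open>v \<noteq> 0\<close>, so the quotients below are genuine.\<close>

definition hyp_lipschitz_const :: "(complex ^ 'n) set \<Rightarrow> (complex ^ 'n) set \<Rightarrow> ereal" where
  "hyp_lipschitz_const D Z =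
     (SUP (z, v) \<in> Z \<times> (UNIV - {0}). ereal (kobayashi_metric D z v / kobayashi_metric Z z v))"

definition lipschitz_subdomain :: "(complex ^ 'n) set \<Rightarrow> (complex ^ 'n) set \<Rightarrow> bool" where
  "lipschitz_subdomain D Z \<longleftrightarrow> subdomain Z D \<and> hyp_lipschitz_const D Z < 1"

definition complex_geodesic :: "(complex ^ 'n) set \<Rightarrow> (complex \<Rightarrow> complex ^ 'n) \<Rightarrow> bool" where
  "complex_geodesic D \<phi> \<longleftrightarrow> analytic_disc D \<phi> \<and>
     (\<forall>\<zeta>\<in>unit_disc. \<forall>\<eta>\<in>unit_disc. kobayashi_dist D (\<phi> \<zeta>) (\<phi> \<eta>) = poincare_dist \<zeta> \<eta>)"

definition complex_hyperplane :: "(complex ^ 'n) set \<Rightarrow> bool" where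
  "complex_hyperplane H \<longleftrightarrow> (\<exists>a b. a \<noteq> 0 \<and> H = {z. (\<Sum>i\<in>UNIV. a $ i * z $ i) = b})"

definition lempert_projection ::
    "(complex ^ 'n) set \<Rightarrow> (complex \<Rightarrow> complex ^ 'n) \<Rightarrow> (complex ^ 'n \<Rightarrow> complex ^ 'n) \<Rightarrow> bool" where
  "lempert_projection D \<phi> \<rho> \<longleftrightarrow>
     holomorphic_map_on \<rho> D \<and> \<rho> ` D = \<phi> ` unit_disc \<and>
     (\<forall>z\<in>D. \<rho> (\<rho> z) = \<rho> z) \<and>
     (\<forall>z\<in>\<phi> ` unit_disc. \<rho> z = z) \<and>
     (\<forall>\<zeta>\<in>unit_disc. \<exists>H. complex_hyperplane H \<and> {z \<in> D. \<rho> z = \<phi> \<zeta>} = D \<inter> H)"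

text \<open>A complex geodesic is injective on the unit disc, so \<open>inv_into\<close> gives its inverse on
  its image.\<close>

definition lempert_device ::
    "(complex ^ 'n) set \<Rightarrow> (complex \<Rightarrow> complex ^ 'n) \<Rightarrow> (complex ^ 'n \<Rightarrow> complex ^ 'n)
      \<Rightarrow> (complex ^ 'n \<Rightarrow> complex) \<Rightarrow> bool" where
  "lempert_device D \<phi> \<rho> \<rho>t \<longleftrightarrow>
     complex_geodesic D \<phi> \<and> lempert_projection D \<phi> \<rho> \<and>
     (\<forall>z\<in>D. \<rho>t z = inv_into unit_disc \<phi> (\<rho> z))"

definition one_bloch :: "(complex ^ 'n) set \<Rightarrow> (complex ^ 'n) set \<Rightarrow> bool" where
  "one_bloch D X \<longleftrightarrow> X \<subseteq> D \<and>
     (\<exists>C>0. \<forall>\<phi> \<rho> \<rho>t. lempert_device D \<phi> \<rho> \<rho>t \<longrightarrow>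
        (\<exists>U. bloch_subdomain poincare_dist unit_disc U \<and> \<rho>t ` X \<subseteq> U \<and>
             bloch_radius poincare_dist unit_disc U < ereal C))"

definition c_bloch :: "(complex ^ 'n) set \<Rightarrow> (complex ^ 'n) set \<Rightarrow> bool" where
  "c_bloch D X \<longleftrightarrow> subdomain X D \<and>
     (\<exists>C>0. \<forall>\<phi> \<rho> \<rho>t. lempert_device D \<phi> \<rho> \<rho>t \<longrightarrow>
        (\<exists>U. bloch_subdomain poincare_dist unit_disc U \<and> \<rho>t ` (X \<inter> \<phi> ` unit_disc) \<subseteq> U \<and>
             bloch_radius poincare_dist unit_disc U \<le> ereal C))"

end

theory Submission
  imports Defs
begin

text \<open>Both implications compare \<open>D\<close> with the unit disc along complex geodesics, and the second one
  needs Lempert's theory: through every point of a bounded convex domain and in every complex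
  direction there is a complex geodesic \<open>\<phi>\<close> with a holomorphic left inverse whose fibres are
  hyperplane sections. No regularity of the boundary is assumed, and the construction below rests on
  a duality argument that never uses boundary values.

  Lipschitz implies c-Bloch (\<open>c_bloch_of_lipschitz\<close>). Let \<open>U\<close> be the preimage of \<open>X\<close> under a geodesic
  \<open>\<phi>\<close>. If \<open>U\<close> contains a hyperbolic disc of radius \<open>R\<close>, then \<open>\<phi>\<close>, precomposed with a
  parametrisation of that disc, is an analytic disc in \<open>X\<close>; since \<open>\<phi>\<close> is also an infinitesimal isometry
  (\<open>geodesic_infinitesimal\<close>), the quotient of the two Kobayashi metrics at the centre is at least
  \<open>tanh R\<close>. A Lipschitz constant below one therefore bounds \<open>R\<close>. The set \<open>U\<close> may be disconnected; it is
  enlarged to the complement of a maximal separated subset of the complement of \<open>U\<close>, which is a domain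
  and still contains no large discs (\<open>bloch_superdomain\<close>).

  1-Bloch implies Lipschitz (\<open>lipschitz_of_one_bloch\<close>). Given \<open>z \<in> X\<close> and \<open>v\<close>, take a device whose geodesic
  is extremal for \<open>(z, v)\<close> in \<open>D\<close>, with left inverse \<open>\<sigma>\<close>. An analytic disc \<open>f\<close> in \<open>X\<close> centred at \<open>z\<close> gives a
  self-map \<open>\<sigma> \<circ> f\<close> of the unit disc fixing the origin whose image misses a point of a fixed disc about the
  origin. By the Schwarz-Pick lemma its derivative at the origin is bounded by a constant less than
  one (\<open>image_contains_ball\<close>), and this is the Lipschitz estimate.

  Construction of the device. For an extremal disc \<open>\<phi>\<close>, which exists by Montel's theorem, the positive
  extension theorem of M. Riesz dualises the extremal problem on the circle. Cauchy transforms of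
  the dual functional give a holomorphic vector-valued function \<open>h\<close> on the unit disc such that, for
  every \<open>w\<close> in \<open>D\<close>, the function \<open>g\<^sub>w(\<zeta>) = h(\<zeta>) \<cdot> (\<phi>(\<zeta>) - w)\<close> satisfies
  \<open>Re (cnj \<zeta> g\<^sub>w(\<zeta>)) \<ge> - C (1 - |\<zeta>|\<^sup>2)\<close> (\<open>supporting_field_exists\<close>). Thus \<open>g\<^sub>w\<close> is, up to sign, an infinitesimal
  generator of self-maps of the disc, in the sense of Berkson and Porta. A nonzero generator has at
  most one zero in the disc. Comparing the generators of neighbouring points \<open>w\<close> shows that the zero
  persists and moves holomorphically as \<open>w\<close> varies in \<open>D\<close> (locale \<open>supporting_field\<close>). The
  zero of \<open>g\<^sub>w\<close> is the value at \<open>w\<close> of the left inverse, whose fibres are visibly hyperplane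
  sections.\<close>

(* The dollar sign is reserved for the components of vectors. *)
no_notation fps_nth (infixl \<open>$\<close> 75)

section \<open>Real parts of holomorphic functions on the disc\<close>

lemma Re_ge_of_boundary:
  assumes "f holomorphic_on unit_disc" "0 < r" "r < 1"
    and bd: "\<And>\<zeta>. cmod \<zeta> = r \<Longrightarrow> c \<le> Re (f \<zeta>)"
    and "cmod \<zeta> < r"
  shows "c \<le> Re (f \<zeta>)"
proof -
  have sub: "cball 0 r \<subseteq> unit_disc"
    using assms(3) by (auto simp: dist_norm)
  have hol: "(\<lambda>\<zeta>. - f \<zeta>) holomorphic_on cball 0 r"
    using holomorphic_on_subset[OF assms(1) sub] by (intro holomorphic_intros)
  have "Re (- f \<zeta>) \<le> - c"
  proof (rule maximum_real_frontier[where S = "cball 0 r" and f = "\<lambda>\<zeta>. - f \<zeta>"])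
    show "(\<lambda>\<zeta>. - f \<zeta>) holomorphic_on interior (cball 0 r)"
      using hol holomorphic_on_subset interior_subset by blast
    show "continuous_on (closure (cball 0 r)) (\<lambda>\<zeta>. - f \<zeta>)"
      using hol holomorphic_on_imp_continuous_on by auto
    show "Re (- f z) \<le> - c" if "z \<in> frontier (cball 0 r)" for z
      using that bd[of z] by (auto simp: dist_norm)
  qed (use assms in auto)
  then show ?thesis by simp
qed

text \<open>A substitute for the minimum principle when there are no boundary values on the unit circle: the
  function is only bounded below by an error term on each circle of radius \<open>r < 1\<close>, and it may itself
  depend on \<open>r\<close>, so that kernels adapted to the disc of radius \<open>r\<close> can be used.\<close>

lemma Re_nonneg_of_limit:
  assumes hol: "\<forall>\<^sub>F r in at_left 1. N r holomorphic_on unit_disc"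
    and bd: "\<forall>\<^sub>F r in at_left (1::real). \<forall>\<zeta>. cmod \<zeta> = r \<longrightarrow> - \<delta> r \<le> Re (N r \<zeta>)"
    and \<delta>: "(\<delta> \<longlongrightarrow> 0) (at_left 1)"
    and lim: "((\<lambda>r. N r \<zeta>) \<longlongrightarrow> l) (at_left 1)"
    and \<zeta>: "cmod \<zeta> < 1"
  shows "0 \<le> Re l"
proof -
  have "\<forall>\<^sub>F r in at_left (1::real). cmod \<zeta> < r"
    using eventually_at_left_real[of "cmod \<zeta>" 1] \<zeta>
    by (auto elim: eventually_mono)
  moreover have "\<forall>\<^sub>F r in at_left (1::real). r < 1"
    by (auto simp: eventually_at_filter)
  ultimately have "\<forall>\<^sub>F r in at_left 1. 0 \<le> Re (N r \<zeta>) + \<delta> r"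
    using hol bd
  proof eventually_elim
    case (elim r)
    then have "0 < r" using norm_ge_zero[of \<zeta>] by linarith
    have "- \<delta> r \<le> Re (N r \<zeta>)"
      by (rule Re_ge_of_boundary[of "N r" r]) (use elim \<open>0 < r\<close> in auto)
    then show ?case by simp
  qed
  moreover have "((\<lambda>r. Re (N r \<zeta>) + \<delta> r) \<longlongrightarrow> Re l + 0) (at_left 1)"
    by (intro tendsto_intros lim \<delta>)
  ultimately show ?thesis
    using tendsto_lowerbound[of "\<lambda>r. Re (N r \<zeta>) + \<delta> r" "Re l + 0" "at_left (1::real)" 0] by simp
qed

text \<open>The modulus of \<open>exp (- p)\<close> attains its maximum at \<open>\<zeta>\<close>, so it is constant.\<close>

lemma Re_zero_of_Re_nonneg:
  assumes p: "p holomorphic_on unit_disc" and nn: "\<And>z. cmod z < 1 \<Longrightarrow> 0 \<le> Re (p z)"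
    and \<zeta>: "cmod \<zeta> < 1" "Re (p \<zeta>) = 0" and z: "cmod z < 1"
  shows "Re (p z) = 0"
proof -
  have "(\<lambda>z. exp (- p z)) constant_on unit_disc"
  proof (rule maximum_modulus_principle[where U = unit_disc and \<xi> = \<zeta>])
    show "(\<lambda>z. exp (- p z)) holomorphic_on unit_disc" by (intro holomorphic_intros p)
    show "cmod (exp (- p z)) \<le> cmod (exp (- p \<zeta>))" if "z \<in> unit_disc" for z
      using nn[of z] \<zeta>(2) that by simp
  qed (use \<zeta> in auto)
  then obtain c where "\<And>z. z \<in> unit_disc \<Longrightarrow> exp (- p z) = c"
    unfolding constant_on_def by blast
  from this[of z] this[of \<zeta>] \<zeta> z have "exp (- p z) = exp (- p \<zeta>)" by simp
  then have "cmod (exp (- p z)) = cmod (exp (- p \<zeta>))" by (rule arg_cong)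
  then show ?thesis using \<zeta>(2) by simp
qed

lemma exists_phase: "\<exists>c. cmod c = 1 \<and> c * z = of_real (cmod z)"
proof (cases "z = 0")
  case True then show ?thesis by (intro exI[of _ 1]) simp
next
  case False
  have "cnj z / cmod z * z = of_real (cmod z)"
    using False complex_norm_square[of z] by (simp add: field_simps power2_eq_square)
  then show ?thesis using False by (intro exI[of _ "cnj z / cmod z"]) (simp add: norm_divide)
qed

lemma one_minus_cnj_mult_nonzero:
  assumes "cmod b < 1" "cmod \<zeta> < 1" shows "1 - cnj b * \<zeta> \<noteq> 0"
proof
  assume "1 - cnj b * \<zeta> = 0"
  then have "cmod (cnj b * \<zeta>) = 1" by (metis eq_iff_diff_eq_0 norm_one)
  then show False using assms norm_mult_less[of "cnj b" 1 \<zeta> 1] by simp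
qed

lemma holomorphic_divide_zero:
  assumes "g holomorphic_on unit_disc" "g b = 0" "cmod b < 1"
  obtains k where "k holomorphic_on unit_disc" "\<And>\<zeta>. cmod \<zeta> < 1 \<Longrightarrow> g \<zeta> = (\<zeta> - b) * k \<zeta>"
proof -
  let ?k = "\<lambda>z. if z = b then deriv g b else (g z - g b) / (z - b)"
  have "?k holomorphic_on unit_disc"
    by (rule pole_lemma_open[OF assms(1)]) simp
  moreover have "g \<zeta> = (\<zeta> - b) * ?k \<zeta>" for \<zeta>
    using assms(2) by auto
  ultimately show ?thesis using that by blast
qed

lemma Re_divide_ge_half:
  assumes "cmod (x - y) \<le> cmod x" "y \<noteq> 0" shows "1 / 2 \<le> Re (x / y)"
proof -
  have "(cmod (x - y))\<^sup>2 \<le> (cmod x)\<^sup>2" using assms by (intro power_mono) auto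
  then have "(cmod y)\<^sup>2 \<le> 2 * Re (x * cnj y)"
    unfolding cmod_power2 by (simp add: power2_eq_square algebra_simps)
  moreover have "Re (x / y) = Re (x * cnj y) / (cmod y)\<^sup>2"
    by (simp add: Re_divide cmod_power2)
  moreover have "(cmod y)\<^sup>2 > 0" using assms by simp
  ultimately show ?thesis by (simp add: pos_le_divide_eq)
qed

text \<open>This is the Berkson-Porta formula with a perturbation. The hypothesis says that all the
  functions \<open>(\<zeta> - b) k(\<zeta>) - c e(\<zeta>)\<close> with \<open>|c| = 1\<close> point outwards on the unit circle, up to an error
  of order \<open>1 - |\<zeta>|\<^sup>2\<close>. For \<open>e = 0\<close> the conclusion is that \<open>k(\<zeta>) / (1 - cnj b \<zeta>)\<close> has nonnegative real part.
  The formula \<open>(\<zeta> - b)(1 - cnj b \<zeta>) = \<zeta> |1 - cnj b \<zeta>|\<^sup>2\<close> on the unit circle is what turns the hypothesis into a bound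
  for a real part; it is used on smaller circles, with \<open>r\<^sup>2 - cnj b \<zeta>\<close> in place of
  \<open>1 - cnj b \<zeta>\<close>.\<close>

lemma generator_domination:
  fixes k e :: "complex \<Rightarrow> complex"
  assumes k: "k holomorphic_on unit_disc" and e: "e holomorphic_on unit_disc"
    and b: "cmod b < 1"
    and gen: "\<And>\<zeta>. cmod \<zeta> < 1 \<Longrightarrow>
        - C * (1 - (cmod \<zeta>)\<^sup>2) + cmod \<zeta> * cmod (e \<zeta>) \<le> Re (cnj \<zeta> * ((\<zeta> - b) * k \<zeta>))"
    and \<zeta>: "cmod \<zeta> < 1"
  shows "cmod (e \<zeta>) \<le> (cmod (1 - cnj b * \<zeta>))\<^sup>2 * Re (k \<zeta> / (1 - cnj b * \<zeta>))"
proof -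
  have C: "C \<ge> 0"
  proof -
    from gen[of 0] show ?thesis by simp
  qed
  define d where "d r \<zeta> = (complex_of_real (r\<^sup>2) - cnj b * \<zeta>)" for r :: real and \<zeta>
  have db: "cmod (d r \<zeta>) \<ge> r\<^sup>2 - cmod b * cmod \<zeta>" for r \<zeta>
    using norm_triangle_ineq2[of "complex_of_real (r\<^sup>2)" "cnj b * \<zeta>"]
    by (simp add: d_def norm_mult del: of_real_power)
  have lower: "0 \<le> Re (k \<zeta> / d 1 \<zeta> - c * e \<zeta> / (d 1 \<zeta>)\<^sup>2)" if c: "cmod c = 1" for c
  proof (rule Re_nonneg_of_limit[where N = "\<lambda>r \<zeta>. k \<zeta> / d r \<zeta> - c * e \<zeta> * r / (d r \<zeta>)\<^sup>2"
        and \<zeta> = \<zeta> and \<delta> = "\<lambda>r. C * (1 - r\<^sup>2) / (r\<^sup>2 - cmod b)\<^sup>2"])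
    have lim2: "((\<lambda>r::real. r\<^sup>2) \<longlongrightarrow> 1\<^sup>2) (at_left 1)"
      by (intro tendsto_intros)
    have ev1: "\<forall>\<^sub>F r in at_left (1::real). cmod b < r\<^sup>2"
      using order_tendstoD(1)[OF lim2, of "cmod b"] b by simp
    have ev2: "\<forall>\<^sub>F r in at_left (1::real). 0 < r \<and> r < 1"
      using eventually_at_left_real[of 0 1] by (auto elim: eventually_mono)
    have nz: "d r \<zeta> \<noteq> 0" if "cmod b < r\<^sup>2" "cmod \<zeta> < 1" for r \<zeta>
    proof -
      have "cmod b * cmod \<zeta> \<le> cmod b * 1" using that by (intro mult_left_mono) auto
      then show ?thesis using db[of r \<zeta>] that by auto
    qed
    show "\<forall>\<^sub>F r in at_left 1. (\<lambda>\<zeta>. k \<zeta> / d r \<zeta> - c * e \<zeta> * r / (d r \<zeta>)\<^sup>2) holomorphic_on unit_disc"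
      using ev1
    proof eventually_elim
      case (elim r)
      then show ?case
        using nz[OF elim] by (auto simp: d_def intro!: holomorphic_intros k e)
    qed
    show "\<forall>\<^sub>F r in at_left 1. \<forall>\<zeta>. cmod \<zeta> = r \<longrightarrow>
        - (C * (1 - r\<^sup>2) / (r\<^sup>2 - cmod b)\<^sup>2) \<le> Re (k \<zeta> / d r \<zeta> - c * e \<zeta> * r / (d r \<zeta>)\<^sup>2)"
      using ev1 ev2
    proof eventually_elim
      case (elim r)
      show ?case
      proof (intro allI impI)
        fix \<zeta> assume \<zeta>: "cmod \<zeta> = r"
        have dnz: "d r \<zeta> \<noteq> 0" using nz[of r \<zeta>] elim \<zeta> by auto
        have zz: "cnj \<zeta> * \<zeta> = of_real (r\<^sup>2)"
          using \<zeta> by (metis complex_norm_square mult.commute)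
        \<comment> \<open>On the circle of radius \<open>r\<close> the factor \<open>\<zeta> - b\<close> is \<open>\<zeta> / r\<^sup>2\<close> times the conjugate of the kernel.\<close>
        have "cnj \<zeta> * (\<zeta> - b) = cnj (d r \<zeta>)"
          using zz by (simp add: d_def algebra_simps)
        then have "cnj \<zeta> * ((\<zeta> - b) * k \<zeta>) = cnj (d r \<zeta>) * k \<zeta>"
          by (metis mult.assoc)
        also have "\<dots> = of_real ((cmod (d r \<zeta>))\<^sup>2) * (k \<zeta> / d r \<zeta>)"
          using dnz by (simp add: complex_norm_square field_simps del: of_real_power)
        finally have "Re (cnj \<zeta> * ((\<zeta> - b) * k \<zeta>)) = (cmod (d r \<zeta>))\<^sup>2 * Re (k \<zeta> / d r \<zeta>)"
          by (metis Re_complex_of_real Im_complex_of_real mult_zero_left diff_zero times_complex.simps(1))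
        then have 1: "- C * (1 - r\<^sup>2) + r * cmod (e \<zeta>) \<le> (cmod (d r \<zeta>))\<^sup>2 * Re (k \<zeta> / d r \<zeta>)"
          using gen[of \<zeta>] \<zeta> elim by simp
        have dpos: "(cmod (d r \<zeta>))\<^sup>2 > 0" using dnz by simp
        have 2: "- C * (1 - r\<^sup>2) / (cmod (d r \<zeta>))\<^sup>2 + r * cmod (e \<zeta>) / (cmod (d r \<zeta>))\<^sup>2 \<le> Re (k \<zeta> / d r \<zeta>)"
          using 1 dpos by (simp add: field_simps)
        have 3: "Re (c * e \<zeta> * r / (d r \<zeta>)\<^sup>2) \<le> r * cmod (e \<zeta>) / (cmod (d r \<zeta>))\<^sup>2"
          using complex_Re_le_cmod[of "c * e \<zeta> * r / (d r \<zeta>)\<^sup>2"] c elim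
          by (simp add: norm_mult norm_divide norm_power mult.commute)
        have "cmod b * r \<le> cmod b * 1" using elim by (intro mult_left_mono) auto
        then have "r\<^sup>2 - cmod b \<le> cmod (d r \<zeta>)" using db[of r \<zeta>] \<zeta> by simp
        then have sq: "(r\<^sup>2 - cmod b)\<^sup>2 \<le> (cmod (d r \<zeta>))\<^sup>2"
          using elim by (intro power_mono) auto
        have "r\<^sup>2 \<le> 1" using elim by (simp add: power_le_one)
        then have "C * (1 - r\<^sup>2) / (cmod (d r \<zeta>))\<^sup>2 \<le> C * (1 - r\<^sup>2) / (r\<^sup>2 - cmod b)\<^sup>2"
          using C sq elim by (intro divide_left_mono mult_nonneg_nonneg mult_pos_pos) (auto simp: dnz)
        then show "- (C * (1 - r\<^sup>2) / (r\<^sup>2 - cmod b)\<^sup>2) \<le> Re (k \<zeta> / d r \<zeta> - c * e \<zeta> * r / (d r \<zeta>)\<^sup>2)"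
          using 2 3 by simp
      qed
    qed
    have "((\<lambda>r. C * (1 - r\<^sup>2) / (r\<^sup>2 - cmod b)\<^sup>2) \<longlongrightarrow> C * (1 - 1\<^sup>2) / (1\<^sup>2 - cmod b)\<^sup>2) (at_left 1)"
      using b by (intro tendsto_intros) auto
    then show "((\<lambda>r. C * (1 - r\<^sup>2) / (r\<^sup>2 - cmod b)\<^sup>2) \<longlongrightarrow> 0) (at_left 1)" by simp
    have "d 1 \<zeta> \<noteq> 0" using nz[of 1 \<zeta>] b \<zeta> by simp
    then have d1: "1 - cnj b * \<zeta> \<noteq> 0" by (simp add: d_def)
    have "((\<lambda>r. k \<zeta> / d r \<zeta> - c * e \<zeta> * of_real r / (d r \<zeta>)\<^sup>2) \<longlongrightarrow>
       k \<zeta> / d 1 \<zeta> - c * e \<zeta> * of_real 1 / (d 1 \<zeta>)\<^sup>2) (at_left 1)"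
      unfolding d_def using d1 by (intro tendsto_intros) auto
    then show "((\<lambda>r. k \<zeta> / d r \<zeta> - c * e \<zeta> * of_real r / (d r \<zeta>)\<^sup>2) \<longlongrightarrow>
       k \<zeta> / d 1 \<zeta> - c * e \<zeta> / (d 1 \<zeta>)\<^sup>2) (at_left 1)" by simp
  qed (rule \<zeta>)
  define E where "E = e \<zeta> / (d 1 \<zeta>)\<^sup>2"
  obtain c where c: "cmod c = 1" "c * E = of_real (cmod E)" using exists_phase by blast
  have "c * e \<zeta> / (d 1 \<zeta>)\<^sup>2 = of_real (cmod E)" using c by (simp add: E_def)
  then have "cmod E \<le> Re (k \<zeta> / d 1 \<zeta>)" using lower[OF c(1)] by simp
  moreover have "d 1 \<zeta> = 1 - cnj b * \<zeta>" by (simp add: d_def)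
  moreover have "1 - cnj b * \<zeta> \<noteq> 0" by (rule one_minus_cnj_mult_nonzero[OF b \<zeta>])
  ultimately show ?thesis
    by (simp add: E_def norm_divide norm_power field_simps)
qed

section \<open>The bilinear pairing on complex n-space\<close>

definition bdot :: "complex ^ 'n \<Rightarrow> complex ^ 'n \<Rightarrow> complex" where
  "bdot a z = (\<Sum>i\<in>UNIV. a $ i * z $ i)"

lemma bdot_simps [simp]:
  "bdot a (x + y) = bdot a x + bdot a y" "bdot a (x - y) = bdot a x - bdot a y"
  "bdot a (c *s x) = c * bdot a x" "bdot a 0 = 0" "bdot a (- x) = - bdot a x"
  "bdot (a + b) x = bdot a x + bdot b x" "bdot (a - b) x = bdot a x - bdot b x"
  "bdot (c *s a) x = c * bdot a x" "bdot 0 x = 0" "bdot (- a) x = - bdot a x"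
  "bdot a (r *\<^sub>R x) = of_real r * bdot a x"
  by (simp_all add: bdot_def algebra_simps sum.distrib sum_subtractf sum_distrib_left sum_negf,
      auto simp: scaleR_sum_right[symmetric] scaleR_conv_of_real)

lemma bdot_axis: "bdot a (axis i 1) = a $ i"
proof -
  have "bdot a (axis i 1) = (\<Sum>j\<in>UNIV. if j = i then a $ i else 0)"
    unfolding bdot_def by (intro sum.cong) (auto simp: axis_def)
  then show ?thesis by simp
qed

lemma norm_bdot_le: "cmod (bdot a z) \<le> norm a * norm z"
proof -
  have "cmod (bdot a z) \<le> (\<Sum>i\<in>UNIV. \<bar>cmod (a $ i)\<bar> * \<bar>cmod (z $ i)\<bar>)"
    unfolding bdot_def by (rule order_trans[OF norm_sum]) (simp add: norm_mult)
  also have "\<dots> \<le> norm a * norm z"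
    unfolding norm_vec_def by (rule L2_set_mult_ineq)
  finally show ?thesis .
qed

lemma bounded_linear_bdot: "bounded_linear (bdot a)"
proof (rule bounded_linear_intro)
  show "norm (bdot a x) \<le> norm x * norm a" for x
    using norm_bdot_le[of a x] by (simp add: mult.commute)
qed (simp_all add: scaleR_conv_of_real[where 'a = complex])

lemma norm_axis_one: "norm (axis i (1::complex)) = 1"
  by (simp add: norm_eq_1 inner_axis_axis)

lemma holomorphic_on_bdot:
  fixes h f :: "complex \<Rightarrow> complex ^ 'n"
  assumes "\<And>i. (\<lambda>\<zeta>. h \<zeta> $ i) holomorphic_on S" "\<And>i. (\<lambda>\<zeta>. f \<zeta> $ i) holomorphic_on S"
  shows "(\<lambda>\<zeta>. bdot (h \<zeta>) (f \<zeta>)) holomorphic_on S"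
  unfolding bdot_def by (intro holomorphic_intros assms)

lemma inner_eq_bdot: "inner a z = Re (bdot (\<chi> i. cnj (a $ i)) z)"
  by (simp add: inner_vec_def bdot_def inner_complex_def)

lemma vector_sum_axis: "(\<Sum>i\<in>UNIV. (w $ i) *s axis i 1) = (w :: complex ^ 'n)"
  by (simp add: vec_eq_iff axis_def if_distrib[where f = "\<lambda>x. _ * x"] sum.delta' cong: if_cong)

lemma continuous_on_vector_scalar:
  fixes w :: "complex ^ 'n"
  assumes "continuous_on S q" shows "continuous_on S (\<lambda>\<eta>. q \<eta> *s w)"
proof -
  have "continuous_on S (\<lambda>\<eta>. \<chi> i. q \<eta> * w $ i)"
    by (intro continuous_on_vec_lambda continuous_intros assms)
  then show ?thesis by (simp add: vector_scalar_mult_def)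
qed

lemma norm_vector_scalar: "norm (c *s (w :: complex ^ 'n)) = cmod c * norm w"
  by (simp add: norm_vec_def norm_mult L2_set_right_distrib)

lemma scaleR_eq_vector_scalar: "(c *\<^sub>R z :: complex ^ 'n) = of_real c *s z"
  by (simp add: vec_eq_iff scaleR_conv_of_real[where 'a = complex])

lemma bounded_linear_vector_scalar: "bounded_linear (\<lambda>c. c *s (w :: complex ^ 'n))"
proof (rule bounded_linear_intro)
  show "norm (c *s w) \<le> norm c * norm w" for c by (simp add: norm_vector_scalar)
qed (simp_all add: vector_sadd_rdistrib vec_eq_iff)

section \<open>The left inverse defined by a holomorphic family of hyperplanes\<close>

text \<open>At a boundary point \<open>\<phi>(\<zeta>)\<close> the vector \<open>cnj \<zeta> h(\<zeta>)\<close> would define a supporting hyperplane of \<open>D\<close>. The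
  last hypothesis expresses this in the open disc, where the defect \<open>C (1 - |\<zeta>|\<^sup>2)\<close> is uniform in \<open>w\<close>.\<close>

locale supporting_field =
  fixes D :: "(complex ^ 'n) set" and \<phi> h :: "complex \<Rightarrow> complex ^ 'n" and C :: real
  assumes open_D: "open D" and conn_D: "connected D"
    and \<phi>: "analytic_disc D \<phi>"
    and hol_h: "\<And>i. (\<lambda>\<zeta>. h \<zeta> $ i) holomorphic_on unit_disc"
    and h0: "h 0 \<noteq> 0"
    and supp: "\<And>w \<zeta>. w \<in> D \<Longrightarrow> cmod \<zeta> < 1 \<Longrightarrow>
       - C * (1 - (cmod \<zeta>)\<^sup>2) \<le> Re (cnj \<zeta> * bdot (h \<zeta>) (\<phi> \<zeta> - w))"
begin

definition g :: "complex ^ 'n \<Rightarrow> complex \<Rightarrow> complex" where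
  "g w \<zeta> = bdot (h \<zeta>) (\<phi> \<zeta> - w)"

lemma hol_g: "g w holomorphic_on unit_disc"
  unfolding g_def using \<phi> hol_h
  by (intro holomorphic_on_bdot) (auto simp: analytic_disc_def intro!: holomorphic_intros)

lemma g_add: "g (w + u) \<zeta> = g w \<zeta> - bdot (h \<zeta>) u"
  by (simp add: g_def algebra_simps)

text \<open>Moving \<open>w\<close> by \<open>c u\<close> with \<open>|c| = 1\<close> stays in \<open>D\<close> and changes \<open>g w\<close> by a multiple of \<open>h \<cdot> u\<close>, so
  the phase of \<open>c\<close> can be chosen to make the perturbation as unfavourable as possible.\<close>

lemma domination:
  assumes ball: "ball w \<epsilon> \<subseteq> D" and u: "norm u < \<epsilon>" and b: "cmod b < 1"
    and k: "k holomorphic_on unit_disc" "\<And>\<zeta>. cmod \<zeta> < 1 \<Longrightarrow> g w \<zeta> = (\<zeta> - b) * k \<zeta>"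
    and \<zeta>: "cmod \<zeta> < 1"
  shows "cmod (bdot (h \<zeta>) u) \<le> (cmod (1 - cnj b * \<zeta>))\<^sup>2 * Re (k \<zeta> / (1 - cnj b * \<zeta>))"
proof (rule generator_domination[OF k(1) _ b _ \<zeta>])
  show "(\<lambda>\<zeta>. bdot (h \<zeta>) u) holomorphic_on unit_disc"
    by (intro holomorphic_on_bdot hol_h) auto
  fix \<zeta> :: complex assume \<zeta>: "cmod \<zeta> < 1"
  obtain c where c: "cmod c = 1" "c * (cnj \<zeta> * bdot (h \<zeta>) u) = of_real (cmod (cnj \<zeta> * bdot (h \<zeta>) u))"
    using exists_phase by blast
  have "norm (c *s u) = norm u"
    using c(1) by (simp add: norm_vec_def norm_mult)
  then have "w + c *s u \<in> D" using ball u by (auto simp: dist_norm)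
  from supp[OF this \<zeta>]
  have "- C * (1 - (cmod \<zeta>)\<^sup>2) \<le> Re (cnj \<zeta> * g w \<zeta> - c * (cnj \<zeta> * bdot (h \<zeta>) u))"
    by (simp add: g_add[unfolded g_def] g_def algebra_simps)
  then show "- C * (1 - (cmod \<zeta>)\<^sup>2) + cmod \<zeta> * cmod (bdot (h \<zeta>) u)
      \<le> Re (cnj \<zeta> * ((\<zeta> - b) * k \<zeta>))"
    using k(2)[OF \<zeta>] by (simp add: c(2) norm_mult)
qed

lemma ball_in_D: "w \<in> D \<Longrightarrow> \<exists>\<epsilon>>0. ball w \<epsilon> \<subseteq> D"
  using open_D openE by blast

text \<open>If the real part vanished somewhere, it would vanish identically, and \<open>domination\<close> would force \<open>h(0)\<close>
  to annihilate all small vectors.\<close>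

lemma quotient_pos:
  assumes w: "w \<in> D" and b: "cmod b < 1"
    and k: "k holomorphic_on unit_disc" "\<And>\<zeta>. cmod \<zeta> < 1 \<Longrightarrow> g w \<zeta> = (\<zeta> - b) * k \<zeta>"
    and \<zeta>: "cmod \<zeta> < 1"
  shows "0 < Re (k \<zeta> / (1 - cnj b * \<zeta>))"
proof (rule ccontr)
  let ?p = "\<lambda>\<zeta>. k \<zeta> / (1 - cnj b * \<zeta>)"
  obtain \<epsilon> where \<epsilon>: "\<epsilon> > 0" "ball w \<epsilon> \<subseteq> D" using ball_in_D[OF w] by blast
  have nn: "0 \<le> Re (?p z)" if "cmod z < 1" for z
  proof -
    have "0 \<le> (cmod (1 - cnj b * z))\<^sup>2 * Re (?p z)"
      using domination[OF \<epsilon>(2) _ b k that, of 0] \<epsilon>(1) by simp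
    then show ?thesis
      using one_minus_cnj_mult_nonzero[OF b that] by (simp add: zero_le_mult_iff)
  qed
  assume "\<not> 0 < Re (?p \<zeta>)"
  then have z: "Re (?p \<zeta>) = 0" using nn[OF \<zeta>] by simp
  have "?p holomorphic_on unit_disc"
    using one_minus_cnj_mult_nonzero[OF b] by (intro holomorphic_intros k(1)) auto
  then have "Re (?p 0) = 0"
    using nn by (rule Re_zero_of_Re_nonneg[where p = ?p, OF _ _ \<zeta> z]) auto
  then have le: "bdot (h 0) u = 0" if "norm u < \<epsilon>" for u
    using domination[OF \<epsilon>(2) that b k, of 0] by simp
  have "h 0 $ i = 0" for i
  proof -
    have "norm ((\<epsilon> / 2) *\<^sub>R axis i (1::complex) :: complex ^ 'n) < \<epsilon>" using \<epsilon>(1) by (simp add: norm_axis_one)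
    from le[OF this] show ?thesis using \<epsilon>(1) by (simp add: bdot_axis)
  qed
  then show False using h0 by (simp add: vec_eq_iff)
qed

lemma quotient_bound:
  assumes ball: "ball w \<epsilon> \<subseteq> D" and u: "norm u < \<epsilon>" and b: "cmod b < 1"
    and k: "k holomorphic_on unit_disc" "\<And>\<zeta>. cmod \<zeta> < 1 \<Longrightarrow> g w \<zeta> = (\<zeta> - b) * k \<zeta>"
    and \<zeta>: "cmod \<zeta> < 1"
  shows "cmod (bdot (h \<zeta>) u) \<le> cmod (1 - cnj b * \<zeta>) * cmod (k \<zeta>)" and "k \<zeta> \<noteq> 0"
proof -
  have nz: "1 - cnj b * \<zeta> \<noteq> 0" by (rule one_minus_cnj_mult_nonzero[OF b \<zeta>])
  have "cmod (bdot (h \<zeta>) u) \<le> (cmod (1 - cnj b * \<zeta>))\<^sup>2 * Re (k \<zeta> / (1 - cnj b * \<zeta>))"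
    by (rule domination[OF assms])
  also have "\<dots> \<le> (cmod (1 - cnj b * \<zeta>))\<^sup>2 * cmod (k \<zeta> / (1 - cnj b * \<zeta>))"
    by (intro mult_left_mono complex_Re_le_cmod) auto
  also have "\<dots> = cmod (1 - cnj b * \<zeta>) * cmod (k \<zeta>)"
    using nz by (simp add: norm_divide power2_eq_square)
  finally show "cmod (bdot (h \<zeta>) u) \<le> cmod (1 - cnj b * \<zeta>) * cmod (k \<zeta>)" .
  have "0 < \<epsilon>" using u norm_ge_zero[of u] by linarith
  then have "w \<in> D" using ball by auto
  from quotient_pos[OF this b k \<zeta>] show "k \<zeta> \<noteq> 0" by auto
qed

text \<open>A Schwarz lemma for the zero. If \<open>g w \<zeta> = (\<zeta> - b) k(\<zeta>)\<close>, then the equation \<open>(b' - b) k(b') = s h(b') \<cdot> u\<close> is compared with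
  \<open>quotient_bound\<close>. For \<open>s = 0\<close> it gives uniqueness of the zero, in general Lipschitz continuity.\<close>

lemma zero_moves_slowly:
  assumes ball: "ball w \<epsilon> \<subseteq> D" and u: "norm u < \<epsilon>" and s: "0 \<le> s"
    and b: "cmod b < 1" "g w b = 0" and b': "cmod b' < 1" "g (w + s *\<^sub>R u) b' = 0"
  shows "cmod (b' - b) \<le> 2 * s"
proof -
  obtain k where k: "k holomorphic_on unit_disc" "\<And>\<zeta>. cmod \<zeta> < 1 \<Longrightarrow> g w \<zeta> = (\<zeta> - b) * k \<zeta>"
    using holomorphic_divide_zero[OF hol_g b(2,1)] by blast
  note q = quotient_bound[OF ball u b(1) k b'(1)]
  have "(b' - b) * k b' = of_real s * bdot (h b') u"
    using b'(2) k(2)[OF b'(1)] by (simp add: g_add)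
  then have "cmod (b' - b) * cmod (k b') = s * cmod (bdot (h b') u)"
    using s by (metis norm_mult norm_of_real abs_of_nonneg)
  also have "\<dots> \<le> s * (cmod (1 - cnj b * b') * cmod (k b'))"
    by (intro mult_left_mono q s)
  finally have 1: "cmod (b' - b) \<le> s * cmod (1 - cnj b * b')"
    using q(2) by (simp add: mult.assoc[symmetric])
  have "cmod (1 - cnj b * b') \<le> 1 + cmod b * cmod b'"
    using norm_triangle_ineq4[of 1 "cnj b * b'"] by (simp add: norm_mult)
  also have "cmod b * cmod b' \<le> 1"
    using b b' by (intro mult_le_one) auto
  finally have "s * cmod (1 - cnj b * b') \<le> s * 2" by (intro mult_left_mono s) auto
  then show ?thesis using 1 by simp
qed

lemma zero_unique:
  assumes "w \<in> D" "cmod b < 1" "g w b = 0" "cmod b' < 1" "g w b' = 0"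
  shows "b' = b"
proof -
  obtain \<epsilon> where \<epsilon>: "\<epsilon> > 0" "ball w \<epsilon> \<subseteq> D" using ball_in_D[OF assms(1)] by blast
  have "cmod (b' - b) \<le> 2 * 0"
    by (rule zero_moves_slowly[OF \<epsilon>(2), of 0]) (use assms \<epsilon> in auto)
  then show ?thesis by simp
qed

text \<open>If \<open>g (w + u)\<close> had no zero, then \<open>g w / g (w + u)\<close> would be holomorphic. By \<open>quotient_bound\<close> the two functions
  are so close on circles near the unit circle that the real part of this quotient is at least one
  half there, and hence also inside; but the quotient vanishes at \<open>b\<close>.\<close>

lemma zero_persists:
  assumes ball: "ball w \<epsilon> \<subseteq> D" and u: "norm u < \<epsilon>" and b: "cmod b < 1" "g w b = 0"
  shows "\<exists>b'. cmod b' < 1 \<and> g (w + u) b' = 0"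
proof (rule ccontr)
  assume no: "\<nexists>b'. cmod b' < 1 \<and> g (w + u) b' = 0"
  have \<epsilon>: "\<epsilon> > 0" using u norm_ge_zero[of u] by linarith
  obtain k where k: "k holomorphic_on unit_disc" "\<And>\<zeta>. cmod \<zeta> < 1 \<Longrightarrow> g w \<zeta> = (\<zeta> - b) * k \<zeta>"
    using holomorphic_divide_zero[OF hol_g b(2,1)] by blast
  obtain s where s: "norm u / \<epsilon> < s" "s < 1"
    using dense[of "norm u / \<epsilon>" 1] u \<epsilon> by auto
  have s0: "s > 0" using s(1) \<epsilon> by (meson divide_nonneg_pos norm_ge_zero le_less_trans)
  define v where "v = (1 / s) *\<^sub>R u"
  have v: "norm v < \<epsilon>" using s \<epsilon> s0 by (simp add: v_def field_simps)
  have uv: "u = s *\<^sub>R v" using s0 by (simp add: v_def)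
  have "((\<lambda>r. (1 - s) * (r - cmod b) - s * (1 - r\<^sup>2)) \<longlongrightarrow> (1 - s) * (1 - cmod b) - s * (1 - 1\<^sup>2)) (at_left (1::real))"
    by (intro tendsto_intros)
  then have "\<forall>\<^sub>F r in at_left 1. 0 < (1 - s) * (r - cmod b) - s * (1 - r\<^sup>2)"
    using s b by (intro order_tendstoD(1)) auto
  moreover have "\<forall>\<^sub>F r in at_left 1. cmod b < r \<and> r < 1"
    using eventually_at_left_real[of "cmod b" 1] b by (auto elim: eventually_mono)
  ultimately have "\<forall>\<^sub>F r in at_left 1. s * (1 - r\<^sup>2) \<le> (1 - s) * (r - cmod b) \<and> cmod b < r \<and> r < 1"
    by eventually_elim auto
  moreover have "at_left (1::real) \<noteq> bot" by simp
  ultimately obtain r where r: "s * (1 - r\<^sup>2) \<le> (1 - s) * (r - cmod b)" "cmod b < r" "r < 1"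
    using eventually_happens' by blast
  have "1 / 2 \<le> Re (g w b / g (w + u) b)"
  proof (rule Re_ge_of_boundary[where f = "\<lambda>\<zeta>. g w \<zeta> / g (w + u) \<zeta>" and r = r])
    show "(\<lambda>\<zeta>. g w \<zeta> / g (w + u) \<zeta>) holomorphic_on unit_disc"
      using no by (intro holomorphic_intros hol_g) auto
    show "0 < r" using r(2) norm_ge_zero[of b] by linarith
    fix \<zeta> assume \<zeta>: "cmod \<zeta> = r"
    then have \<zeta>1: "cmod \<zeta> < 1" using r by simp
    have zz: "cnj \<zeta> * \<zeta> = of_real (r\<^sup>2)"
      using \<zeta> by (metis complex_norm_square mult.commute)
    have "1 - b * cnj \<zeta> = cnj \<zeta> * (\<zeta> - b) + of_real (1 - r\<^sup>2)"
      using zz by (simp add: algebra_simps)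
    then have "cmod (1 - b * cnj \<zeta>) \<le> cmod (cnj \<zeta> * (\<zeta> - b)) + cmod (of_real (1 - r\<^sup>2))"
      by (simp only: norm_triangle_ineq)
    then have "cmod (1 - b * cnj \<zeta>) \<le> r * cmod (\<zeta> - b) + \<bar>1 - r\<^sup>2\<bar>"
      using \<zeta> by (simp only: norm_mult complex_mod_cnj norm_of_real)
    moreover have "r\<^sup>2 \<le> 1" using r \<open>0 < r\<close> by (simp add: power_le_one)
    moreover have "cmod (1 - cnj b * \<zeta>) = cmod (1 - b * cnj \<zeta>)"
      by (metis complex_cnj_cnj complex_cnj_diff complex_cnj_mult complex_cnj_one complex_mod_cnj)
    ultimately have "cmod (1 - cnj b * \<zeta>) \<le> r * cmod (\<zeta> - b) + (1 - r\<^sup>2)"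
      by simp
    moreover have "r * cmod (\<zeta> - b) \<le> 1 * cmod (\<zeta> - b)"
      using r by (intro mult_right_mono) auto
    ultimately have "s * cmod (1 - cnj b * \<zeta>) \<le> s * (cmod (\<zeta> - b) + (1 - r\<^sup>2))"
      using s0 by (intro mult_left_mono) auto
    also have "\<dots> \<le> s * cmod (\<zeta> - b) + (1 - s) * (r - cmod b)"
      using r(1) by (simp add: algebra_simps)
    also have "(1 - s) * (r - cmod b) \<le> (1 - s) * cmod (\<zeta> - b)"
      using norm_triangle_ineq2[of \<zeta> b] \<zeta> s by (intro mult_left_mono) auto
    finally have *: "s * cmod (1 - cnj b * \<zeta>) \<le> cmod (\<zeta> - b)" by (simp add: algebra_simps)
    have "cmod (g w \<zeta> - g (w + u) \<zeta>) = s * cmod (bdot (h \<zeta>) v)"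
      using s0 by (simp add: g_add uv norm_mult)
    also have "\<dots> \<le> s * (cmod (1 - cnj b * \<zeta>) * cmod (k \<zeta>))"
      using s0 by (intro mult_left_mono quotient_bound[OF ball v b(1) k \<zeta>1]) auto
    also have "\<dots> \<le> cmod (\<zeta> - b) * cmod (k \<zeta>)"
      using mult_right_mono[OF *, of "cmod (k \<zeta>)"] by (simp add: mult.assoc)
    also have "\<dots> = cmod (g w \<zeta>)" by (simp add: k(2)[OF \<zeta>1] norm_mult)
    finally show "1 / 2 \<le> Re (g w \<zeta> / g (w + u) \<zeta>)"
      using no \<zeta>1 by (intro Re_divide_ge_half) auto
  qed (use r in auto)
  then show False using b by simp
qed

text \<open>The set of \<open>w\<close> for which there is a zero contains \<open>\<phi> 0\<close>, and with each point it contains every ball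
  about this point that lies in \<open>D\<close>. So it is open and closed in \<open>D\<close>.\<close>

lemma zero_exists:
  assumes "w \<in> D" shows "\<exists>b. cmod b < 1 \<and> g w b = 0"
proof -
  define W where "W = {w \<in> D. \<exists>b. cmod b < 1 \<and> g w b = 0}"
  have "\<phi> 0 \<in> D" using \<phi> by (auto simp: analytic_disc_def)
  then have "\<phi> 0 \<in> W" by (auto simp: W_def g_def intro!: exI[of _ 0])
  have step: "w + u \<in> W" if "w \<in> W" "ball w \<epsilon> \<subseteq> D" "norm u < \<epsilon>" for w u \<epsilon>
    using that zero_persists[of w \<epsilon> u] by (auto simp: W_def dist_norm)
  have "open W"
  proof (rule Topological_Spaces.openI)
    fix w assume w: "w \<in> W"
    then obtain \<epsilon> where \<epsilon>: "\<epsilon> > 0" "ball w \<epsilon> \<subseteq> D" using ball_in_D by (auto simp: W_def)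
    have "ball w \<epsilon> \<subseteq> W"
    proof
      fix x assume "x \<in> ball w \<epsilon>"
      then show "x \<in> W"
        using step[OF w \<epsilon>(2), of "x - w"] by (simp add: dist_norm norm_minus_commute)
    qed
    then show "\<exists>T. open T \<and> w \<in> T \<and> T \<subseteq> W" using \<epsilon>(1) by (intro exI[of _ "ball w \<epsilon>"]) auto
  qed
  moreover have "open (D - W)"
  proof (rule Topological_Spaces.openI)
    fix w assume w: "w \<in> D - W"
    then obtain \<epsilon> where \<epsilon>: "\<epsilon> > 0" "ball w \<epsilon> \<subseteq> D" using ball_in_D by blast
    have "ball w (\<epsilon> / 2) \<subseteq> D - W"
    proof
      fix x assume x: "x \<in> ball w (\<epsilon> / 2)"
      have sub: "ball x (\<epsilon> / 2) \<subseteq> D"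
      proof
        fix y assume "y \<in> ball x (\<epsilon> / 2)"
        then have "dist w y < \<epsilon>" using x dist_triangle[of w y x] by auto
        then show "y \<in> D" using \<epsilon> by auto
      qed
      have "x \<notin> W"
        using step[OF _ sub, of "w - x"] x w by (auto simp: dist_norm)
      moreover have "x \<in> D" using x \<epsilon> by auto
      ultimately show "x \<in> D - W" by simp
    qed
    then show "\<exists>T. open T \<and> w \<in> T \<and> T \<subseteq> D - W"
      using \<epsilon>(1) by (intro exI[of _ "ball w (\<epsilon> / 2)"]) auto
  qed
  ultimately have "W = {} \<or> D - W = {}"
    using connectedD[OF conn_D, of W "D - W"] by (auto simp: W_def)
  then show ?thesis using \<open>\<phi> 0 \<in> W\<close> assms by (auto simp: W_def)
qed

definition \<rho> :: "complex ^ 'n \<Rightarrow> complex" where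
  "\<rho> w = (THE b. cmod b < 1 \<and> g w b = 0)"

lemma \<rho>: assumes "w \<in> D" shows "cmod (\<rho> w) < 1" "g w (\<rho> w) = 0"
proof -
  have "\<exists>!b. cmod b < 1 \<and> g w b = 0" using zero_exists[OF assms] zero_unique[OF assms] by blast
  from theI'[OF this] show "cmod (\<rho> w) < 1" "g w (\<rho> w) = 0" by (auto simp: \<rho>_def)
qed

lemma \<rho>_eqI: "w \<in> D \<Longrightarrow> cmod b < 1 \<Longrightarrow> g w b = 0 \<Longrightarrow> \<rho> w = b"
  using \<rho> zero_unique by blast

lemma \<rho>_eq_iff: "w \<in> D \<Longrightarrow> cmod b < 1 \<Longrightarrow> \<rho> w = b \<longleftrightarrow> g w b = 0"
  using \<rho> \<rho>_eqI by blast

lemma \<rho>_\<phi>: "cmod \<zeta> < 1 \<Longrightarrow> \<rho> (\<phi> \<zeta>) = \<zeta>"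
  using \<phi> by (intro \<rho>_eqI) (auto simp: analytic_disc_def g_def)

lemma h_nonzero:
  assumes "cmod \<zeta> < 1" shows "h \<zeta> \<noteq> 0"
proof
  assume "h \<zeta> = 0"
  then have const: "\<rho> w = \<zeta>" if "w \<in> D" for w
    using that assms by (intro \<rho>_eqI) (auto simp: g_def)
  have "\<phi> 0 \<in> D" "\<phi> (1/2) \<in> D" using \<phi> by (auto simp: analytic_disc_def)
  then show False using const \<rho>_\<phi>[of 0] \<rho>_\<phi>[of "1/2"] by simp
qed

text \<open>The zero \<open>\<zeta>\<close> of \<open>g (w + u)\<close> satisfies \<open>\<zeta> - \<rho> w = H(\<zeta>) \<cdot> u\<close> with \<open>H = h / k\<close>,
  where \<open>k(\<zeta>) = g w \<zeta> / (\<zeta> - \<rho> w)\<close> has no zeros. Since \<open>\<rho>\<close> is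
  continuous at \<open>w\<close>, the derivative is \<open>u \<mapsto> H(\<rho> w) \<cdot> u\<close>.\<close>

lemma \<rho>_has_derivative:
  assumes w: "w \<in> D" shows "\<exists>a. (\<rho> has_derivative bdot a) (at w)"
proof -
  let ?b = "\<rho> w"
  note b = \<rho>[OF w]
  obtain k where k: "k holomorphic_on unit_disc" "\<And>\<zeta>. cmod \<zeta> < 1 \<Longrightarrow> g w \<zeta> = (\<zeta> - ?b) * k \<zeta>"
    using holomorphic_divide_zero[OF hol_g b(2,1)] by blast
  obtain \<epsilon> where \<epsilon>: "\<epsilon> > 0" "ball w \<epsilon> \<subseteq> D" using ball_in_D[OF w] by blast
  have knz: "k \<zeta> \<noteq> 0" if "cmod \<zeta> < 1" for \<zeta>
    using quotient_bound(2)[OF \<epsilon>(2) _ b(1) k that, of 0] \<epsilon>(1) by simp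
  define H where "H \<zeta> = (\<chi> i. h \<zeta> $ i / k \<zeta>)" for \<zeta>
  have H: "bdot (H \<zeta>) u = bdot (h \<zeta>) u / k \<zeta>" for \<zeta> u
    by (simp add: H_def bdot_def sum_divide_distrib)
  have "(\<lambda>\<zeta>. h \<zeta> $ i / k \<zeta>) holomorphic_on unit_disc" for i
    using knz by (intro holomorphic_intros k(1) hol_h) auto
  then have "continuous_on unit_disc H"
    unfolding H_def by (intro continuous_on_vec_lambda holomorphic_on_imp_continuous_on)
  then have Hc: "isCont H ?b" using b by (simp add: continuous_on_eq_continuous_at)
  have close: "cmod (\<rho> (w + u) - ?b) \<le> 4 * norm u / \<epsilon>" "w + u \<in> D"
      if "norm u < \<epsilon> / 2" for u
  proof -
    show D: "w + u \<in> D" using that \<epsilon> by (auto simp: dist_norm)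
    show "cmod (\<rho> (w + u) - ?b) \<le> 4 * norm u / \<epsilon>"
    proof (cases "u = 0")
      case False
      define v where "v = (\<epsilon> / (2 * norm u)) *\<^sub>R u"
      have "norm v < \<epsilon>" "u = (2 * norm u / \<epsilon>) *\<^sub>R v"
        using False \<epsilon> by (auto simp: v_def)
      then have "cmod (\<rho> (w + u) - ?b) \<le> 2 * (2 * norm u / \<epsilon>)"
        using \<rho>[OF D] b \<epsilon> by (intro zero_moves_slowly[of w \<epsilon> v]) auto
      then show ?thesis by simp
    qed (use \<epsilon> in simp)
  qed
  have "(\<rho> has_derivative bdot (H ?b)) (at w)"
    unfolding has_derivative_at_alt
  proof (intro conjI allI impI bounded_linear_bdot)
    fix e :: real assume "0 < e"
    then obtain \<delta> where \<delta>: "\<delta> > 0" "\<And>\<zeta>. dist \<zeta> ?b < \<delta> \<Longrightarrow> dist (H \<zeta>) (H ?b) < e"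
      using Hc unfolding continuous_at_eps_delta by blast
    let ?d = "min (\<epsilon> / 2) (\<delta> * \<epsilon> / 4)"
    have "norm (\<rho> y - \<rho> w - bdot (H ?b) (y - w)) \<le> e * norm (y - w)" if y: "norm (y - w) < ?d" for y
    proof -
      define u where "u = y - w"
      have yu: "y = w + u" by (simp add: u_def)
      have u: "norm u < \<epsilon> / 2" "norm u < \<delta> * \<epsilon> / 4" using y by (auto simp: u_def)
      note c = close[OF u(1), folded yu]
      let ?z = "\<rho> y"
      note z = \<rho>[OF c(2)]
      have "4 * norm u / \<epsilon> < \<delta>" using u(2) \<epsilon>(1) by (simp add: field_simps)
      then have "norm (H ?z - H ?b) \<le> e" using \<delta>(2)[of ?z] c(1) by (simp add: dist_norm)
      have "(?z - ?b) * k ?z = bdot (h ?z) u"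
        using z k(2)[OF z(1)] by (simp add: yu g_add)
      then have "?z - ?b = bdot (H ?z) u"
        using knz[OF z(1)] by (simp add: H field_simps)
      then have "\<rho> y - \<rho> w - bdot (H ?b) (y - w) = bdot (H ?z) u - bdot (H ?b) u"
        by (simp only: u_def)
      also have "\<dots> = bdot (H ?z - H ?b) u" by simp
      finally have "norm (\<rho> y - \<rho> w - bdot (H ?b) (y - w)) = norm (bdot (H ?z - H ?b) u)"
        by (rule arg_cong)
      also have "\<dots> \<le> norm (H ?z - H ?b) * norm u" by (rule norm_bdot_le)
      also have "\<dots> \<le> e * norm u" using \<open>norm (H ?z - H ?b) \<le> e\<close> by (intro mult_right_mono) auto
      finally show ?thesis by (simp add: u_def)
    qed
    moreover have "?d > 0" using \<delta> \<epsilon> by simp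
    ultimately show "\<exists>d>0. \<forall>y. norm (y - w) < d \<longrightarrow> norm (\<rho> y - \<rho> w - bdot (H ?b) (y - w)) \<le> e * norm (y - w)"
      by blast
  qed
  then show ?thesis by blast
qed

end

section \<open>Extension of positive functionals\<close>

text \<open>The extension theorem of M. Riesz for a cone \<open>K\<close> with order unit \<open>e\<close>. A partially defined functional is
  represented by its graph, a subspace of \<open>'a \<times> real\<close>; positivity on \<open>K\<close> already makes a subspace
  the graph of a function, because \<open>0 \<in> K\<close>. Zorn's lemma yields a maximal positive graph. To extend it by a
  vector \<open>x\<close> one assigns to \<open>x\<close> the supremum of the values at elements below \<open>x\<close>.\<close>

lemma riesz_extension:
  fixes K :: "'a::real_vector set" and S :: "('a \<times> real) set"
  assumes K0: "0 \<in> K" and Kadd: "\<And>x y. x \<in> K \<Longrightarrow> y \<in> K \<Longrightarrow> x + y \<in> K"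
    and Kscale: "\<And>c x. 0 < c \<Longrightarrow> x \<in> K \<Longrightarrow> c *\<^sub>R x \<in> K"
    and unit: "\<And>x. \<exists>t. t *\<^sub>R e - x \<in> K" and e: "(e, m) \<in> S"
    and S: "subspace S" and pos: "\<And>x t. (x, t) \<in> S \<Longrightarrow> x \<in> K \<Longrightarrow> 0 \<le> t"
  obtains \<Psi> where "linear \<Psi>" "\<And>x. x \<in> K \<Longrightarrow> 0 \<le> \<Psi> x" "\<And>x t. (x, t) \<in> S \<Longrightarrow> \<Psi> x = t"
proof -
  \<comment> \<open>Graphs of positive functionals that extend the given one.\<close>
  define \<A> where "\<A> = {G. subspace G \<and> S \<subseteq> G \<and> (\<forall>x t. (x, t) \<in> G \<longrightarrow> x \<in> K \<longrightarrow> 0 \<le> t)}"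
  have "\<exists>M\<in>\<A>. \<forall>X\<in>\<A>. M \<subseteq> X \<longrightarrow> X = M"
  proof (rule subset_Zorn_nonempty)
    show "\<A> \<noteq> {}" using S pos by (auto simp: \<A>_def)
    fix \<C> assume \<C>: "\<C> \<noteq> {}" "subset.chain \<A> \<C>"
    then have sub: "\<C> \<subseteq> \<A>" and tot: "\<And>A B. A \<in> \<C> \<Longrightarrow> B \<in> \<C> \<Longrightarrow> A \<subseteq> B \<or> B \<subseteq> A"
      by (auto simp: subset_chain_def)
    have "subspace (\<Union>\<C>)"
      unfolding subspace_def
    proof (intro conjI ballI allI)
      show "0 \<in> \<Union>\<C>" using \<C>(1) sub by (auto simp: \<A>_def subspace_def)
      show "x + y \<in> \<Union>\<C>" if xy: "x \<in> \<Union>\<C>" "y \<in> \<Union>\<C>" for x y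
      proof -
        obtain A B where "A \<in> \<C>" "B \<in> \<C>" "x \<in> A" "y \<in> B" using xy by blast
        then obtain G where "G \<in> \<C>" "x \<in> G" "y \<in> G" using tot by blast
        moreover have "subspace G" using sub \<open>G \<in> \<C>\<close> by (auto simp: \<A>_def)
        ultimately show ?thesis using subspace_add by blast
      qed
      show "c *\<^sub>R x \<in> \<Union>\<C>" if x: "x \<in> \<Union>\<C>" for c x
      proof -
        obtain G where "G \<in> \<C>" "x \<in> G" using x by blast
        moreover have "subspace G" using sub \<open>G \<in> \<C>\<close> by (auto simp: \<A>_def)
        ultimately show ?thesis using subspace_scale by blast
      qed
    qed
    moreover have "S \<subseteq> \<Union>\<C>" using \<C>(1) sub by (auto simp: \<A>_def)
    ultimately show "\<Union>\<C> \<in> \<A>" using sub by (auto simp: \<A>_def)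
  qed
  then obtain M where M: "subspace M" "S \<subseteq> M" "\<And>x t. (x, t) \<in> M \<Longrightarrow> x \<in> K \<Longrightarrow> 0 \<le> t"
    and max: "\<And>X. X \<in> \<A> \<Longrightarrow> M \<subseteq> X \<Longrightarrow> X = M" by (auto simp: \<A>_def)
  have M_add: "(x + y, s + t) \<in> M" if "(x, s) \<in> M" "(y, t) \<in> M" for x y s t
    using subspace_add[OF M(1) that] by simp
  have M_scale: "(c *\<^sub>R x, c * s) \<in> M" if "(x, s) \<in> M" for x c s
    using subspace_scale[OF M(1) that, of c] by simp
  have M_diff: "(x - y, s - t) \<in> M" if "(x, s) \<in> M" "(y, t) \<in> M" for x y s t
    using subspace_diff[OF M(1) that] by simp
  have total: "\<exists>t. (x, t) \<in> M" for x
  proof -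
    define L where "L = {s. \<exists>y. (y, s) \<in> M \<and> x - y \<in> K}"
    define a where "a = Sup L"
    have le: "s \<le> t" if s: "s \<in> L" and t: "(y, t) \<in> M" "y - x \<in> K" for s t y
    proof -
      obtain z where z: "(z, s) \<in> M" "x - z \<in> K" using s by (auto simp: L_def)
      have "y - z \<in> K" using Kadd[OF t(2) z(2)] by simp
      then show ?thesis using M(3)[OF M_diff[OF t(1) z(1)]] by simp
    qed
    obtain t1 where t1: "t1 *\<^sub>R e - (- x) \<in> K" using unit by blast
    moreover have "((- t1) *\<^sub>R e, (- t1) * m) \<in> M" using e M(2) by (intro M_scale) auto
    ultimately have "(- t1) * m \<in> L"
      by (auto simp: L_def add.commute intro!: exI[of _ "(- t1) *\<^sub>R e"])
    then have Lne: "L \<noteq> {}" by auto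
    obtain t2 where t2: "t2 *\<^sub>R e - x \<in> K" using unit by blast
    have "\<And>s. s \<in> L \<Longrightarrow> s \<le> t2 * m"
      using le M_scale[of e m t2] e M(2) t2 by blast
    then have Lbdd: "bdd_above L" by (auto simp: bdd_above_def)
    have a_lower: "s \<le> a" if "s \<in> L" for s
      unfolding a_def by (rule cSup_upper[OF that Lbdd])
    have a_upper: "a \<le> t" if "(y, t) \<in> M" "y - x \<in> K" for t y
      unfolding a_def by (rule cSup_least[OF Lne le[OF _ that]])
    define M' where "M' = {(y + c *\<^sub>R x, s + c * a) |y s c. (y, s) \<in> M}"
    have M'I: "(y + c *\<^sub>R x, s + c * a) \<in> M'" if "(y, s) \<in> M" for y s c
      using that by (auto simp: M'_def)
    have "subspace M'"
      unfolding subspace_def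
    proof (intro conjI ballI allI)
      have "(0, 0) \<in> M" using subspace_0[OF M(1)] by (simp add: zero_prod_def)
      from M'I[OF this, of 0] show "0 \<in> M'" by (simp add: zero_prod_def)
      fix p assume "p \<in> M'"
      then obtain y s c where p: "p = (y + c *\<^sub>R x, s + c * a)" "(y, s) \<in> M" by (auto simp: M'_def)
      show "k *\<^sub>R p \<in> M'" for k
        using M'I[OF M_scale[OF p(2), of k], of "k * c"] p(1) by (simp add: algebra_simps)
      fix q assume "q \<in> M'"
      then obtain y' s' c' where q: "q = (y' + c' *\<^sub>R x, s' + c' * a)" "(y', s') \<in> M" by (auto simp: M'_def)
      show "p + q \<in> M'"
        using M'I[OF M_add[OF p(2) q(2)], of "c + c'"] p(1) q(1) by (simp add: algebra_simps)
    qed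
    moreover have MM': "M \<subseteq> M'"
    proof
      fix p assume "p \<in> M"
      then show "p \<in> M'" using M'I[of "fst p" "snd p" 0] by simp
    qed
    moreover have "0 \<le> t" if "(z, t) \<in> M'" "z \<in> K" for z t
    proof -
      from that(1) obtain y s c where z: "z = y + c *\<^sub>R x" "t = s + c * a" "(y, s) \<in> M"
        by (auto simp: M'_def)
      consider "c = 0" | "c > 0" | "c < 0" by linarith
      then show ?thesis
      proof cases
        case 1 then show ?thesis using M(3)[OF z(3)] that z by simp
      next
        case 2
        have "(1 / c) *\<^sub>R z \<in> K" using 2 that by (intro Kscale) auto
        then have "x - (- 1 / c) *\<^sub>R y \<in> K" using 2 by (simp add: z(1) scaleR_add_right add.commute)
        then have "(- 1 / c) * s \<in> L"
          unfolding L_def using M_scale[OF z(3), of "- 1 / c"] by blast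
        from a_lower[OF this] show ?thesis using 2 by (simp add: z(2) field_simps)
      next
        case 3
        have "(- 1 / c) *\<^sub>R z \<in> K" using 3 that by (intro Kscale) auto
        then have "(- 1 / c) *\<^sub>R y - x \<in> K" using 3 by (simp add: z(1) scaleR_add_right)
        from a_upper[OF M_scale[OF z(3)] this] show ?thesis using 3 by (simp add: z(2) field_simps)
      qed
    qed
    ultimately have "M' = M" using M(2) by (intro max) (auto simp: \<A>_def)
    moreover have "(0, 0) \<in> M" using subspace_0[OF M(1)] by (simp add: zero_prod_def)
    ultimately have "(x, a) \<in> M" using M'I[of 0 0 1] by simp
    then show ?thesis by blast
  qed
  have unique: "s = t" if "(x, s) \<in> M" "(x, t) \<in> M" for x s t
    using M(3)[OF M_diff[OF that]] M(3)[OF M_diff[OF that(2,1)]] K0 by simp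
  define \<Psi> where "\<Psi> x = (THE t. (x, t) \<in> M)" for x
  have \<Psi>: "(x, \<Psi> x) \<in> M" for x
  proof -
    obtain t where t: "(x, t) \<in> M" using total by blast
    then show ?thesis unfolding \<Psi>_def by (rule theI) (rule unique[OF _ t])
  qed
  have eq: "\<Psi> x = t" if "(x, t) \<in> M" for x t
    using unique[OF \<Psi> that] .
  show ?thesis
  proof (rule that)
    show "linear \<Psi>"
      using eq M_add[OF \<Psi> \<Psi>] M_scale[OF \<Psi>] by (intro linearI) auto
    show "0 \<le> \<Psi> x" if "x \<in> K" for x using M(3)[OF \<Psi> that] .
    show "\<Psi> x = t" if "(x, t) \<in> S" for x t using eq that M(2) by blast
  qed
qed

section \<open>Complex functionals on the circle and their Cauchy transforms\<close>

text \<open>A complex linear functional of norm at most \<open>B\<close> on the continuous functions on the unit circle, written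
  as a function on all functions so that no type of continuous functions on the circle is needed.\<close>

definition circle_functional :: "((complex \<Rightarrow> complex) \<Rightarrow> complex) \<Rightarrow> real \<Rightarrow> bool" where
  "circle_functional T B \<longleftrightarrow>
     (\<forall>p q. continuous_on (sphere 0 1) p \<longrightarrow> continuous_on (sphere 0 1) q \<longrightarrow>
        T (\<lambda>\<eta>. p \<eta> + q \<eta>) = T p + T q) \<and>
     (\<forall>c p. continuous_on (sphere 0 1) p \<longrightarrow> T (\<lambda>\<eta>. c * p \<eta>) = c * T p) \<and>
     (\<forall>p M. continuous_on (sphere 0 1) p \<longrightarrow> (\<forall>\<eta>. cmod \<eta> = 1 \<longrightarrow> cmod (p \<eta>) \<le> M) \<longrightarrow>
        cmod (T p) \<le> B * M)"

text \<open>Every bounded real functional is the real part of a complex linear one.\<close>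

lemma circle_functional_complexify:
  fixes \<Lambda> :: "(complex \<Rightarrow> complex) \<Rightarrow> real"
  assumes add: "\<And>p q. continuous_on (sphere 0 1) p \<Longrightarrow> continuous_on (sphere 0 1) q \<Longrightarrow>
        \<Lambda> (\<lambda>\<eta>. p \<eta> + q \<eta>) = \<Lambda> p + \<Lambda> q"
    and scale: "\<And>c p. continuous_on (sphere 0 1) p \<Longrightarrow> \<Lambda> (\<lambda>\<eta>. of_real c * p \<eta>) = c * \<Lambda> p"
    and bound: "\<And>p M. continuous_on (sphere 0 1) p \<Longrightarrow> (\<And>\<eta>. cmod \<eta> = 1 \<Longrightarrow> cmod (p \<eta>) \<le> M) \<Longrightarrow>
        \<bar>\<Lambda> p\<bar> \<le> B * M"
  obtains T where "circle_functional T (2 * B)"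
    "\<And>p. continuous_on (sphere 0 1) p \<Longrightarrow> Re (T p) = \<Lambda> p"
proof -
  define T where "T p = Complex (\<Lambda> p) (- \<Lambda> (\<lambda>\<eta>. \<i> * p \<eta>))" for p
  have "circle_functional T (2 * B)"
    unfolding circle_functional_def
  proof (intro conjI allI impI)
    fix p :: "complex \<Rightarrow> complex" assume p: "continuous_on (sphere 0 1) p"
    have ip: "continuous_on (sphere 0 1) (\<lambda>\<eta>. \<i> * p \<eta>)" by (intro continuous_intros p)
    show "T (\<lambda>\<eta>. p \<eta> + q \<eta>) = T p + T q" if q: "continuous_on (sphere 0 1) q" for q
    proof -
      have iq: "continuous_on (sphere 0 1) (\<lambda>\<eta>. \<i> * q \<eta>)" by (intro continuous_intros q)
      show ?thesis using add[OF p q] add[OF ip iq]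
        by (simp add: T_def complex_eq_iff algebra_simps)
    qed
    show "T (\<lambda>\<eta>. c * p \<eta>) = c * T p" for c
    proof -
      have 1: "continuous_on (sphere 0 1) (\<lambda>\<eta>. of_real r * p \<eta>)" "continuous_on (sphere 0 1) (\<lambda>\<eta>. of_real r * (\<i> * p \<eta>))" for r
        by (intro continuous_intros p)+
      have e1: "(\<lambda>\<eta>. c * p \<eta>) = (\<lambda>\<eta>. of_real (Re c) * p \<eta> + of_real (Im c) * (\<i> * p \<eta>))"
        by (rule ext, subst (1) complex_eq[of c]) (simp add: algebra_simps)
      have e2: "(\<lambda>\<eta>. \<i> * (c * p \<eta>)) = (\<lambda>\<eta>. of_real (Re c) * (\<i> * p \<eta>) + of_real (- Im c) * p \<eta>)"
        by (rule ext, subst (1) complex_eq[of c]) (simp add: algebra_simps)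
      have "\<Lambda> (\<lambda>\<eta>. c * p \<eta>) = Re c * \<Lambda> p + Im c * \<Lambda> (\<lambda>\<eta>. \<i> * p \<eta>)"
        unfolding e1 by (subst add[OF 1]) (simp only: scale[OF p] scale[OF ip])
      moreover have "\<Lambda> (\<lambda>\<eta>. \<i> * (c * p \<eta>)) = Re c * \<Lambda> (\<lambda>\<eta>. \<i> * p \<eta>) - Im c * \<Lambda> p"
        unfolding e2 add[OF 1(2,1)] scale[OF ip] scale[OF p] by simp
      ultimately show ?thesis by (simp add: T_def complex_eq_iff)
    qed
    show "cmod (T p) \<le> 2 * B * M" if M: "\<forall>\<eta>. cmod \<eta> = 1 \<longrightarrow> cmod (p \<eta>) \<le> M" for M
    proof -
      have "\<bar>\<Lambda> p\<bar> \<le> B * M" using M by (intro bound p) auto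
      moreover have "\<bar>\<Lambda> (\<lambda>\<eta>. \<i> * p \<eta>)\<bar> \<le> B * M" using M by (intro bound ip) (auto simp: norm_mult)
      ultimately show ?thesis
        using cmod_le[of "T p"] by (simp add: T_def)
    qed
  qed
  then show ?thesis using that by (simp add: T_def)
qed

context
  fixes T :: "(complex \<Rightarrow> complex) \<Rightarrow> complex" and B :: real
  assumes T: "circle_functional T B"
begin

lemma circle_functional_add: "continuous_on (sphere 0 1) p \<Longrightarrow> continuous_on (sphere 0 1) q \<Longrightarrow>
        T (\<lambda>\<eta>. p \<eta> + q \<eta>) = T p + T q"
  and circle_functional_scale: "continuous_on (sphere 0 1) p \<Longrightarrow> T (\<lambda>\<eta>. c * p \<eta>) = c * T p"
  and circle_functional_bound: "continuous_on (sphere 0 1) p \<Longrightarrow> (\<And>\<eta>. cmod \<eta> = 1 \<Longrightarrow> cmod (p \<eta>) \<le> M) \<Longrightarrow>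
        cmod (T p) \<le> B * M"
  using T by (auto simp: circle_functional_def)

lemma circle_functional_diff:
  assumes "continuous_on (sphere 0 1) p" "continuous_on (sphere 0 1) q"
  shows "T (\<lambda>\<eta>. p \<eta> - q \<eta>) = T p - T q"
  using circle_functional_add[of p "\<lambda>\<eta>. (-1) * q \<eta>"] circle_functional_scale[of q "-1"] assms
  by (simp add: continuous_on_minus)

lemma circle_functional_cong:
  assumes "continuous_on (sphere 0 1) p" "continuous_on (sphere 0 1) q"
    and "\<And>\<eta>. cmod \<eta> = 1 \<Longrightarrow> p \<eta> = q \<eta>"
  shows "T p = T q"
proof -
  have "cmod (T (\<lambda>\<eta>. p \<eta> - q \<eta>)) \<le> B * 0"
    using assms by (intro circle_functional_bound continuous_intros) auto
  then show ?thesis using circle_functional_diff[OF assms(1,2)] by simp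
qed

text \<open>The difference quotients of the kernel \<open>1 / (\<eta> - \<zeta>)\<close> in \<open>\<zeta>\<close> converge uniformly in \<open>\<eta>\<close> on the circle.\<close>

lemma cauchy_transform_holomorphic:
  assumes n: "continuous_on (sphere 0 1) n"
  shows "(\<lambda>\<zeta>. T (\<lambda>\<eta>. n \<eta> / (\<eta> - \<zeta>))) holomorphic_on unit_disc"
proof (rule holomorphic_onI)
  fix \<zeta> :: complex assume "\<zeta> \<in> unit_disc"
  then have \<zeta>: "cmod \<zeta> < 1" by simp
  define d where "d = (1 - cmod \<zeta>) / 2"
  have d: "d > 0" using \<zeta> by (simp add: d_def)
  have "compact (sphere (0::complex) 1)" by simp
  then have "bounded (n ` sphere 0 1)"
    using n compact_continuous_image compact_imp_bounded by blast
  then obtain N where "\<forall>x\<in>sphere 0 1. cmod (n x) \<le> N"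
    unfolding bounded_iff by auto
  then have N: "cmod (n \<eta>) \<le> N" if "cmod \<eta> = 1" for \<eta> using that by simp
  have N0: "N \<ge> 0" using order_trans[OF norm_ge_zero N[of 1]] by simp
  have B0: "B \<ge> 0"
    using order_trans[OF norm_ge_zero circle_functional_bound[of "\<lambda>_. 0" 1]] by simp
  have far: "d \<le> cmod (\<eta> - z)" if "cmod \<eta> = 1" "dist z \<zeta> < d" for \<eta> z
  proof -
    have "1 \<le> cmod (\<eta> - z) + cmod (z - \<zeta>) + cmod \<zeta>"
      using norm_triangle_ineq[of "\<eta> - z" "z - \<zeta>"] norm_triangle_ineq[of "\<eta> - \<zeta>" \<zeta>] that by simp
    then show ?thesis using that(2) by (simp add: dist_norm d_def)
  qed
  have nz: "\<eta> \<noteq> z" if "cmod \<eta> = 1" "dist z \<zeta> < d" for \<eta> z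
    using far[OF that] d by auto
  have cont1: "continuous_on (sphere 0 1) (\<lambda>\<eta>. n \<eta> / (\<eta> - z))" if "dist z \<zeta> < d" for z
    using nz[OF _ that] by (intro continuous_intros n) auto
  have cont2: "continuous_on (sphere 0 1) (\<lambda>\<eta>. n \<eta> / (\<eta> - \<zeta>)\<^sup>2)"
    using nz[of _ \<zeta>] d by (intro continuous_intros n) auto
  let ?f = "\<lambda>\<zeta>. T (\<lambda>\<eta>. n \<eta> / (\<eta> - \<zeta>))" and ?D = "T (\<lambda>\<eta>. n \<eta> / (\<eta> - \<zeta>)\<^sup>2)"
  have key: "cmod (?f z - ?f \<zeta> - ?D * (z - \<zeta>)) \<le> B * (N / d ^ 3) * (cmod (z - \<zeta>))\<^sup>2"
    if z: "dist z \<zeta> < d" for z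
  proof -
    have dz: "dist \<zeta> \<zeta> < d" using d by simp
    let ?R = "\<lambda>\<eta>. (n \<eta> / (\<eta> - z) - n \<eta> / (\<eta> - \<zeta>)) - (z - \<zeta>) * (n \<eta> / (\<eta> - \<zeta>)\<^sup>2)"
    have "?f z - ?f \<zeta> - ?D * (z - \<zeta>) = T ?R"
      by (subst circle_functional_diff, (intro continuous_intros cont1[OF z] cont1[OF dz] cont2)+,
          subst circle_functional_diff[OF cont1[OF z] cont1[OF dz]], subst circle_functional_scale[OF cont2])
         (simp add: algebra_simps)
    moreover have "cmod (T ?R) \<le> B * ((N / d ^ 3) * (cmod (z - \<zeta>))\<^sup>2)"
    proof (rule circle_functional_bound)
      show "continuous_on (sphere 0 1) ?R"
        by (intro continuous_intros cont1[OF z] cont1[OF dz] cont2)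
      fix \<eta> :: complex assume \<eta>: "cmod \<eta> = 1"
      have e: "?R \<eta> = n \<eta> * (z - \<zeta>)\<^sup>2 / ((\<eta> - z) * (\<eta> - \<zeta>)\<^sup>2)"
        using nz[OF \<eta> z] nz[OF \<eta> dz] by (simp add: divide_simps) (simp add: algebra_simps power2_eq_square)
      have "d ^ 3 = d * d\<^sup>2" by (simp add: power3_eq_cube power2_eq_square)
      also have "\<dots> \<le> cmod (\<eta> - z) * (cmod (\<eta> - \<zeta>))\<^sup>2"
        using far[OF \<eta> z] far[OF \<eta> dz] d by (intro mult_mono power_mono) auto
      finally have "cmod (?R \<eta>) \<le> cmod (n \<eta>) * (cmod (z - \<zeta>))\<^sup>2 / d ^ 3"
        unfolding e norm_divide norm_mult norm_power using d by (intro divide_left_mono mult_nonneg_nonneg) (auto intro!: mult_pos_pos simp: nz[OF \<eta> z] nz[OF \<eta> dz])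
      also have "\<dots> \<le> N * (cmod (z - \<zeta>))\<^sup>2 / d ^ 3"
        using N[OF \<eta>] d by (intro divide_right_mono mult_right_mono) auto
      finally show "cmod (?R \<eta>) \<le> (N / d ^ 3) * (cmod (z - \<zeta>))\<^sup>2" by simp
    qed
    ultimately show ?thesis by (simp add: mult.assoc)
  qed
  have "(?f has_field_derivative ?D) (at \<zeta>)"
    unfolding has_field_derivative_def has_derivative_at_alt
  proof (intro conjI allI impI bounded_linear_mult_right)
    fix e :: real assume e: "e > 0"
    define Q where "Q = B * (N / d ^ 3) + 1"
    have Q: "Q > 0" using B0 N0 d by (simp add: Q_def add_nonneg_pos)
    have "norm (?f z - ?f \<zeta> - ?D * (z - \<zeta>)) \<le> e * norm (z - \<zeta>)" if z: "norm (z - \<zeta>) < min d (e / Q)" for z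
    proof -
      have "norm (?f z - ?f \<zeta> - ?D * (z - \<zeta>)) \<le> B * (N / d ^ 3) * (cmod (z - \<zeta>))\<^sup>2"
        using z by (intro key) (simp add: dist_norm)
      also have "\<dots> \<le> Q * (cmod (z - \<zeta>))\<^sup>2" by (intro mult_right_mono) (auto simp: Q_def)
      also have "\<dots> = (Q * cmod (z - \<zeta>)) * cmod (z - \<zeta>)" by (simp add: power2_eq_square)
      also have "\<dots> \<le> e * cmod (z - \<zeta>)"
        using z Q by (intro mult_right_mono) (auto simp: field_simps)
      finally show ?thesis .
    qed
    then show "\<exists>d>0. \<forall>y. norm (y - \<zeta>) < d \<longrightarrow> norm (?f y - ?f \<zeta> - ?D * (y - \<zeta>)) \<le> e * norm (y - \<zeta>)"
      using d e Q by (intro exI[of _ "min d (e / Q)"]) auto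
  qed
  then show "?f field_differentiable at \<zeta> within unit_disc"
    using field_differentiable_at_within field_differentiable_def by blast
qed

end

section \<open>Duality for extremal discs\<close>

text \<open>Pairs of functions on the circle are parametrised by the angle, which places them in a normed space of
  bounded continuous functions on the real line.\<close>

definition circle_fun :: "(complex \<Rightarrow> complex ^ 'n) \<Rightarrow> (complex \<Rightarrow> real) \<Rightarrow> real \<Rightarrow>\<^sub>C ((complex ^ 'n) \<times> real)" where
  "circle_fun u s = Bcontfun (\<lambda>\<theta>. (u (cis \<theta>), s (cis \<theta>)))"

lemma apply_circle_fun:
  assumes "continuous_on (sphere 0 1) u" "continuous_on (sphere 0 1) s"
  shows "apply_bcontfun (circle_fun u s) \<theta> = (u (cis \<theta>), s (cis \<theta>))"
proof -
  have c: "continuous_on (sphere 0 1) (\<lambda>\<eta>. (u \<eta>, s \<eta>))" by (intro continuous_intros assms)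
  have "continuous_on UNIV ((\<lambda>\<eta>. (u \<eta>, s \<eta>)) \<circ> cis)"
    by (intro continuous_on_compose continuous_on_subset[OF c]) (auto intro!: continuous_intros simp: cis_conv_exp)
  moreover have "bounded (range (\<lambda>\<theta>. (u (cis \<theta>), s (cis \<theta>))))"
  proof (rule bounded_subset)
    show "bounded ((\<lambda>\<eta>. (u \<eta>, s \<eta>)) ` sphere 0 1)"
      by (intro compact_imp_bounded compact_continuous_image c) simp
  qed auto
  ultimately have "(\<lambda>\<theta>. (u (cis \<theta>), s (cis \<theta>))) \<in> bcontfun"
    by (simp add: bcontfun_def o_def)
  then show ?thesis by (simp add: circle_fun_def Bcontfun_inverse)
qed

lemma circle_fun_add:
  assumes "continuous_on (sphere 0 1) u" "continuous_on (sphere 0 1) s"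
    and "continuous_on (sphere 0 1) u'" "continuous_on (sphere 0 1) s'"
  shows "circle_fun (\<lambda>\<eta>. u \<eta> + u' \<eta>) (\<lambda>\<eta>. s \<eta> + s' \<eta>) = circle_fun u s + circle_fun u' s'"
  by (rule bcontfun_eqI) (simp add: apply_circle_fun assms continuous_on_add)

lemma circle_fun_scale:
  assumes "continuous_on (sphere 0 1) u" "continuous_on (sphere 0 1) s"
  shows "circle_fun (\<lambda>\<eta>. c *\<^sub>R u \<eta>) (\<lambda>\<eta>. c * s \<eta>) = c *\<^sub>R circle_fun u s"
  by (rule bcontfun_eqI) (simp add: apply_circle_fun assms continuous_on_scaleR continuous_on_mult_left continuous_on_const)

lemma holomorphic_continuous_sphere:
  fixes f :: "complex \<Rightarrow> complex ^ 'n"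
  assumes "1 < R" "\<And>i. (\<lambda>\<zeta>. f \<zeta> $ i) holomorphic_on ball 0 R"
  shows "continuous_on (sphere 0 1) f"
proof -
  have "continuous_on (sphere 0 1) (\<lambda>\<zeta>. \<chi> i. f \<zeta> $ i)"
    using assms(1) by (intro continuous_on_vec_lambda holomorphic_on_imp_continuous_on
        holomorphic_on_subset[OF assms(2)]) auto
  then show ?thesis by simp
qed

lemma disc_deriv_add:
  fixes f g :: "complex \<Rightarrow> complex ^ 'n"
  assumes "1 < R" "\<And>i. (\<lambda>\<zeta>. f \<zeta> $ i) holomorphic_on ball 0 R" "\<And>i. (\<lambda>\<zeta>. g \<zeta> $ i) holomorphic_on ball 0 R"
  shows "disc_deriv (\<lambda>\<zeta>. f \<zeta> + g \<zeta>) 0 = disc_deriv f 0 + disc_deriv g 0"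
proof -
  have "(\<lambda>\<zeta>. f \<zeta> $ i) field_differentiable at 0" "(\<lambda>\<zeta>. g \<zeta> $ i) field_differentiable at 0" for i
    using assms by (auto intro!: holomorphic_on_imp_differentiable_at)
  then show ?thesis by (simp add: disc_deriv_def vec_eq_iff)
qed

lemma disc_deriv_cmult:
  fixes f :: "complex \<Rightarrow> complex ^ 'n"
  assumes "0 < R" "\<And>i. (\<lambda>\<zeta>. f \<zeta> $ i) holomorphic_on ball 0 R"
  shows "disc_deriv (\<lambda>\<zeta>. c *s f \<zeta>) 0 = c *s disc_deriv f 0"
proof -
  have "(\<lambda>\<zeta>. f \<zeta> $ i) field_differentiable at 0" for i
    using assms by (auto intro!: holomorphic_on_imp_differentiable_at)
  then show ?thesis by (simp add: disc_deriv_def vec_eq_iff)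
qed

text \<open>The last hypothesis says that \<open>\<phi>\<close> has the largest derivative in the direction \<open>v\<close> among
  all analytic discs in \<open>D\<close> centred at the origin.\<close>

locale extremal_disc =
  fixes D :: "(complex ^ 'n) set" and v :: "complex ^ 'n" and M :: real and \<phi> :: "complex \<Rightarrow> complex ^ 'n"
  assumes open_D: "open D" and convex_D: "convex D" and bounded_D: "bounded D" and zero_D: "0 \<in> D"
    and M: "0 < M"
    and \<phi>: "analytic_disc D \<phi>" "\<phi> 0 = 0" "disc_deriv \<phi> 0 = of_real M *s v"
    and ext: "\<And>f t. analytic_disc D f \<Longrightarrow> f 0 = 0 \<Longrightarrow> disc_deriv f 0 = of_real t *s v \<Longrightarrow> t \<le> M"
begin

definition "polar = {a :: complex ^ 'n. \<forall>w\<in>D. inner a w \<le> 1}"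

lemma polar_bounded: "\<exists>r>0. \<forall>a\<in>polar. norm a \<le> r"
proof -
  obtain \<epsilon> where \<epsilon>: "\<epsilon> > 0" "ball 0 \<epsilon> \<subseteq> D" using open_D zero_D openE by blast
  have "norm a \<le> 2 / \<epsilon>" if "a \<in> polar" for a
  proof (cases "a = 0")
    case False
    let ?w = "(\<epsilon> / (2 * norm a)) *\<^sub>R a"
    have "?w \<in> D" using \<epsilon> False by (auto intro!: subsetD[OF \<epsilon>(2)])
    then have "inner a ?w \<le> 1" using that by (auto simp: polar_def)
    then show ?thesis using \<epsilon>(1) False by (simp add: dot_square_norm power2_eq_square field_simps)
  qed (use \<epsilon> in simp)
  then show ?thesis using \<epsilon>(1) by (intro exI[of _ "2 / \<epsilon>"]) auto
qed

lemma zero_polar: "0 \<in> polar" by (simp add: polar_def)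

text \<open>The strict inequality \<open>q < 1\<close> gives membership in the open set \<open>D\<close> itself, not only in its closure.\<close>

lemma bipolar:
  assumes q: "q < 1" and y: "\<And>a. a \<in> polar \<Longrightarrow> inner a y \<le> q"
  shows "y \<in> D"
proof (rule ccontr)
  assume "y \<notin> D"
  then have "\<exists>a b. a \<noteq> 0 \<and> (\<forall>x\<in>D. inner a x \<le> b) \<and> (\<forall>x\<in>{y}. inner a x \<ge> b)"
    using zero_D by (intro separating_hyperplane_sets convex_D) auto
  then obtain a b where ab: "a \<noteq> 0" "\<And>x. x \<in> D \<Longrightarrow> inner a x \<le> b" "inner a y \<ge> b" by auto
  obtain \<epsilon> where \<epsilon>: "\<epsilon> > 0" "ball 0 \<epsilon> \<subseteq> D" using open_D zero_D openE by blast
  let ?w = "(\<epsilon> / (2 * norm a)) *\<^sub>R a"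
  have "?w \<in> D" using \<epsilon> ab(1) by (auto intro!: subsetD[OF \<epsilon>(2)])
  then have "inner a ?w \<le> b" by (rule ab(2))
  moreover have "0 < inner a ?w" using \<epsilon>(1) ab(1) by simp
  ultimately have b: "b > 0" by linarith
  have "(1 / b) *\<^sub>R a \<in> polar" using ab(2) b by (auto simp: polar_def field_simps)
  from y[OF this] have "inner a y / b \<le> q" by simp
  moreover have "1 \<le> inner a y / b" using ab(3) b by (simp add: field_simps)
  ultimately show False using q by simp
qed

text \<open>The inequalities \<open>inner a (f \<zeta>) \<le> c\<close> extend from the circle to the disc by the maximum principle. So
  \<open>f\<close> divided by any number larger than \<open>c\<close> is an analytic disc in \<open>D\<close>, to which extremality applies.\<close>

lemma extremal_inequality:
  assumes R: "1 < R" and f: "\<And>i. (\<lambda>\<zeta>. f \<zeta> $ i) holomorphic_on ball 0 R"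
    and f0: "f 0 = 0" "disc_deriv f 0 = of_real t *s v"
    and bd: "\<And>\<eta> a. cmod \<eta> = 1 \<Longrightarrow> a \<in> polar \<Longrightarrow> inner a (f \<eta>) \<le> c"
  shows "t \<le> c * M"
proof -
  have c: "0 \<le> c" using bd[of 1 0] zero_polar by simp
  have le: "inner a (f \<zeta>) \<le> c" if a: "a \<in> polar" and \<zeta>: "cmod \<zeta> \<le> 1" for a \<zeta>
  proof -
    let ?F = "\<lambda>\<zeta>. bdot (\<chi> i. cnj (a $ i)) (f \<zeta>)"
    have F: "?F holomorphic_on ball 0 R" by (intro holomorphic_on_bdot f) auto
    have "Re (?F \<zeta>) \<le> c"
    proof (rule maximum_real_frontier[where S = "cball 0 1" and f = ?F])
      show "?F holomorphic_on interior (cball 0 1)"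
        using R by (intro holomorphic_on_subset[OF F]) (auto simp: ball_def)
      show "continuous_on (closure (cball 0 1)) ?F"
        using R by (intro holomorphic_on_imp_continuous_on holomorphic_on_subset[OF F]) auto
      show "Re (?F z) \<le> c" if "z \<in> frontier (cball 0 1)" for z
        using bd[OF _ a, of z] that by (simp add: inner_eq_bdot)
    qed (use \<zeta> in auto)
    then show ?thesis by (simp add: inner_eq_bdot)
  qed
  have "t \<le> (c + e) * M" if e: "e > 0" for e
  proof -
    define k where "k = 1 / (c + e)"
    have k: "k > 0" using c e by (simp add: k_def)
    define f1 where "f1 \<zeta> = of_real k *s f \<zeta>" for \<zeta>
    have "f1 \<zeta> \<in> D" if "cmod \<zeta> < 1" for \<zeta>
    proof (rule bipolar)
      show "k * c < 1" using c e by (simp add: k_def)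
      show "inner a (f1 \<zeta>) \<le> k * c" if "a \<in> polar" for a
        using le[OF that, of \<zeta>] k \<open>cmod \<zeta> < 1\<close>
        by (simp add: f1_def scaleR_eq_vector_scalar[symmetric])
    qed
    moreover have "(\<lambda>\<zeta>. f1 \<zeta> $ i) holomorphic_on unit_disc" for i
      unfolding f1_def using R
      by (auto intro!: holomorphic_intros holomorphic_on_subset[OF f])
    ultimately have "analytic_disc D f1" by (auto simp: analytic_disc_def)
    moreover have "f1 0 = 0" by (simp add: f1_def f0)
    moreover have "disc_deriv f1 0 = of_real (k * t) *s v"
      unfolding f1_def by (subst disc_deriv_cmult[of R]) (use R f f0 in auto)
    ultimately have "k * t \<le> M" by (rule ext)
    then show ?thesis using c e by (simp add: k_def field_simps)
  qed
  then have "\<And>e. e > 0 \<Longrightarrow> t \<le> c * M + e"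
    using M by (metis (no_types, opaque_lifting) divide_pos_pos distrib_right nonzero_eq_divide_eq order_less_irrefl)
  then show ?thesis by (rule field_le_epsilon)
qed

text \<open>Let a pair \<open>(u, s)\<close> of a vector-valued and a real function on the circle be positive if \<open>u\<close> takes values in
  \<open>s\<close> times the closure of \<open>D\<close>. On the pairs \<open>(f, c)\<close> with \<open>c\<close> constant and \<open>f\<close>
  holomorphic near the closed disc, \<open>f(0) = 0\<close> and \<open>f'(0) = t v\<close>, the functional
  \<open>c M - t\<close> is positive; this is \<open>extremal_inequality\<close>. The pair \<open>(0, 1)\<close> is an order unit, so
  \<open>riesz_extension\<close> applies. The values of the extension on the pairs \<open>(0, s)\<close> will
  give the scalar part of the dual field.\<close>

lemma positive_functional:
  obtains \<Psi> :: "(complex \<Rightarrow> complex ^ 'n) \<Rightarrow> (complex \<Rightarrow> real) \<Rightarrow> real" and B :: real where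
    "\<And>u s u' s'. continuous_on (sphere 0 1) u \<Longrightarrow> continuous_on (sphere 0 1) s \<Longrightarrow>
       continuous_on (sphere 0 1) u' \<Longrightarrow> continuous_on (sphere 0 1) s' \<Longrightarrow>
       \<Psi> (\<lambda>\<eta>. u \<eta> + u' \<eta>) (\<lambda>\<eta>. s \<eta> + s' \<eta>) = \<Psi> u s + \<Psi> u' s'"
    "\<And>u s c. continuous_on (sphere 0 1) u \<Longrightarrow> continuous_on (sphere 0 1) s \<Longrightarrow>
       \<Psi> (\<lambda>\<eta>. c *\<^sub>R u \<eta>) (\<lambda>\<eta>. c * s \<eta>) = c * \<Psi> u s"
    "\<And>u s N. continuous_on (sphere 0 1) u \<Longrightarrow> continuous_on (sphere 0 1) s \<Longrightarrow>
       (\<And>\<eta>. cmod \<eta> = 1 \<Longrightarrow> norm (u \<eta>) \<le> N \<and> \<bar>s \<eta>\<bar> \<le> N) \<Longrightarrow> \<bar>\<Psi> u s\<bar> \<le> B * N"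
    "\<And>w p. w \<in> D \<Longrightarrow> continuous_on (sphere 0 1) p \<Longrightarrow> (\<And>\<eta>. cmod \<eta> = 1 \<Longrightarrow> 0 \<le> p \<eta>) \<Longrightarrow>
       0 \<le> \<Psi> (\<lambda>\<eta>. p \<eta> *\<^sub>R w) p"
    "\<And>f R t c. 1 < R \<Longrightarrow> (\<And>i. (\<lambda>\<zeta>. f \<zeta> $ i) holomorphic_on ball 0 R) \<Longrightarrow> f 0 = 0 \<Longrightarrow>
       disc_deriv f 0 = of_real t *s v \<Longrightarrow> \<Psi> f (\<lambda>_. c) = c * M - t"
proof -
  \<comment> \<open>The cone of positive pairs, described by the linear inequalities of the polar of \<open>D\<close>.\<close>
  define K :: "(real \<Rightarrow>\<^sub>C ((complex ^ 'n) \<times> real)) set" where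
    "K = {F. \<forall>\<theta>. \<forall>a\<in>polar. inner a (fst (apply_bcontfun F \<theta>)) \<le> snd (apply_bcontfun F \<theta>)}"
  define S :: "((real \<Rightarrow>\<^sub>C ((complex ^ 'n) \<times> real)) \<times> real) set" where
    "S = {(circle_fun f (\<lambda>_. c), c * M - t) |f c t. (\<exists>R>1. \<forall>i. (\<lambda>\<zeta>. f \<zeta> $ i) holomorphic_on ball 0 R) \<and>
        f 0 = 0 \<and> disc_deriv f 0 = of_real t *s v}"
  define e :: "real \<Rightarrow>\<^sub>C ((complex ^ 'n) \<times> real)" where "e = circle_fun (\<lambda>_. 0) (\<lambda>_. 1)"
  have e: "apply_bcontfun e \<theta> = (0, 1)" for \<theta>
    by (simp add: e_def apply_circle_fun continuous_on_const)
  obtain r where r: "r > 0" "\<And>a. a \<in> polar \<Longrightarrow> norm a \<le> r" using polar_bounded by blast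
  have unit: "t *\<^sub>R e - F \<in> K" if t: "\<And>\<theta>. r * norm (fst (apply_bcontfun F \<theta>)) + \<bar>snd (apply_bcontfun F \<theta>)\<bar> \<le> t" for F t
    unfolding K_def
  proof (intro CollectI allI ballI)
    fix \<theta> a assume a: "a \<in> polar"
    have "- inner a (fst (apply_bcontfun F \<theta>)) \<le> norm a * norm (fst (apply_bcontfun F \<theta>))"
      using Cauchy_Schwarz_ineq2[of a "fst (apply_bcontfun F \<theta>)"] by linarith
    also have "\<dots> \<le> r * norm (fst (apply_bcontfun F \<theta>))" using r(2)[OF a] by (intro mult_right_mono) auto
    finally show "inner a (fst (apply_bcontfun (t *\<^sub>R e - F) \<theta>)) \<le> snd (apply_bcontfun (t *\<^sub>R e - F) \<theta>)"
      using t[of \<theta>] by (simp add: e)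
  qed
  have sub: "subspace S"
    unfolding subspace_def
  proof (intro conjI ballI allI)
    have "circle_fun (\<lambda>_. 0) (\<lambda>_. 0) = (0 :: real \<Rightarrow>\<^sub>C ((complex ^ 'n) \<times> real))"
      by (rule bcontfun_eqI) (simp add: apply_circle_fun continuous_on_const zero_prod_def)
    moreover have "disc_deriv (\<lambda>_. 0) 0 = (0 :: complex ^ 'n)"
      by (simp add: disc_deriv_def vec_eq_iff)
    ultimately show "0 \<in> S"
      unfolding S_def zero_prod_def
      by (intro CollectI exI[of _ "\<lambda>_. 0"] exI[of _ 0]) (auto intro!: exI[of _ 2])
    fix x assume "x \<in> S"
    then obtain f c t R where x: "x = (circle_fun f (\<lambda>_. c), c * M - t)" "R > 1"
      "\<And>i. (\<lambda>\<zeta>. f \<zeta> $ i) holomorphic_on ball 0 R" "f 0 = 0" "disc_deriv f 0 = of_real t *s v"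
      by (auto simp: S_def)
    note cf = holomorphic_continuous_sphere[OF x(2,3)]
    show "k *\<^sub>R x \<in> S" for k
    proof -
      have "circle_fun (\<lambda>\<eta>. k *\<^sub>R f \<eta>) (\<lambda>_. k * c) = k *\<^sub>R circle_fun f (\<lambda>_. c)"
        by (rule circle_fun_scale[OF cf]) (rule continuous_on_const)
      moreover have "disc_deriv (\<lambda>\<zeta>. k *\<^sub>R f \<zeta>) 0 = of_real (k * t) *s v"
        unfolding scaleR_eq_vector_scalar
        by (subst disc_deriv_cmult[of R]) (use x in auto)
      moreover have "\<forall>i. (\<lambda>\<zeta>. (k *\<^sub>R f \<zeta>) $ i) holomorphic_on ball 0 R"
        unfolding scaleR_eq_vector_scalar by (auto intro!: holomorphic_intros x)
      ultimately show ?thesis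
        unfolding S_def using x(2)
        by (intro CollectI exI[of _ "\<lambda>\<zeta>. k *\<^sub>R f \<zeta>"] exI[of _ "k * c"] exI[of _ "k * t"])
          (auto simp: x(1,4) algebra_simps)
    qed
    fix y assume "y \<in> S"
    then obtain g d q R' where y: "y = (circle_fun g (\<lambda>_. d), d * M - q)" "R' > 1"
      "\<And>i. (\<lambda>\<zeta>. g \<zeta> $ i) holomorphic_on ball 0 R'" "g 0 = 0" "disc_deriv g 0 = of_real q *s v"
      by (auto simp: S_def)
    note cg = holomorphic_continuous_sphere[OF y(2,3)]
    let ?R = "min R R'"
    have R: "1 < ?R" "\<And>i. (\<lambda>\<zeta>. f \<zeta> $ i) holomorphic_on ball 0 ?R" "\<And>i. (\<lambda>\<zeta>. g \<zeta> $ i) holomorphic_on ball 0 ?R"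
      using x(2) y(2) by (auto intro: holomorphic_on_subset[OF x(3)] holomorphic_on_subset[OF y(3)])
    have "circle_fun (\<lambda>\<eta>. f \<eta> + g \<eta>) (\<lambda>_. c + d) = circle_fun f (\<lambda>_. c) + circle_fun g (\<lambda>_. d)"
      by (intro circle_fun_add cf cg continuous_on_const)
    moreover have "disc_deriv (\<lambda>\<zeta>. f \<zeta> + g \<zeta>) 0 = of_real (t + q) *s v"
      by (subst disc_deriv_add[OF R]) (simp add: x y vector_sadd_rdistrib)
    moreover have "\<forall>i. (\<lambda>\<zeta>. (f \<zeta> + g \<zeta>) $ i) holomorphic_on ball 0 ?R"
      by (auto intro!: holomorphic_intros R)
    ultimately show "x + y \<in> S"
      unfolding S_def using R(1)
      by (intro CollectI exI[of _ "\<lambda>\<zeta>. f \<zeta> + g \<zeta>"] exI[of _ "c + d"] exI[of _ "t + q"])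
        (auto simp: x(1,4) y(1,4) algebra_simps intro!: exI[of _ ?R])
  qed
  obtain \<Psi> where \<Psi>: "linear \<Psi>" "\<And>x. x \<in> K \<Longrightarrow> 0 \<le> \<Psi> x" "\<And>x t. (x, t) \<in> S \<Longrightarrow> \<Psi> x = t"
  proof (rule riesz_extension[of K e M S])
    show "0 \<in> K" by (simp add: K_def)
    show "x + y \<in> K" if "x \<in> K" "y \<in> K" for x y
      using that by (auto simp: K_def inner_add_right intro: add_mono)
    show "c *\<^sub>R x \<in> K" if "0 < c" "x \<in> K" for c x
      using that by (auto simp: K_def intro: mult_left_mono)
    show "\<exists>t. t *\<^sub>R e - F \<in> K" for F
    proof -
      have "r * norm (fst (apply_bcontfun F \<theta>)) + \<bar>snd (apply_bcontfun F \<theta>)\<bar> \<le> r * norm F + norm F" for \<theta>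
      proof -
        have n: "norm (apply_bcontfun F \<theta>) \<le> norm F" by (rule norm_bounded)
        have "norm (fst (apply_bcontfun F \<theta>)) \<le> norm F" "norm (snd (apply_bcontfun F \<theta>)) \<le> norm F"
          using n norm_fst_le[of "fst (apply_bcontfun F \<theta>)" "snd (apply_bcontfun F \<theta>)"]
            norm_snd_le[of "snd (apply_bcontfun F \<theta>)" "fst (apply_bcontfun F \<theta>)"] by auto
        then show ?thesis using r(1) by (intro add_mono mult_left_mono) auto
      qed
      from unit[OF this] show ?thesis by blast
    qed
    have "disc_deriv (\<lambda>_. 0) 0 = (0 :: complex ^ 'n)"
      by (simp add: disc_deriv_def vec_eq_iff)
    then show "(e, M) \<in> S"
      unfolding S_def e_def
      by (intro CollectI exI[of _ "\<lambda>_. 0"] exI[of _ 1] exI[of _ 0]) (auto intro!: exI[of _ 2])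
    show "subspace S" by (rule sub)
    show "0 \<le> t" if tS: "(F, t) \<in> S" and FK: "F \<in> K" for F t
    proof -
      obtain f c t' R where x: "F = circle_fun f (\<lambda>_. c)" "t = c * M - t'" "R > 1"
        "\<And>i. (\<lambda>\<zeta>. f \<zeta> $ i) holomorphic_on ball 0 R" "f 0 = 0" "disc_deriv f 0 = of_real t' *s v"
        using tS by (auto simp: S_def)
      note cf = holomorphic_continuous_sphere[OF x(3,4)]
      have "t' \<le> c * M"
      proof (rule extremal_inequality[OF x(3-6)])
        fix \<eta> :: complex and a assume \<eta>: "cmod \<eta> = 1" and a: "a \<in> polar"
        have "\<eta> \<noteq> 0" using \<eta> by auto
        from cis_Arg[OF this] have "\<eta> = cis (Arg \<eta>)" using \<eta> by (simp add: sgn_div_norm)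
        then obtain \<theta> where \<theta>: "\<eta> = cis \<theta>" by blast
        show "inner a (f \<eta>) \<le> c"
          using FK a by (auto simp: K_def x(1) apply_circle_fun cf continuous_on_const \<theta>)
      qed
      then show ?thesis by (simp add: x(2))
    qed
  qed blast
  have \<Psi>e: "\<Psi> e = M"
  proof (rule \<Psi>(3))
    have "disc_deriv (\<lambda>_. 0) 0 = (0 :: complex ^ 'n)"
      by (simp add: disc_deriv_def vec_eq_iff)
    then show "(e, M) \<in> S"
      unfolding S_def e_def
      by (intro CollectI exI[of _ "\<lambda>_. 0"] exI[of _ 1] exI[of _ 0]) (auto intro!: exI[of _ 2])
  qed
  show ?thesis
  proof (rule that[of "\<lambda>u s. \<Psi> (circle_fun u s)" "(r + 1) * M"])
    show "\<Psi> (circle_fun (\<lambda>\<eta>. u \<eta> + u' \<eta>) (\<lambda>\<eta>. s \<eta> + s' \<eta>)) = \<Psi> (circle_fun u s) + \<Psi> (circle_fun u' s')"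
      if "continuous_on (sphere 0 1) u" "continuous_on (sphere 0 1) s"
       "continuous_on (sphere 0 1) u'" "continuous_on (sphere 0 1) s'" for u s u' s'
      by (simp add: circle_fun_add[OF that] linear_add[OF \<Psi>(1)])
    show "\<Psi> (circle_fun (\<lambda>\<eta>. c *\<^sub>R u \<eta>) (\<lambda>\<eta>. c * s \<eta>)) = c * \<Psi> (circle_fun u s)"
      if "continuous_on (sphere 0 1) u" "continuous_on (sphere 0 1) s" for u s c
      by (simp add: circle_fun_scale[OF that] linear_cmul[OF \<Psi>(1)])
    show "\<bar>\<Psi> (circle_fun u s)\<bar> \<le> (r + 1) * M * N"
      if c: "continuous_on (sphere 0 1) u" "continuous_on (sphere 0 1) s"
        and N: "\<And>\<eta>. cmod \<eta> = 1 \<Longrightarrow> norm (u \<eta>) \<le> N \<and> \<bar>s \<eta>\<bar> \<le> N" for u s N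
    proof -
      let ?F = "circle_fun u s" and ?t = "(r + 1) * N"
      have b: "r * norm (u (cis \<theta>)) + \<bar>s (cis \<theta>)\<bar> \<le> ?t" for \<theta>
      proof -
        have "norm (u (cis \<theta>)) \<le> N" "\<bar>s (cis \<theta>)\<bar> \<le> N" using N[of "cis \<theta>"] by auto
        then have "r * norm (u (cis \<theta>)) + \<bar>s (cis \<theta>)\<bar> \<le> r * N + N"
          using r(1) by (intro add_mono mult_left_mono) auto
        then show ?thesis by (simp add: distrib_right)
      qed
      have "?t *\<^sub>R e - ?F \<in> K" by (rule unit) (use b in \<open>simp add: apply_circle_fun c\<close>)
      moreover have "?t *\<^sub>R e - (- ?F) \<in> K"
        by (rule unit) (use b in \<open>simp add: apply_circle_fun c\<close>)
      ultimately have "0 \<le> ?t * M - \<Psi> ?F" "0 \<le> ?t * M + \<Psi> ?F"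
        using \<Psi>(2)[of "?t *\<^sub>R e - ?F"] \<Psi>(2)[of "?t *\<^sub>R e - (- ?F)"]
        by (simp_all add: linear_diff[OF \<Psi>(1)] linear_add[OF \<Psi>(1)] linear_cmul[OF \<Psi>(1)] \<Psi>e)
      then show ?thesis by (simp add: abs_le_iff algebra_simps)
    qed
    show "0 \<le> \<Psi> (circle_fun (\<lambda>\<eta>. p \<eta> *\<^sub>R w) p)"
      if "w \<in> D" "continuous_on (sphere 0 1) p" "\<And>\<eta>. cmod \<eta> = 1 \<Longrightarrow> 0 \<le> p \<eta>" for w p
    proof (rule \<Psi>(2))
      have cw: "continuous_on (sphere 0 1) (\<lambda>\<eta>. p \<eta> *\<^sub>R w)" by (intro continuous_intros that)
      have "p \<eta> * inner a w \<le> p \<eta>" if "cmod \<eta> = 1" "a \<in> polar" for \<eta> a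
        using mult_left_mono[of "inner a w" 1 "p \<eta>"] that \<open>w \<in> D\<close> \<open>\<And>\<eta>. cmod \<eta> = 1 \<Longrightarrow> 0 \<le> p \<eta>\<close>
        by (auto simp: polar_def)
      then show "circle_fun (\<lambda>\<eta>. p \<eta> *\<^sub>R w) p \<in> K"
        by (simp add: K_def apply_circle_fun cw that)
    qed
    show "\<Psi> (circle_fun f (\<lambda>_. c)) = c * M - t"
      if "1 < R" "\<And>i. (\<lambda>\<zeta>. f \<zeta> $ i) holomorphic_on ball 0 R" "f 0 = 0"
       "disc_deriv f 0 = of_real t *s v" for f R t c
      using that by (intro \<Psi>(3)) (auto simp: S_def)
  qed
qed

text \<open>The positive functional is split into its components \<open>- L i\<close> and \<open>S\<close>, complexified. The five
  relations among them are, in this order: positivity on \<open>(p w, p)\<close>, vanishing of \<open>L\<close> on holomorphic functions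
  of order at least two at the origin, the two normalisations, and the fact that the real part of
  \<open>S q\<close> depends on the real part of \<open>q\<close> only.\<close>

lemma dual_functionals:
  obtains L :: "'n \<Rightarrow> (complex \<Rightarrow> complex) \<Rightarrow> complex" and S :: "(complex \<Rightarrow> complex) \<Rightarrow> complex" and B
  where "\<And>i. circle_functional (L i) B" "circle_functional S B"
    "\<And>w p. w \<in> D \<Longrightarrow> continuous_on (sphere 0 1) p \<Longrightarrow> (\<And>\<eta>. cmod \<eta> = 1 \<Longrightarrow> 0 \<le> p \<eta>) \<Longrightarrow>
       Re (\<Sum>i\<in>UNIV. L i (\<lambda>\<eta>. of_real (p \<eta>)) * w $ i) \<le> Re (S (\<lambda>\<eta>. of_real (p \<eta>)))"
    "\<And>q R w. 1 < R \<Longrightarrow> q holomorphic_on ball 0 R \<Longrightarrow> q 0 = 0 \<Longrightarrow> deriv q 0 = 0 \<Longrightarrow>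
       Re (\<Sum>i\<in>UNIV. L i q * w $ i) = 0"
    "Re (\<Sum>i\<in>UNIV. L i (\<lambda>\<eta>. \<eta>) * v $ i) = 1" "Re (S (\<lambda>_. 1)) = M"
    "\<And>q. continuous_on (sphere 0 1) q \<Longrightarrow> Re (S (\<lambda>\<eta>. of_real (Re (q \<eta>)))) = Re (S q)"
proof -
  obtain \<Psi> :: "(complex \<Rightarrow> complex ^ 'n) \<Rightarrow> (complex \<Rightarrow> real) \<Rightarrow> real" and B :: real where
    add: "\<And>u s u' s'. continuous_on (sphere 0 1) u \<Longrightarrow> continuous_on (sphere 0 1) s \<Longrightarrow>
       continuous_on (sphere 0 1) u' \<Longrightarrow> continuous_on (sphere 0 1) s' \<Longrightarrow>
       \<Psi> (\<lambda>\<eta>. u \<eta> + u' \<eta>) (\<lambda>\<eta>. s \<eta> + s' \<eta>) = \<Psi> u s + \<Psi> u' s'"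
    and scale: "\<And>u s c. continuous_on (sphere 0 1) u \<Longrightarrow> continuous_on (sphere 0 1) s \<Longrightarrow>
       \<Psi> (\<lambda>\<eta>. c *\<^sub>R u \<eta>) (\<lambda>\<eta>. c * s \<eta>) = c * \<Psi> u s"
    and bound: "\<And>u s N. continuous_on (sphere 0 1) u \<Longrightarrow> continuous_on (sphere 0 1) s \<Longrightarrow>
       (\<And>\<eta>. cmod \<eta> = 1 \<Longrightarrow> norm (u \<eta>) \<le> N \<and> \<bar>s \<eta>\<bar> \<le> N) \<Longrightarrow> \<bar>\<Psi> u s\<bar> \<le> B * N"
    and pos: "\<And>w p. w \<in> D \<Longrightarrow> continuous_on (sphere 0 1) p \<Longrightarrow> (\<And>\<eta>. cmod \<eta> = 1 \<Longrightarrow> 0 \<le> p \<eta>) \<Longrightarrow>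
       0 \<le> \<Psi> (\<lambda>\<eta>. p \<eta> *\<^sub>R w) p"
    and val: "\<And>f R t c. 1 < R \<Longrightarrow> (\<And>i. (\<lambda>\<zeta>. f \<zeta> $ i) holomorphic_on ball 0 R) \<Longrightarrow> f 0 = 0 \<Longrightarrow>
       disc_deriv f 0 = of_real t *s v \<Longrightarrow> \<Psi> f (\<lambda>_. c) = c * M - t"
    by (rule positive_functional) blast
  define \<Lambda> where "\<Lambda> u = - \<Psi> u (\<lambda>_. 0)" for u
  have c0: "continuous_on (sphere 0 1) (\<lambda>_. 0::real)" "continuous_on (sphere 0 1) (\<lambda>_. 0 :: complex ^ 'n)"
    by (auto intro: continuous_on_const)
  have \<Lambda>_add: "\<Lambda> (\<lambda>\<eta>. u \<eta> + u' \<eta>) = \<Lambda> u + \<Lambda> u'"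
    if "continuous_on (sphere 0 1) u" "continuous_on (sphere 0 1) u'" for u u'
    using add[OF that(1) c0(1) that(2) c0(1)] by (simp add: \<Lambda>_def)
  have \<Lambda>_scale: "\<Lambda> (\<lambda>\<eta>. c *\<^sub>R u \<eta>) = c * \<Lambda> u" if "continuous_on (sphere 0 1) u" for u c
    using scale[OF that c0(1), of c] by (simp add: \<Lambda>_def)
  have "\<exists>T. circle_functional T (2 * B) \<and> (\<forall>q. continuous_on (sphere 0 1) q \<longrightarrow> Re (T q) = \<Lambda> (\<lambda>\<eta>. q \<eta> *s axis i 1))" for i
  proof (rule circle_functional_complexify[of "\<lambda>q. \<Lambda> (\<lambda>\<eta>. q \<eta> *s axis i 1)" B])
    show "\<Lambda> (\<lambda>\<eta>. (p \<eta> + q \<eta>) *s axis i 1) = \<Lambda> (\<lambda>\<eta>. p \<eta> *s axis i 1) + \<Lambda> (\<lambda>\<eta>. q \<eta> *s axis i 1)"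
      if "continuous_on (sphere 0 1) p" "continuous_on (sphere 0 1) q" for p q
      using \<Lambda>_add[OF continuous_on_vector_scalar continuous_on_vector_scalar, OF that]
      by (simp add: vector_sadd_rdistrib)
    show "\<Lambda> (\<lambda>\<eta>. (of_real c * p \<eta>) *s axis i 1) = c * \<Lambda> (\<lambda>\<eta>. p \<eta> *s axis i 1)"
      if "continuous_on (sphere 0 1) p" for c p
      using \<Lambda>_scale[OF continuous_on_vector_scalar, OF that]
      by (simp add: scaleR_eq_vector_scalar vector_smult_assoc)
    show "\<bar>\<Lambda> (\<lambda>\<eta>. p \<eta> *s axis i 1)\<bar> \<le> B * N"
      if "continuous_on (sphere 0 1) p" "\<And>\<eta>. cmod \<eta> = 1 \<Longrightarrow> cmod (p \<eta>) \<le> N" for p N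
    proof -
      have "0 \<le> N" using order_trans[OF norm_ge_zero that(2)[of 1]] by simp
      then show ?thesis
        using bound[OF continuous_on_vector_scalar[OF that(1)] c0(1), of "axis i 1" N] that(2)
        by (simp add: \<Lambda>_def norm_vector_scalar norm_axis_one)
    qed
  qed blast
  then obtain L where L: "\<And>i. circle_functional (L i) (2 * B)"
    "\<And>i q. continuous_on (sphere 0 1) q \<Longrightarrow> Re (L i q) = \<Lambda> (\<lambda>\<eta>. q \<eta> *s axis i 1)"
    by metis
  obtain S where S: "circle_functional S (2 * B)"
    "\<And>q. continuous_on (sphere 0 1) q \<Longrightarrow> Re (S q) = \<Psi> (\<lambda>_. 0) (\<lambda>\<eta>. Re (q \<eta>))"
  proof (rule circle_functional_complexify[of "\<lambda>q. \<Psi> (\<lambda>_. 0) (\<lambda>\<eta>. Re (q \<eta>))" B])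
    show "\<Psi> (\<lambda>_. 0) (\<lambda>\<eta>. Re (p \<eta> + q \<eta>)) = \<Psi> (\<lambda>_. 0) (\<lambda>\<eta>. Re (p \<eta>)) + \<Psi> (\<lambda>_. 0) (\<lambda>\<eta>. Re (q \<eta>))"
      if "continuous_on (sphere 0 1) p" "continuous_on (sphere 0 1) q" for p q
      using add[OF c0(2) continuous_on_Re c0(2) continuous_on_Re, OF that] by simp
    show "\<Psi> (\<lambda>_. 0) (\<lambda>\<eta>. Re (of_real c * p \<eta>)) = c * \<Psi> (\<lambda>_. 0) (\<lambda>\<eta>. Re (p \<eta>))"
      if "continuous_on (sphere 0 1) p" for c p
      using scale[OF c0(2) continuous_on_Re[OF that], of c] by simp
    show "\<bar>\<Psi> (\<lambda>_. 0) (\<lambda>\<eta>. Re (p \<eta>))\<bar> \<le> B * N"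
      if "continuous_on (sphere 0 1) p" "\<And>\<eta>. cmod \<eta> = 1 \<Longrightarrow> cmod (p \<eta>) \<le> N" for p N
    proof -
      have "0 \<le> N" using order_trans[OF norm_ge_zero that(2)[of 1]] by simp
      moreover have "\<bar>Re (p \<eta>)\<bar> \<le> N" if "cmod \<eta> = 1" for \<eta>
        using order_trans[OF abs_Re_le_cmod \<open>\<And>\<eta>. cmod \<eta> = 1 \<Longrightarrow> cmod (p \<eta>) \<le> N\<close>[OF that]] .
      ultimately show ?thesis
        by (intro bound c0 continuous_on_Re that) auto
    qed
  qed blast
  have pair: "Re (\<Sum>i\<in>UNIV. L i q * w $ i) = \<Lambda> (\<lambda>\<eta>. q \<eta> *s w)"
    if q: "continuous_on (sphere 0 1) q" for q w
  proof -
    have A: "Re (L i q * w $ i) = \<Lambda> (\<lambda>\<eta>. q \<eta> *s ((w $ i) *s axis i 1))" for i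
    proof -
      have "L i (\<lambda>\<eta>. w $ i * q \<eta>) = w $ i * L i q" by (rule circle_functional_scale[OF L(1) q])
      moreover have "Re (L i (\<lambda>\<eta>. w $ i * q \<eta>)) = \<Lambda> (\<lambda>\<eta>. (w $ i * q \<eta>) *s axis i 1)"
        by (intro L(2) continuous_intros q)
      ultimately show ?thesis by (simp add: vector_smult_assoc mult.commute)
    qed
    have B: "\<Lambda> (\<lambda>\<eta>. q \<eta> *s (\<Sum>i\<in>I. (w $ i) *s axis i 1)) = (\<Sum>i\<in>I. \<Lambda> (\<lambda>\<eta>. q \<eta> *s ((w $ i) *s axis i 1)))"
      if "finite I" for I
      using that
    proof (induction I rule: finite_induct)
      case empty
      show ?case using \<Lambda>_scale[OF c0(2), of 0] by simp
    next
      case (insert i I)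
      have "\<Lambda> (\<lambda>\<eta>. q \<eta> *s (a + b)) = \<Lambda> (\<lambda>\<eta>. q \<eta> *s a) + \<Lambda> (\<lambda>\<eta>. q \<eta> *s b)" for a b
        using \<Lambda>_add[OF continuous_on_vector_scalar[OF q] continuous_on_vector_scalar[OF q], of a b]
        by (simp only: vector_add_ldistrib)
      then show ?case using insert by (simp only: sum.insert insert)
    qed
    have "Re (\<Sum>i\<in>UNIV. L i q * w $ i) = (\<Sum>i\<in>UNIV. \<Lambda> (\<lambda>\<eta>. q \<eta> *s ((w $ i) *s axis i 1)))"
      by (simp only: Re_sum A)
    also have "\<dots> = \<Lambda> (\<lambda>\<eta>. q \<eta> *s (\<Sum>i\<in>UNIV. (w $ i) *s axis i 1))"
      by (rule B[OF finite, symmetric])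
    finally show ?thesis by (simp only: vector_sum_axis)
  qed
  show ?thesis
  proof (rule that[of L "2 * B" S, OF L(1) S(1)])
    show "Re (\<Sum>i\<in>UNIV. L i (\<lambda>\<eta>. of_real (p \<eta>)) * w $ i) \<le> Re (S (\<lambda>\<eta>. of_real (p \<eta>)))"
      if w: "w \<in> D" and p: "continuous_on (sphere 0 1) p" "\<And>\<eta>. cmod \<eta> = 1 \<Longrightarrow> 0 \<le> p \<eta>" for w p
    proof -
      have cp: "continuous_on (sphere 0 1) (\<lambda>\<eta>. complex_of_real (p \<eta>))" by (intro continuous_intros p)
      have cw: "continuous_on (sphere 0 1) (\<lambda>\<eta>. p \<eta> *\<^sub>R w)" by (intro continuous_intros p)
      have "\<Psi> (\<lambda>\<eta>. p \<eta> *\<^sub>R w) p = \<Psi> (\<lambda>\<eta>. p \<eta> *\<^sub>R w) (\<lambda>_. 0) + \<Psi> (\<lambda>_. 0) p"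
        using add[OF cw c0(1) c0(2) p(1)] by simp
      then have "\<Lambda> (\<lambda>\<eta>. p \<eta> *\<^sub>R w) \<le> \<Psi> (\<lambda>_. 0) p" using pos[OF w p] by (simp add: \<Lambda>_def)
      then show ?thesis unfolding pair[OF cp] S(2)[OF cp] by (simp add: scaleR_eq_vector_scalar)
    qed
    show "Re (\<Sum>i\<in>UNIV. L i q * w $ i) = 0"
      if R: "1 < R" and q: "q holomorphic_on ball 0 R" "q 0 = 0" "deriv q 0 = 0" for q R w
    proof -
      have cq: "continuous_on (sphere 0 1) q"
        using R by (intro holomorphic_on_imp_continuous_on holomorphic_on_subset[OF q(1)]) auto
      have "q field_differentiable at 0"
        using R by (intro holomorphic_on_imp_differentiable_at[OF q(1)]) auto
      then have "disc_deriv (\<lambda>\<eta>. q \<eta> *s w) 0 = of_real 0 *s v"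
        using q(3) by (simp add: disc_deriv_def vec_eq_iff)
      then have "\<Psi> (\<lambda>\<eta>. q \<eta> *s w) (\<lambda>_. 0) = 0 * M - 0"
        using R by (intro val[of R]) (auto intro!: holomorphic_intros q(1) simp: q(2))
      then show ?thesis unfolding pair[OF cq] \<Lambda>_def by simp
    qed
    have "disc_deriv (\<lambda>\<eta>. \<eta> *s v) 0 = of_real 1 *s v"
      by (simp add: disc_deriv_def vec_eq_iff)
    then have "\<Psi> (\<lambda>\<eta>. \<eta> *s v) (\<lambda>_. 0) = 0 * M - 1"
      by (intro val[of 2]) (auto intro!: holomorphic_intros)
    then show "Re (\<Sum>i\<in>UNIV. L i (\<lambda>\<eta>. \<eta>) * v $ i) = 1"
      by (subst pair) (auto intro: continuous_intros simp: \<Lambda>_def)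
    have "disc_deriv (\<lambda>_. 0) 0 = (of_real 0 *s v :: complex ^ 'n)"
      by (simp add: disc_deriv_def vec_eq_iff)
    then have "\<Psi> (\<lambda>_. 0) (\<lambda>_. 1) = 1 * M - 0"
      by (intro val[of 2]) auto
    then show "Re (S (\<lambda>_. 1)) = M"
      by (subst S(2)) (auto intro: continuous_intros)
    show "Re (S (\<lambda>\<eta>. of_real (Re (q \<eta>)))) = Re (S q)" if q: "continuous_on (sphere 0 1) q" for q
    proof -
      have "continuous_on (sphere 0 1) (\<lambda>\<eta>. complex_of_real (Re (q \<eta>)))"
        by (intro continuous_intros q)
      then show ?thesis by (simp add: S(2) q)
    qed
  qed
qed

text \<open>Put \<open>h(\<zeta>) = L (\<eta>\<^sup>2 / (\<eta> - \<zeta>))\<close> and \<open>A(\<zeta>) = S ((\<eta> + \<zeta>) / (\<eta> - \<zeta>))\<close>. Positivity for the Poisson kernel in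
  place of \<open>p\<close> gives the lower bound \<open>star\<close> for \<open>Re (cnj \<zeta> (\<zeta> A(\<zeta>) - h(\<zeta>) \<cdot> w))\<close>. It remains to replace \<open>\<zeta> A(\<zeta>)\<close> by
  \<open>h(\<zeta>) \<cdot> \<phi>(\<zeta>)\<close>. The difference of the two is \<open>\<zeta> Q(\<zeta>)\<close>, where \<open>Re Q \<ge> 0\<close> by \<open>star\<close> with \<open>w = \<phi>(\<zeta>)\<close>, and
  \<open>Re (Q 0) = M - M = 0\<close> because \<open>\<phi>\<close> is extremal. So \<open>Re Q = 0\<close>, and the replacement does not change the
  real part in question.\<close>

theorem supporting_field_exists: "\<exists>h C. supporting_field D \<phi> h C"
proof -
  obtain L :: "'n \<Rightarrow> (complex \<Rightarrow> complex) \<Rightarrow> complex" and S :: "(complex \<Rightarrow> complex) \<Rightarrow> complex" and B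
    where L: "\<And>i. circle_functional (L i) B" and S: "circle_functional S B"
    and LS: "\<And>w p. w \<in> D \<Longrightarrow> continuous_on (sphere 0 1) p \<Longrightarrow> (\<And>\<eta>. cmod \<eta> = 1 \<Longrightarrow> 0 \<le> p \<eta>) \<Longrightarrow>
       Re (\<Sum>i\<in>UNIV. L i (\<lambda>\<eta>. of_real (p \<eta>)) * w $ i) \<le> Re (S (\<lambda>\<eta>. of_real (p \<eta>)))"
    and L0: "\<And>q R w. 1 < R \<Longrightarrow> q holomorphic_on ball 0 R \<Longrightarrow> q 0 = 0 \<Longrightarrow> deriv q 0 = 0 \<Longrightarrow>
       Re (\<Sum>i\<in>UNIV. L i q * w $ i) = 0"
    and Lv: "Re (\<Sum>i\<in>UNIV. L i (\<lambda>\<eta>. \<eta>) * v $ i) = 1" and S1: "Re (S (\<lambda>_. 1)) = M"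
    and SRe: "\<And>q. continuous_on (sphere 0 1) q \<Longrightarrow> Re (S (\<lambda>\<eta>. of_real (Re (q \<eta>)))) = Re (S q)"
    by (rule dual_functionals) blast
  define h :: "complex \<Rightarrow> complex ^ 'n" where "h \<zeta> = (\<chi> i. L i (\<lambda>\<eta>. \<eta>\<^sup>2 / (\<eta> - \<zeta>)))" for \<zeta>
  define A where "A \<zeta> = S (\<lambda>\<eta>. (\<eta> + \<zeta>) / (\<eta> - \<zeta>))" for \<zeta>
  have nz: "\<eta> - \<zeta> \<noteq> 0" "1 - \<eta> * cnj \<zeta> \<noteq> 0" if "cmod \<eta> = 1" "cmod \<zeta> < 1" for \<eta> \<zeta>
  proof -
    show "\<eta> - \<zeta> \<noteq> 0" using that by auto
    have "cmod (\<eta> * cnj \<zeta>) \<noteq> 1" using that by (simp add: norm_mult)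
    then show "1 - \<eta> * cnj \<zeta> \<noteq> 0" by (metis eq_iff_diff_eq_0 norm_one)
  qed
  have hol_h: "(\<lambda>\<zeta>. h \<zeta> $ i) holomorphic_on unit_disc" for i
    using cauchy_transform_holomorphic[OF L[of i], of "\<lambda>\<eta>. \<eta>\<^sup>2"] by (simp add: h_def continuous_intros)
  have hol_A: "A holomorphic_on unit_disc"
  proof (rule holomorphic_transform)
    show "(\<lambda>\<zeta>. S (\<lambda>\<eta>. 2 * \<eta> / (\<eta> - \<zeta>)) - S (\<lambda>_. 1)) holomorphic_on unit_disc"
      by (intro holomorphic_intros cauchy_transform_holomorphic[OF S] continuous_intros)
    show "S (\<lambda>\<eta>. 2 * \<eta> / (\<eta> - \<zeta>)) - S (\<lambda>_. 1) = A \<zeta>" if "\<zeta> \<in> unit_disc" for \<zeta>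
    proof -
      have \<zeta>: "cmod \<zeta> < 1" using that by simp
      have "S (\<lambda>\<eta>. 2 * \<eta> / (\<eta> - \<zeta>)) - S (\<lambda>_. 1) = S (\<lambda>\<eta>. 2 * \<eta> / (\<eta> - \<zeta>) - 1)"
        using nz[OF _ \<zeta>] by (intro circle_functional_diff[OF S, symmetric] continuous_intros) auto
      also have "\<dots> = A \<zeta>"
        unfolding A_def using nz[OF _ \<zeta>]
        by (intro circle_functional_cong[OF S] continuous_intros) (auto simp: field_simps)
      finally show ?thesis .
    qed
  qed
  have h0: "h 0 $ i = L i (\<lambda>\<eta>. \<eta>)" for i
    unfolding h_def vec_lambda_beta
    by (intro circle_functional_cong[OF L] continuous_intros) (auto simp: power2_eq_square)
  have bh: "bdot (h \<zeta>) w = (\<Sum>i\<in>UNIV. L i (\<lambda>\<eta>. \<eta>\<^sup>2 / (\<eta> - \<zeta>)) * w $ i)" for \<zeta> w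
    by (simp add: bdot_def h_def)
  have bh0: "bdot (h 0) w = (\<Sum>i\<in>UNIV. L i (\<lambda>\<eta>. \<eta>) * w $ i)" for w
    by (simp add: bdot_def h0)
  have star: "- (1 - (cmod \<zeta>)\<^sup>2) * Re (cnj \<zeta> * bdot (h 0) w) \<le> Re (cnj \<zeta> * (\<zeta> * A \<zeta> - bdot (h \<zeta>) w))"
    if w: "w \<in> D" and \<zeta>: "cmod \<zeta> < 1" for w \<zeta>
  proof -
    define c where "c = cnj \<zeta>"
    have c\<zeta>: "\<zeta> * c = of_real ((cmod \<zeta>)\<^sup>2)" by (simp only: c_def complex_norm_square)
    define F where "F \<eta> = (\<eta> + \<zeta>) / (\<eta> - \<zeta>)" for \<eta>
    define p where "p \<eta> = Re (F \<eta>)" for \<eta>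
    \<comment> \<open>The part of the Poisson kernel of order at least two at the origin, on which \<open>L\<close> vanishes.\<close>
    define q where "q \<eta> = (\<zeta> * c * c\<^sup>2) * \<eta>\<^sup>2 / (1 - \<eta> * c)" for \<eta>
    have cF: "continuous_on (sphere 0 1) F"
      unfolding F_def using nz[OF _ \<zeta>] by (intro continuous_intros) auto
    have cp: "continuous_on (sphere 0 1) p" unfolding p_def by (intro continuous_intros cF)
    have cp': "continuous_on (sphere 0 1) (\<lambda>\<eta>. complex_of_real (p \<eta>))" by (intro continuous_intros cp)
    have c1: "continuous_on (sphere 0 1) (\<lambda>\<eta>. \<eta>\<^sup>2 / (\<eta> - \<zeta>))"
      using nz[OF _ \<zeta>] by (intro continuous_intros) auto
    have c2: "continuous_on (sphere 0 1) (\<lambda>\<eta>::complex. \<eta>)" by (intro continuous_intros)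
    have cq: "continuous_on (sphere 0 1) q"
      unfolding q_def c_def using nz[OF _ \<zeta>] by (intro continuous_intros) auto
    have pF: "2 * of_real (p \<eta>) = F \<eta> + (1 + \<eta> * c) / (1 - \<eta> * c)" if \<eta>: "cmod \<eta> = 1" for \<eta>
    proof -
      have \<eta>\<eta>: "\<eta> * cnj \<eta> = 1" using \<eta> by (simp add: complex_norm_square[symmetric])
      then have \<eta>0: "\<eta> \<noteq> 0" by auto
      have "cnj \<eta> - c \<noteq> 0" using nz(1)[OF \<eta> \<zeta>] by (auto simp: c_def)
      have "cnj (F \<eta>) = (cnj \<eta> + c) / (cnj \<eta> - c)" by (simp add: F_def c_def)
      also have "\<dots> = (\<eta> * (cnj \<eta> + c)) / (\<eta> * (cnj \<eta> - c))" using \<eta>0 by simp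
      also have "\<dots> = (1 + \<eta> * c) / (1 - \<eta> * c)" by (simp add: distrib_left right_diff_distrib \<eta>\<eta>)
      finally have "cnj (F \<eta>) = (1 + \<eta> * c) / (1 - \<eta> * c)" .
      moreover have "2 * of_real (p \<eta>) = F \<eta> + cnj (F \<eta>)"
        by (simp add: p_def complex_add_cnj)
      ultimately show ?thesis by simp
    qed
    have p0: "0 \<le> p \<eta>" if \<eta>: "cmod \<eta> = 1" for \<eta>
    proof -
      have "Re ((\<eta> + \<zeta>) * cnj (\<eta> - \<zeta>)) = (cmod \<eta>)\<^sup>2 - (cmod \<zeta>)\<^sup>2"
        unfolding cmod_power2 by (simp add: power2_eq_square algebra_simps)
      also have "\<dots> \<ge> 0" using \<eta> \<zeta> by (simp add: power_le_one)
      finally have "0 \<le> Re (\<eta> + \<zeta>) * Re (\<eta> - \<zeta>) + Im (\<eta> + \<zeta>) * Im (\<eta> - \<zeta>)"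
        by (simp only: times_complex.sel cnj.sel mult_minus_right diff_minus_eq_add)
      then show ?thesis unfolding p_def F_def Re_divide' by (rule divide_nonneg_nonneg) simp
    qed
    \<comment> \<open>The Poisson kernel is split into the Cauchy kernel of \<open>h\<close>, a multiple of \<open>\<eta>\<close>, which carries
  the defect \<open>1 - |\<zeta>|\<^sup>2\<close>, and \<open>q\<close>.\<close>
    have ident: "(\<zeta> * c) * of_real (p \<eta>) = c * (\<eta>\<^sup>2 / (\<eta> - \<zeta>)) - ((1 - \<zeta> * c) * c) * \<eta> + q \<eta>"
      if \<eta>: "cmod \<eta> = 1" for \<eta>
    proof -
      have n: "\<eta> - \<zeta> \<noteq> 0" "1 - \<eta> * c \<noteq> 0" using nz[OF \<eta> \<zeta>] by (auto simp: c_def)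
      have e: "of_real (p \<eta>) = (F \<eta> + (1 + \<eta> * c) / (1 - \<eta> * c)) / 2"
        unfolding pF[OF \<eta>, symmetric] by simp
      show ?thesis
        unfolding e F_def q_def using n by (simp add: divide_simps) (simp add: algebra_simps power2_eq_square)
    qed
    have Li: "(\<zeta> * c) * L i (\<lambda>\<eta>. of_real (p \<eta>))
        = c * L i (\<lambda>\<eta>. \<eta>\<^sup>2 / (\<eta> - \<zeta>)) - ((1 - \<zeta> * c) * c) * L i (\<lambda>\<eta>. \<eta>) + L i q" for i
    proof -
      have "(\<zeta> * c) * L i (\<lambda>\<eta>. of_real (p \<eta>)) = L i (\<lambda>\<eta>. (\<zeta> * c) * of_real (p \<eta>))"
        by (rule circle_functional_scale[OF L cp', symmetric])
      also have "\<dots> = L i (\<lambda>\<eta>. (c * (\<eta>\<^sup>2 / (\<eta> - \<zeta>)) - ((1 - \<zeta> * c) * c) * \<eta>) + q \<eta>)"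
        by (intro circle_functional_cong[OF L] continuous_on_add continuous_on_diff continuous_on_mult_left cp' c1 c2 cq ident) auto
      also have "\<dots> = L i (\<lambda>\<eta>. c * (\<eta>\<^sup>2 / (\<eta> - \<zeta>)) - ((1 - \<zeta> * c) * c) * \<eta>) + L i q"
        by (intro circle_functional_add[OF L] continuous_on_add continuous_on_diff continuous_on_mult_left c1 c2 cq)
      also have "L i (\<lambda>\<eta>. c * (\<eta>\<^sup>2 / (\<eta> - \<zeta>)) - ((1 - \<zeta> * c) * c) * \<eta>)
          = L i (\<lambda>\<eta>. c * (\<eta>\<^sup>2 / (\<eta> - \<zeta>))) - L i (\<lambda>\<eta>. ((1 - \<zeta> * c) * c) * \<eta>)"
        by (intro circle_functional_diff[OF L] continuous_on_mult_left c1 c2)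
      also have "\<dots> = c * L i (\<lambda>\<eta>. \<eta>\<^sup>2 / (\<eta> - \<zeta>)) - ((1 - \<zeta> * c) * c) * L i (\<lambda>\<eta>. \<eta>)"
        by (simp only: circle_functional_scale[OF L c1] circle_functional_scale[OF L c2])
      finally show ?thesis .
    qed
    have "(\<zeta> * c) * (\<Sum>i\<in>UNIV. L i (\<lambda>\<eta>. of_real (p \<eta>)) * w $ i)
        = (\<Sum>i\<in>UNIV. (c * L i (\<lambda>\<eta>. \<eta>\<^sup>2 / (\<eta> - \<zeta>)) - ((1 - \<zeta> * c) * c) * L i (\<lambda>\<eta>. \<eta>) + L i q) * w $ i)"
      by (simp only: sum_distrib_left mult.assoc[symmetric] Li)
    also have "\<dots> = c * bdot (h \<zeta>) w - ((1 - \<zeta> * c) * c) * bdot (h 0) w + (\<Sum>i\<in>UNIV. L i q * w $ i)"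
      unfolding bh[of \<zeta>] bh0 by (simp add: sum.distrib sum_subtractf sum_distrib_left algebra_simps)
    finally have sum: "(\<zeta> * c) * (\<Sum>i\<in>UNIV. L i (\<lambda>\<eta>. of_real (p \<eta>)) * w $ i)
       = c * bdot (h \<zeta>) w - ((1 - \<zeta> * c) * c) * bdot (h 0) w + (\<Sum>i\<in>UNIV. L i q * w $ i)" .
    have "Re (\<Sum>i\<in>UNIV. L i q * w $ i) = 0"
    proof (rule L0)
      let ?R = "2 / (1 + cmod \<zeta>)"
      have pos: "0 < 1 + cmod \<zeta>" using norm_ge_zero[of \<zeta>] by linarith
      show "1 < ?R" using \<zeta> pos by (simp add: field_simps)
      have n: "1 - \<eta> * c \<noteq> 0" if "\<eta> \<in> ball 0 ?R" for \<eta>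
      proof
        assume "1 - \<eta> * c = 0"
        then have "cmod (\<eta> * c) = 1" by (metis eq_iff_diff_eq_0 norm_one)
        then have e: "cmod \<eta> * cmod \<zeta> = 1" by (simp add: norm_mult c_def)
        then have "\<zeta> \<noteq> 0" by auto
        then have "cmod \<eta> * cmod \<zeta> < ?R * cmod \<zeta>" using that by (intro mult_strict_right_mono) auto
        then have "1 < ?R * cmod \<zeta>" by (simp only: e)
        then show False using \<zeta> pos by (simp add: field_simps)
      qed
      show "q holomorphic_on ball 0 ?R"
        unfolding q_def using n by (intro holomorphic_intros) auto
      show "q 0 = 0" by (simp add: q_def)
      have "(q has_field_derivative 0) (at 0)"
        unfolding q_def by (auto intro!: derivative_eq_intros)
      then show "deriv q 0 = 0" by (rule DERIV_imp_deriv)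
    qed
    moreover have e: "((1 - \<zeta> * c) * c) * bdot (h 0) w = of_real (1 - (cmod \<zeta>)\<^sup>2) * (c * bdot (h 0) w)"
      unfolding c\<zeta> by (simp only: of_real_diff of_real_1 mult.assoc)
    have Re_of_real_mult: "Re (of_real r * z) = r * Re z" for r z by simp
    ultimately have "(cmod \<zeta>)\<^sup>2 * Re (\<Sum>i\<in>UNIV. L i (\<lambda>\<eta>. of_real (p \<eta>)) * w $ i)
        = Re (c * bdot (h \<zeta>) w) - (1 - (cmod \<zeta>)\<^sup>2) * Re (c * bdot (h 0) w)"
      using arg_cong[OF sum, of Re] unfolding e unfolding c\<zeta>
      by (simp only: add_0_right plus_complex.sel minus_complex.sel Re_of_real_mult)
    moreover have "Re (\<Sum>i\<in>UNIV. L i (\<lambda>\<eta>. of_real (p \<eta>)) * w $ i) \<le> Re (A \<zeta>)"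
    proof -
      have "Re (S (\<lambda>\<eta>. of_real (p \<eta>))) = Re (A \<zeta>)"
        using SRe[OF cF] unfolding p_def[abs_def] A_def F_def[abs_def] .
      then show ?thesis using LS[OF w cp p0] by simp
    qed
    then have "(cmod \<zeta>)\<^sup>2 * Re (\<Sum>i\<in>UNIV. L i (\<lambda>\<eta>. of_real (p \<eta>)) * w $ i) \<le> (cmod \<zeta>)\<^sup>2 * Re (A \<zeta>)"
      by (intro mult_left_mono) auto
    moreover have "Re (c * (\<zeta> * A \<zeta> - bdot (h \<zeta>) w)) = (cmod \<zeta>)\<^sup>2 * Re (A \<zeta>) - Re (c * bdot (h \<zeta>) w)"
    proof -
      have "c * (\<zeta> * A \<zeta> - bdot (h \<zeta>) w) = of_real ((cmod \<zeta>)\<^sup>2) * A \<zeta> - c * bdot (h \<zeta>) w"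
        by (simp only: c\<zeta>[symmetric] right_diff_distrib mult.assoc mult.left_commute)
      then show ?thesis by (simp del: of_real_power)
    qed
    ultimately show ?thesis unfolding c_def[symmetric] mult_minus_left by linarith
  qed
  obtain N where N: "\<And>w. w \<in> D \<Longrightarrow> norm w \<le> N" using bounded_D unfolding bounded_iff by blast
  have N0: "0 \<le> N" using N[OF zero_D] by simp
  define C where "C = norm (h 0) * N"
  have C0: "0 \<le> C" using N0 by (simp add: C_def)
  have star': "- C * (1 - (cmod \<zeta>)\<^sup>2) \<le> Re (cnj \<zeta> * (\<zeta> * A \<zeta> - bdot (h \<zeta>) w))"
    if w: "w \<in> D" and \<zeta>: "cmod \<zeta> < 1" for w \<zeta>
  proof -
    have "Re (cnj \<zeta> * bdot (h 0) w) \<le> cmod \<zeta> * cmod (bdot (h 0) w)"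
      using complex_Re_le_cmod[of "cnj \<zeta> * bdot (h 0) w"] by (simp add: norm_mult)
    also have "\<dots> \<le> 1 * (norm (h 0) * norm w)"
      using \<zeta> by (intro mult_mono norm_bdot_le) auto
    also have "\<dots> \<le> C" unfolding C_def using N[OF w] by (auto intro: mult_left_mono)
    finally have "(1 - (cmod \<zeta>)\<^sup>2) * Re (cnj \<zeta> * bdot (h 0) w) \<le> (1 - (cmod \<zeta>)\<^sup>2) * C"
      using \<zeta> by (intro mult_left_mono) (auto simp: power_le_one)
    then show ?thesis
      using star[OF w \<zeta>] unfolding mult_minus_left mult.commute[of C] by linarith
  qed
  \<comment> \<open>\<open>\<phi>1\<close> is \<open>\<phi>\<close> divided by \<open>\<zeta>\<close>.\<close>
  define \<phi>1 where "\<phi>1 \<zeta> = (\<chi> i. if \<zeta> = 0 then deriv (\<lambda>\<zeta>. \<phi> \<zeta> $ i) 0 else (\<phi> \<zeta> $ i - \<phi> 0 $ i) / (\<zeta> - 0))" for \<zeta>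
  have hol_\<phi>1: "(\<lambda>\<zeta>. \<phi>1 \<zeta> $ i) holomorphic_on unit_disc" for i
    unfolding \<phi>1_def vec_lambda_beta
    using \<phi>(1) by (intro pole_lemma_open) (auto simp: analytic_disc_def)
  have \<phi>1: "\<phi> \<zeta> = \<zeta> *s \<phi>1 \<zeta>" for \<zeta>
    using \<phi>(2) by (auto simp: \<phi>1_def vec_eq_iff)
  define Q where "Q \<zeta> = A \<zeta> - bdot (h \<zeta>) (\<phi>1 \<zeta>)" for \<zeta>
  have hol_Q: "Q holomorphic_on unit_disc"
    unfolding Q_def by (intro holomorphic_intros hol_A holomorphic_on_bdot hol_h hol_\<phi>1)
  have \<phi>D: "\<phi> \<zeta> \<in> D" if "cmod \<zeta> < 1" for \<zeta> using \<phi>(1) that by (auto simp: analytic_disc_def)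
  have ReQ: "- C * (1 - (cmod \<zeta>)\<^sup>2) \<le> (cmod \<zeta>)\<^sup>2 * Re (Q \<zeta>)" if \<zeta>: "cmod \<zeta> < 1" for \<zeta>
  proof -
    have "cnj \<zeta> * (\<zeta> * A \<zeta> - bdot (h \<zeta>) (\<phi> \<zeta>)) = (\<zeta> * cnj \<zeta>) * Q \<zeta>"
      unfolding \<phi>1[of \<zeta>] Q_def by (simp add: algebra_simps)
    also have "\<dots> = of_real ((cmod \<zeta>)\<^sup>2) * Q \<zeta>" by (simp only: complex_norm_square)
    finally show ?thesis using star'[OF \<phi>D[OF \<zeta>] \<zeta>] by (simp del: of_real_power)
  qed
  have nn: "0 \<le> Re (Q \<zeta>)" if \<zeta>: "cmod \<zeta> < 1" for \<zeta>
  proof (rule Re_nonneg_of_limit[where N = "\<lambda>_. Q" and \<zeta> = \<zeta> and \<delta> = "\<lambda>r. C * (1 - r\<^sup>2) / r\<^sup>2"])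
    have "\<forall>\<^sub>F r in at_left (1::real). 0 < r \<and> r < 1"
      using eventually_at_left_real[of 0 1] by (auto elim: eventually_mono)
    then show "\<forall>\<^sub>F r in at_left 1. \<forall>\<zeta>. cmod \<zeta> = r \<longrightarrow> - (C * (1 - r\<^sup>2) / r\<^sup>2) \<le> Re (Q \<zeta>)"
    proof eventually_elim
      case (elim r)
      show ?case
      proof (intro allI impI)
        fix \<zeta> assume "cmod \<zeta> = r"
        then have "- C * (1 - r\<^sup>2) \<le> r\<^sup>2 * Re (Q \<zeta>)" using ReQ[of \<zeta>] elim by simp
        then have "- C * (1 - r\<^sup>2) / r\<^sup>2 \<le> Re (Q \<zeta>)"
          using elim by (subst pos_divide_le_eq) (auto simp: mult.commute)
        then show "- (C * (1 - r\<^sup>2) / r\<^sup>2) \<le> Re (Q \<zeta>)" by simp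
      qed
    qed
    have "((\<lambda>r::real. C * (1 - r\<^sup>2) / r\<^sup>2) \<longlongrightarrow> C * (1 - 1\<^sup>2) / 1\<^sup>2) (at_left 1)"
      by (intro tendsto_intros) auto
    then show "((\<lambda>r::real. C * (1 - r\<^sup>2) / r\<^sup>2) \<longlongrightarrow> 0) (at_left 1)" by simp
  qed (use hol_Q \<zeta> in auto)
  have "Re (Q 0) = 0"
  proof -
    have "A 0 = S (\<lambda>_. 1)"
      unfolding A_def by (intro circle_functional_cong[OF S] continuous_intros) auto
    moreover have "\<phi>1 0 = of_real M *s v"
      using \<phi>(3) by (simp add: \<phi>1_def disc_deriv_def)
    ultimately have "Q 0 = S (\<lambda>_. 1) - of_real M * bdot (h 0) v" by (simp add: Q_def)
    moreover have "Re (bdot (h 0) v) = 1" using Lv unfolding bh0 .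
    ultimately show ?thesis by (simp add: S1)
  qed
  from Re_zero_of_Re_nonneg[OF hol_Q nn _ this] have Q0: "Re (Q \<zeta>) = 0" if "cmod \<zeta> < 1" for \<zeta>
    using that by simp
  have "supporting_field D \<phi> h C"
  proof
    show "open D" "connected D" "analytic_disc D \<phi>"
      using open_D convex_D \<phi> convex_connected by auto
    show "(\<lambda>\<zeta>. h \<zeta> $ i) holomorphic_on unit_disc" for i by (rule hol_h)
    show "h 0 \<noteq> 0"
    proof
      assume "h 0 = 0"
      then have "Re (bdot (h 0) v) = 0" by simp
      then show False using Lv unfolding bh0 by simp
    qed
    show "- C * (1 - (cmod \<zeta>)\<^sup>2) \<le> Re (cnj \<zeta> * bdot (h \<zeta>) (\<phi> \<zeta> - w))"
      if w: "w \<in> D" and \<zeta>: "cmod \<zeta> < 1" for w \<zeta>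
    proof -
      have "cnj \<zeta> * bdot (h \<zeta>) (\<phi> \<zeta> - w)
          = cnj \<zeta> * (\<zeta> * A \<zeta> - bdot (h \<zeta>) w) - (\<zeta> * cnj \<zeta>) * Q \<zeta>"
        by (subst \<phi>1[of \<zeta>]) (simp add: Q_def algebra_simps)
      also have "\<zeta> * cnj \<zeta> = of_real ((cmod \<zeta>)\<^sup>2)" by (simp only: complex_norm_square)
      finally show ?thesis using star'[OF w \<zeta>] Q0[OF \<zeta>] by (simp del: of_real_power)
    qed
  qed
  then show ?thesis by blast
qed

end

section \<open>The Poincare distance\<close>

lemma tanh_artanh:
  fixes x :: real assumes "-1 < x" "x < 1" shows "tanh (artanh x) = x"
proof -
  have pos: "(1 + x) / (1 - x) > 0" using assms by simp
  have "exp (- 2 * artanh x) = inverse ((1 + x) / (1 - x))"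
    using pos by (simp add: artanh_def exp_minus)
  then have e: "exp (- 2 * artanh x) = (1 - x) / (1 + x)" by (simp add: inverse_eq_divide)
  show ?thesis unfolding tanh_real_altdef e using assms by (simp add: field_simps)
qed

lemma artanh_le_iff:
  fixes x y :: real assumes "-1 < x" "x < 1" "-1 < y" "y < 1"
  shows "artanh x \<le> artanh y \<longleftrightarrow> x \<le> y"
  using tanh_real_le_iff[of "artanh x" "artanh y"] tanh_artanh assms by auto

lemma artanh_less_iff:
  fixes x y :: real assumes "-1 < x" "x < 1" "-1 < y" "y < 1"
  shows "artanh x < artanh y \<longleftrightarrow> x < y"
  using artanh_le_iff[of y x] assms by auto

lemma artanh_nonneg: fixes x :: real assumes "0 \<le> x" "x < 1" shows "0 \<le> artanh x"
  using artanh_le_iff[of 0 x] assms by simp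

lemma artanh_add:
  fixes a b :: real assumes "0 \<le> a" "a < 1" "0 \<le> b" "b < 1"
  shows "artanh a + artanh b = artanh ((a + b) / (1 + a * b))"
proof -
  have "tanh (artanh a + artanh b) = (a + b) / (1 + a * b)"
    using assms by (simp add: tanh_add tanh_artanh cosh_real_nonzero)
  then show ?thesis by (metis artanh_tanh_real)
qed

lemma Moebius_in_disc:
  "w \<in> unit_disc \<Longrightarrow> z \<in> unit_disc \<Longrightarrow> Moebius_function 0 w z \<in> unit_disc"
  using Moebius_function_norm_lt_1[of w z 0] by simp

lemma poincare_dist_Moebius: "poincare_dist z w = artanh (cmod (Moebius_function 0 w z))"
  by (simp add: poincare_dist_def Moebius_function_simple)

lemma poincare_dist_commute: "poincare_dist z w = poincare_dist w z"
proof -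
  have "cmod (1 - cnj w * z) = cmod (1 - cnj z * w)"
    by (metis complex_cnj_cnj complex_cnj_diff complex_cnj_mult complex_cnj_one complex_mod_cnj mult.commute)
  then show ?thesis by (simp add: poincare_dist_def norm_divide norm_minus_commute)
qed

lemma poincare_dist_nonneg:
  "z \<in> unit_disc \<Longrightarrow> w \<in> unit_disc \<Longrightarrow> 0 \<le> poincare_dist z w"
  unfolding poincare_dist_Moebius using Moebius_in_disc[of w z] by (intro artanh_nonneg) auto

lemma poincare_dist_0 [simp]: "poincare_dist z 0 = artanh (cmod z)"
  by (simp add: poincare_dist_def)

lemma Schwarz_Pick:
  assumes F: "F holomorphic_on unit_disc" "F ` unit_disc \<subseteq> unit_disc"
    and a: "a \<in> unit_disc" and b: "b \<in> unit_disc"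
  shows "poincare_dist (F a) (F b) \<le> poincare_dist a b"
proof -
  let ?M = "Moebius_function 0"
  have b': "- b \<in> unit_disc" using b by simp
  have Fb: "F b \<in> unit_disc" using F(2) b by blast
  define G where "G = ?M (F b) \<circ> (F \<circ> ?M (- b))"
  have hol: "?M w holomorphic_on unit_disc" if "w \<in> unit_disc" for w
    using Moebius_function_holomorphic[of w 0] that by simp
  have img: "?M (- b) ` unit_disc \<subseteq> unit_disc" using Moebius_in_disc[OF b'] by blast
  have "F \<circ> ?M (- b) holomorphic_on unit_disc"
    by (rule holomorphic_on_compose_gen[OF hol[OF b'] F(1) img])
  moreover have "(F \<circ> ?M (- b)) ` unit_disc \<subseteq> unit_disc" using img F(2) by force
  ultimately have G: "G holomorphic_on ball 0 1"
    unfolding G_def by (intro holomorphic_on_compose_gen[OF _ hol[OF Fb]])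
  have G0: "G 0 = 0" by (simp add: G_def Moebius_function_def)
  have Glt: "cmod (G z) < 1" if "cmod z < 1" for z
  proof -
    have "?M (- b) z \<in> unit_disc" using that b' by (intro Moebius_in_disc) auto
    then have "F (?M (- b) z) \<in> unit_disc" using F(2) by blast
    from Moebius_in_disc[OF Fb this] show ?thesis by (simp add: G_def)
  qed
  define x where "x = ?M b a"
  have x: "x \<in> unit_disc" unfolding x_def by (rule Moebius_in_disc[OF b a])
  have "?M (- b) x = a"
    unfolding x_def using a b by (intro Moebius_function_compose) auto
  then have "G x = ?M (F b) (F a)" by (simp add: G_def)
  moreover have "cmod (G x) \<le> cmod x"
    using Schwarz_Lemma(1)[OF G G0 Glt, of x] x by simp
  ultimately have "cmod (?M (F b) (F a)) \<le> cmod (?M b a)" by (simp add: x_def)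
  moreover have "?M (F b) (F a) \<in> unit_disc" using F(2) a by (intro Moebius_in_disc Fb) blast
  ultimately show ?thesis
    unfolding poincare_dist_Moebius using x
    by (subst artanh_le_iff) (auto simp: x_def intro: less_le_trans[OF _ norm_ge_zero])
qed

text \<open>Subtract \<open>|z - w|\<^sup>2 = |1 - cnj w z|\<^sup>2 - (1 - |z|\<^sup>2)(1 - |w|\<^sup>2)\<close> and use \<open>|1 - cnj w z| \<le> 1 + |z||w|\<close>.\<close>

lemma pseudo_dist_le:
  assumes "cmod z < 1" "cmod w < 1"
  shows "cmod (Moebius_function 0 w z) \<le> (cmod z + cmod w) / (1 + cmod z * cmod w)"
proof -
  define a b where "a = cmod z" and "b = cmod w"
  have ab: "0 \<le> a" "a < 1" "0 \<le> b" "b < 1" using assms by (auto simp: a_def b_def)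
  define N where "N = cmod (1 - cnj w * z)"
  have id: "(cmod (z - w))\<^sup>2 = N\<^sup>2 - (1 - a\<^sup>2) * (1 - b\<^sup>2)"
    unfolding N_def a_def b_def cmod_power2 by (simp add: power2_eq_square algebra_simps)
  have "N \<le> 1 + a * b"
    using norm_triangle_ineq4[of 1 "cnj w * z"] by (simp add: N_def a_def b_def norm_mult mult.commute)
  have N0: "N > 0" using one_minus_cnj_mult_nonzero[OF assms(2,1)] by (simp add: N_def)
  have p: "0 \<le> (1 - a\<^sup>2) * (1 - b\<^sup>2)" using ab by (simp add: power_le_one)
  have ab0: "1 + a * b > 0" using ab by (simp add: add_pos_nonneg)
  have "(cmod (z - w) / N)\<^sup>2 = 1 - (1 - a\<^sup>2) * (1 - b\<^sup>2) / N\<^sup>2"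
    unfolding power_divide id using N0 by (simp add: field_simps)
  also have "\<dots> \<le> 1 - (1 - a\<^sup>2) * (1 - b\<^sup>2) / (1 + a * b)\<^sup>2"
    using p N0 \<open>N \<le> 1 + a * b\<close> ab0 by (intro diff_left_mono divide_left_mono power_mono mult_pos_pos zero_less_power) auto
  also have "\<dots> = ((a + b) / (1 + a * b))\<^sup>2"
    using ab0 by (simp add: power_divide divide_simps) (simp add: power2_eq_square algebra_simps)
  finally have "cmod (z - w) / N \<le> (a + b) / (1 + a * b)"
    by (rule power2_le_imp_le) (use ab in simp)
  then show ?thesis by (simp add: Moebius_function_simple norm_divide N_def a_def b_def)
qed

text \<open>A Moebius transformation moves \<open>b\<close> to the origin. There the bound of \<open>pseudo_dist_le\<close> is the
  right-hand side of the addition formula for \<open>artanh\<close>.\<close>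

lemma poincare_dist_triangle:
  assumes a: "a \<in> unit_disc" and b: "b \<in> unit_disc" and c: "c \<in> unit_disc"
  shows "poincare_dist a c \<le> poincare_dist a b + poincare_dist b c"
proof -
  let ?M = "Moebius_function 0"
  let ?a = "?M b a" and ?c = "?M b c"
  have in_disc: "?a \<in> unit_disc" "?c \<in> unit_disc" by (rule Moebius_in_disc[OF b a], rule Moebius_in_disc[OF b c])
  have inv: "?M (- b) ?a = a" "?M (- b) ?c = c" using a b c by (auto intro!: Moebius_function_compose)
  have b': "- b \<in> unit_disc" using b by simp
  have "poincare_dist (?M (- b) ?a) (?M (- b) ?c) \<le> poincare_dist ?a ?c"
    using Moebius_in_disc[OF b'] b by (intro Schwarz_Pick Moebius_function_holomorphic in_disc) auto
  also have "\<dots> \<le> artanh ((cmod ?a + cmod ?c) / (1 + cmod ?a * cmod ?c))"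
  proof -
    have "cmod (?M ?c ?a) \<le> (cmod ?a + cmod ?c) / (1 + cmod ?a * cmod ?c)"
      using in_disc by (intro pseudo_dist_le) auto
    moreover have "(cmod ?a + cmod ?c) / (1 + cmod ?a * cmod ?c) < 1"
    proof -
      have "0 < (1 - cmod ?a) * (1 - cmod ?c)" using in_disc by simp
      then have "cmod ?a + cmod ?c < 1 + cmod ?a * cmod ?c" by (simp add: algebra_simps)
      then show ?thesis by (simp add: add_nonneg_pos add_pos_nonneg)
    qed
    moreover have "-1 < cmod (?M ?c ?a)" by (rule less_le_trans[OF _ norm_ge_zero]) simp
    ultimately show ?thesis
      unfolding poincare_dist_Moebius by (subst artanh_le_iff) auto
  qed
  also have "\<dots> = artanh (cmod ?a) + artanh (cmod ?c)"
    using in_disc by (intro artanh_add[symmetric]) auto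
  finally show ?thesis
    by (simp add: inv poincare_dist_Moebius[symmetric] poincare_dist_commute[of b c])
qed

text \<open>Write \<open>F(z) = z \<psi>(z)\<close>. If the derivative \<open>\<psi>(0)\<close> is large, Schwarz-Pick for \<open>\<psi>\<close> gives \<open>|\<psi>| \<ge> s\<close> on the circle
  of radius \<open>s = sqrt t\<close>, so \<open>|F| \<ge> t\<close> there. The open mapping \<open>F\<close> then covers the disc of radius \<open>t\<close>. The
  constant is \<open>tanh (2 artanh s)\<close>.\<close>

lemma image_contains_ball:
  assumes F: "F holomorphic_on unit_disc" "F ` unit_disc \<subseteq> unit_disc" "F 0 = 0"
    and t: "0 < t" "t < 1" and not: "\<not> ball 0 t \<subseteq> F ` unit_disc"
  shows "cmod (deriv F 0) \<le> 2 * sqrt t / (1 + t)"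
proof (rule ccontr)
  assume "\<not> ?thesis"
  then have big: "2 * sqrt t / (1 + t) < cmod (deriv F 0)" by simp
  define s where "s = sqrt t"
  have s: "0 < s" "s < 1" "s * s = t" using t by (auto simp: s_def)
  have Flt: "cmod (F z) < 1" if "cmod z < 1" for z using F(2) that by (auto simp: image_subset_iff)
  have no_rot: "\<not> (\<exists>\<alpha>. (\<forall>z. cmod z < 1 \<longrightarrow> F z = \<alpha> * z) \<and> cmod \<alpha> = 1)"
  proof
    assume "\<exists>\<alpha>. (\<forall>z. cmod z < 1 \<longrightarrow> F z = \<alpha> * z) \<and> cmod \<alpha> = 1"
    then obtain \<alpha> where \<alpha>: "\<And>z. cmod z < 1 \<Longrightarrow> F z = \<alpha> * z" "cmod \<alpha> = 1" by blast
    have "ball 0 t \<subseteq> F ` unit_disc"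
    proof
      fix w :: complex assume "w \<in> ball 0 t"
      then have "cmod (w / \<alpha>) < 1" using t \<alpha>(2) by (simp add: norm_divide)
      moreover from \<alpha>(1)[OF this] have "F (w / \<alpha>) = w" using \<alpha>(2) by auto
      ultimately show "w \<in> F ` unit_disc" by (intro image_eqI[of _ _ "w / \<alpha>"]) auto
    qed
    then show False using not by simp
  qed
  have SL: "cmod (F z) \<le> cmod z" "cmod (deriv F 0) \<le> 1" if "cmod z < 1" for z
    using Schwarz_Lemma(1,2)[OF F(1,3) Flt that] by auto
  have strict: "\<not> (\<exists>z. cmod z < 1 \<and> z \<noteq> 0 \<and> cmod (F z) = cmod z)" "cmod (deriv F 0) \<noteq> 1"
    using Schwarz_Lemma(3)[OF F(1,3) Flt, of 0] no_rot by auto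
  define \<psi> where "\<psi> z = (if z = 0 then deriv F 0 else (F z - F 0) / (z - 0))" for z
  have hol: "\<psi> holomorphic_on unit_disc"
    unfolding \<psi>_def by (rule pole_lemma_open[OF F(1)]) simp
  have \<psi>lt: "cmod (\<psi> z) < 1" if z: "cmod z < 1" for z
  proof (cases "z = 0")
    case True
    then show ?thesis using SL(2)[of 0] strict(2) by (auto simp: \<psi>_def less_le)
  next
    case False
    then have "cmod (F z) < cmod z" using SL(1)[OF z] strict(1) z by (auto simp: less_le)
    then show ?thesis using False F(3) by (simp add: \<psi>_def norm_divide)
  qed
  have lower: "t \<le> cmod (F z - F 0)" if z: "cmod z = s" for z
  proof -
    have zd: "z \<in> unit_disc" using z s by simp
    have "s \<le> cmod (\<psi> z)"
    proof (rule ccontr)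
      assume "\<not> s \<le> cmod (\<psi> z)"
      then have less: "cmod (\<psi> z) < s" by simp
      have d: "\<psi> z \<in> unit_disc" "\<psi> 0 \<in> unit_disc" using \<psi>lt zd by auto
      have "artanh (cmod (\<psi> 0)) = poincare_dist (\<psi> 0) 0" by simp
      also have "\<dots> \<le> poincare_dist (\<psi> 0) (\<psi> z) + poincare_dist (\<psi> z) 0"
        using d by (intro poincare_dist_triangle) auto
      also have "poincare_dist (\<psi> 0) (\<psi> z) \<le> poincare_dist 0 z"
        using \<psi>lt zd by (intro Schwarz_Pick hol) auto
      also have "poincare_dist 0 z = artanh s"
        unfolding poincare_dist_commute[of 0] using z by simp
      also have "poincare_dist (\<psi> z) 0 < artanh s"
        using less s order.strict_trans2[of "-1" 0 "cmod (\<psi> z)"] by (simp add: artanh_less_iff)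
      also have "artanh s + artanh s = artanh (2 * s / (1 + t))"
        using s by (simp add: artanh_add)
      finally have "artanh (cmod (\<psi> 0)) < artanh (2 * s / (1 + t))" by simp
      moreover have "artanh (2 * s / (1 + t)) < artanh (cmod (\<psi> 0))"
      proof (subst artanh_less_iff)
        have "0 \<le> 2 * s / (1 + t)" using s t by simp
        then show "-1 < 2 * s / (1 + t)" by linarith
        show "2 * s / (1 + t) < cmod (\<psi> 0)" "cmod (\<psi> 0) < 1"
          using big \<psi>lt[of 0] by (auto simp: \<psi>_def s_def)
        then show "2 * s / (1 + t) < 1" by simp
        show "-1 < cmod (\<psi> 0)" by (rule less_le_trans[OF _ norm_ge_zero]) simp
      qed
      ultimately show False by simp
    qed
    then have "s * s \<le> cmod z * cmod (\<psi> z)" unfolding z using s by (intro mult_left_mono) auto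
    also have "cmod z * cmod (\<psi> z) = cmod (F z - F 0)" using z s by (auto simp: \<psi>_def norm_divide)
    finally show ?thesis unfolding s(3) .
  qed
  have "ball (F 0) t \<subseteq> F ` cball 0 s"
  proof (rule ball_subset_open_map_image)
    have sub: "cball 0 s \<subseteq> unit_disc" using s by auto
    show "continuous_on (closure (cball 0 s)) F"
      using holomorphic_on_imp_continuous_on[OF F(1)] sub by (simp add: continuous_on_subset)
    show "open (F ` interior (cball 0 s))"
    proof (rule open_mapping_thm[OF F(1)])
      show "\<not> F constant_on unit_disc"
      proof
        assume "F constant_on unit_disc"
        then have "F (of_real s) = F 0" using s by (auto simp: constant_on_def)
        then show False using lower[of "of_real s"] s t by simp
      qed
      show "interior (cball 0 s) \<subseteq> unit_disc" using sub interior_subset by blast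
    qed auto
    show "t \<le> cmod (F z - F 0)" if "z \<in> frontier (cball 0 s)" for z using lower that by simp
  qed (use s t in auto)
  moreover have "F ` cball 0 s \<subseteq> F ` unit_disc" using s by (intro image_mono) auto
  ultimately show False using not F(3) by auto
qed

text \<open>\<open>U\<close> need not be connected. A maximal set of points outside \<open>U\<close> with mutual distances at least one is
  discrete, so its complement \<open>V\<close> in the disc is a domain; and each point of the disc outside \<open>U\<close> has one of its points at
  distance less than one, so \<open>V\<close> contains only slightly larger hyperbolic discs than \<open>U\<close>.\<close>

lemma bloch_superdomain:
  assumes U: "U \<subseteq> unit_disc" and R: "0 \<le> R"
    and far: "\<And>\<zeta>. \<zeta> \<in> unit_disc \<Longrightarrow> \<exists>p\<in>unit_disc - U. poincare_dist p \<zeta> < R"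
  shows "\<exists>V. bloch_subdomain poincare_dist unit_disc V \<and> U \<subseteq> V \<and>
      bloch_radius poincare_dist unit_disc V \<le> ereal (R + 1)"
proof -
  define sep where "sep E \<longleftrightarrow> E \<subseteq> unit_disc - U \<and>
    (\<forall>x\<in>E. \<forall>y\<in>E. x \<noteq> y \<longrightarrow> 1 \<le> poincare_dist x y)" for E
  have "\<exists>E\<in>Collect sep. \<forall>X\<in>Collect sep. E \<subseteq> X \<longrightarrow> X = E"
  proof (rule subset_Zorn_nonempty)
    show "Collect sep \<noteq> {}" by (auto simp: sep_def intro!: exI[of _ "{}"])
    fix \<C> assume \<C>: "\<C> \<noteq> {}" "subset.chain (Collect sep) \<C>"
    then have sub: "\<And>E. E \<in> \<C> \<Longrightarrow> sep E" and tot: "\<And>A B. A \<in> \<C> \<Longrightarrow> B \<in> \<C> \<Longrightarrow> A \<subseteq> B \<or> B \<subseteq> A"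
      by (auto simp: subset_chain_def)
    have "1 \<le> poincare_dist x y" if xy: "x \<in> \<Union>\<C>" "y \<in> \<Union>\<C>" "x \<noteq> y" for x y
    proof -
      obtain A B where "A \<in> \<C>" "x \<in> A" "B \<in> \<C>" "y \<in> B" using xy by blast
      then obtain G where "G \<in> \<C>" "x \<in> G" "y \<in> G" using tot by blast
      then show ?thesis using sub[of G] xy(3) by (simp add: sep_def)
    qed
    moreover have "\<Union>\<C> \<subseteq> unit_disc - U" using sub by (auto simp: sep_def)
    ultimately show "\<Union>\<C> \<in> Collect sep" by (auto simp: sep_def)
  qed
  then obtain E where "sep E" and max: "\<And>X. sep X \<Longrightarrow> E \<subseteq> X \<Longrightarrow> X = E" by blast
  then have E: "E \<subseteq> unit_disc - U" "\<And>x y. x \<in> E \<Longrightarrow> y \<in> E \<Longrightarrow> x \<noteq> y \<Longrightarrow> 1 \<le> poincare_dist x y"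
    by (auto simp: sep_def)
  have near: "\<exists>e\<in>E. poincare_dist e p < 1" if p: "p \<in> unit_disc - U" for p
  proof (cases "p \<in> E")
    case True
    then show ?thesis by (intro bexI[of _ p]) (simp_all add: poincare_dist_def)
  next
    case False
    then have "\<not> sep (insert p E)" using max[of "insert p E"] by blast
    have "\<exists>e\<in>E. \<not> 1 \<le> poincare_dist e p"
    proof (rule ccontr)
      assume "\<not> ?thesis"
      then have far: "\<And>e. e \<in> E \<Longrightarrow> 1 \<le> poincare_dist e p" by blast
      then have far': "\<And>e. e \<in> E \<Longrightarrow> 1 \<le> poincare_dist p e" by (simp add: poincare_dist_commute[of p])
      have "sep (insert p E)" using E p far far' by (auto simp: sep_def)
      then show False using \<open>\<not> sep (insert p E)\<close> by blast
    qed
    then show ?thesis by force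
  qed
  have sparse: "E sparse_in unit_disc"
    unfolding sparse_in_open[OF open_ball]
  proof
    fix y assume y: "y \<in> unit_disc"
    let ?f = "\<lambda>p. (p - y) / (1 - cnj y * p)"
    have nz: "1 - cnj y * y \<noteq> 0" using one_minus_cnj_mult_nonzero[of y y] y by simp
    have "isCont ?f y"
      using nz by (intro isCont_divide) simp_all
    moreover have "0 < tanh (1 / 2 :: real)" by simp
    ultimately obtain e1 where e1: "e1 > 0" "\<And>p. dist p y < e1 \<Longrightarrow> dist (?f p) (?f y) < tanh (1 / 2)"
      unfolding continuous_at_eps_delta by blast
    have close: "poincare_dist p y < 1 / 2" if "dist p y < e1" for p
    proof -
      have "cmod (?f p) < tanh (1 / 2)" using e1(2)[OF that] by simp
      then have "artanh (cmod (?f p)) < artanh (tanh (1 / 2))"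
        using tanh_real_lt_1[of "1/2"] order.strict_trans2[of "-1" 0 "cmod (?f p)"]
          order.strict_trans2[of "-1" 0 "tanh (1/2 :: real)"]
        by (subst artanh_less_iff) auto
      then show ?thesis by (simp add: poincare_dist_def artanh_tanh_real)
    qed
    have "\<not> infinite (E \<inter> ball y e1)"
    proof -
      have "p = q" if "p \<in> E \<inter> ball y e1" "q \<in> E \<inter> ball y e1" for p q
      proof (rule ccontr)
        assume "p \<noteq> q"
        then have "1 \<le> poincare_dist p q" using E(2) that by blast
        also have "\<dots> \<le> poincare_dist p y + poincare_dist y q"
          using E(1) that y by (intro poincare_dist_triangle) auto
        also have "\<dots> < 1"
          using close[of p] close[of q] that by (auto simp: dist_commute poincare_dist_commute[of y q])
        finally show False by simp
      qed
      then have "E \<inter> ball y e1 \<subseteq> {THE p. p \<in> E \<inter> ball y e1}"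
        by (metis (no_types, lifting) insertI1 subsetI the_equality)
      then show ?thesis using finite_subset by blast
    qed
    then show "\<not> y islimpt E" using e1(1) islimpt_eq_infinite_ball by blast
  qed
  define V where "V = unit_disc - E"
  have "open V" unfolding V_def by (rule open_diff_sparse_pts[OF open_ball sparse])
  moreover have "connected V"
    unfolding V_def by (rule sparse_imp_connected[OF _ _ _ sparse]) auto
  moreover have rad: "bloch_radius poincare_dist unit_disc V \<le> ereal (R + 1)"
    unfolding bloch_radius_def
  proof (rule SUP_least)
    fix r assume "r \<in> {r. 0 \<le> r \<and> (\<exists>z\<in>unit_disc. hyp_ball poincare_dist unit_disc z r \<subseteq> V)}"
    then obtain z where z: "z \<in> unit_disc" "hyp_ball poincare_dist unit_disc z r \<subseteq> V" by blast
    obtain p where p: "p \<in> unit_disc - U" "poincare_dist p z < R" using far[OF z(1)] by blast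
    obtain e where e: "e \<in> E" "poincare_dist e p < 1" using near[OF p(1)] by blast
    have "e \<notin> hyp_ball poincare_dist unit_disc z r" using e z(2) by (auto simp: V_def)
    then have "r \<le> poincare_dist e z" using e E(1) by (auto simp: hyp_ball_def)
    also have "\<dots> \<le> poincare_dist e p + poincare_dist p z"
      using e E(1) p z by (intro poincare_dist_triangle) auto
    also have "\<dots> \<le> R + 1" using e p by simp
    finally show "ereal r \<le> ereal (R + 1)" by simp
  qed
  moreover have "bloch_radius poincare_dist unit_disc V < \<infinity>"
    using rad by (rule le_less_trans) simp
  ultimately show ?thesis
    using E(1) U by (intro exI[of _ V]) (auto simp: bloch_subdomain_def subdomain_def is_domain_def V_def)
qed

section \<open>The Kobayashi distance and Lempert devices\<close>

lemma analytic_disc_has_derivative: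
  assumes f: "analytic_disc D f" and \<zeta>: "\<zeta> \<in> unit_disc"
  shows "(f has_derivative (\<lambda>t. t *s disc_deriv f \<zeta>)) (at \<zeta>)"
proof -
  have "((\<lambda>\<zeta>. f \<zeta> $ i) has_field_derivative disc_deriv f \<zeta> $ i) (at \<zeta>)" for i
    using f holomorphic_derivI[OF _ open_ball \<zeta>, of "\<lambda>\<zeta>. f \<zeta> $ i"] by (simp add: analytic_disc_def disc_deriv_def)
  then have "((\<lambda>\<zeta>. (f \<zeta> $ i) *s axis i 1) has_derivative (\<lambda>t. (disc_deriv f \<zeta> $ i * t) *s axis i 1)) (at \<zeta>)" for i
    by (intro bounded_linear.has_derivative[OF bounded_linear_vector_scalar]) (simp add: has_field_derivative_def)
  then have "((\<lambda>\<zeta>. \<Sum>i\<in>UNIV. (f \<zeta> $ i) *s axis i 1) has_derivative (\<lambda>t. \<Sum>i\<in>UNIV. (disc_deriv f \<zeta> $ i * t) *s axis i 1)) (at \<zeta>)"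
    by (intro has_derivative_sum)
  moreover have "(\<Sum>i\<in>UNIV. (disc_deriv f \<zeta> $ i * t) *s axis i 1) = t *s disc_deriv f \<zeta>" for t
    using vector_sum_axis[of "t *s disc_deriv f \<zeta>"] by (simp add: mult.commute)
  ultimately show ?thesis by (simp add: vector_sum_axis)
qed

lemma compose_has_field_derivative:
  assumes f: "analytic_disc D f" and \<zeta>: "\<zeta> \<in> unit_disc" and r: "(r has_derivative bdot a) (at (f \<zeta>))"
  shows "((\<lambda>\<zeta>. r (f \<zeta>)) has_field_derivative bdot a (disc_deriv f \<zeta>)) (at \<zeta>)"
proof -
  have "((\<lambda>\<zeta>. r (f \<zeta>)) has_derivative (\<lambda>t. bdot a (t *s disc_deriv f \<zeta>))) (at \<zeta>)"
    by (rule has_derivative_compose[OF analytic_disc_has_derivative[OF f \<zeta>] r])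
  then show ?thesis by (simp add: has_field_derivative_def mult.commute[of "bdot _ _"] mult_commute_abs)
qed

lemma kobayashi_dist_le:
  assumes chain: "p 0 = z" "p m = w" "\<And>j. j < m \<Longrightarrow> analytic_disc D (f j) \<and> a j \<in> unit_disc \<and> b j \<in> unit_disc \<and>
             f j (a j) = p j \<and> f j (b j) = p (Suc j)"
  shows "kobayashi_dist D z w \<le> (\<Sum>j<m. poincare_dist (a j) (b j))"
  unfolding kobayashi_dist_def
proof (rule cInf_lower)
  show "bdd_below {(\<Sum>j<m. poincare_dist (a j) (b j)) | (m::nat) f p a b.
      p 0 = z \<and> p m = w \<and>
      (\<forall>j<m. analytic_disc D (f j) \<and> a j \<in> unit_disc \<and> b j \<in> unit_disc \<and>
             f j (a j) = p j \<and> f j (b j) = p (Suc j))}"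
    by (rule bdd_belowI[of _ 0]) (auto intro!: sum_nonneg poincare_dist_nonneg)
qed (use chain in blast)

lemma kobayashi_dist_disc_le:
  assumes "analytic_disc D f" "a \<in> unit_disc" "b \<in> unit_disc"
  shows "kobayashi_dist D (f a) (f b) \<le> poincare_dist a b"
  using kobayashi_dist_le[of "\<lambda>j. if j = 0 then f a else f b" "f a" 1 "f b" D "\<lambda>_. f" "\<lambda>_. a" "\<lambda>_. b"] assms
  by simp

text \<open>Each link of a chain of discs is mapped by \<open>r\<close> to a pair of points in the unit disc whose distance is
  controlled by Schwarz-Pick.\<close>

lemma poincare_le_kobayashi_dist:
  assumes r: "\<And>w. w \<in> D \<Longrightarrow> r w \<in> unit_disc"
    and hol: "\<And>f. analytic_disc D f \<Longrightarrow> (\<lambda>\<zeta>. r (f \<zeta>)) holomorphic_on unit_disc"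
    and \<phi>: "analytic_disc D \<phi>" "\<zeta> \<in> unit_disc" "\<eta> \<in> unit_disc"
  shows "poincare_dist (r (\<phi> \<zeta>)) (r (\<phi> \<eta>)) \<le> kobayashi_dist D (\<phi> \<zeta>) (\<phi> \<eta>)"
  unfolding kobayashi_dist_def
proof (rule cInf_greatest)
  show "{(\<Sum>j<m. poincare_dist (a j) (b j)) | (m::nat) f p a b.
      p 0 = \<phi> \<zeta> \<and> p m = \<phi> \<eta> \<and>
      (\<forall>j<m. analytic_disc D (f j) \<and> a j \<in> unit_disc \<and> b j \<in> unit_disc \<and>
             f j (a j) = p j \<and> f j (b j) = p (Suc j))} \<noteq> {}" (is "?S \<noteq> {}")
  proof -
    have "(\<Sum>j<(1::nat). poincare_dist \<zeta> \<eta>) \<in> ?S"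
      using \<phi> by (intro CollectI exI[of _ 1] exI[of _ "\<lambda>_. \<phi>"] exI[of _ "\<lambda>j. if j = 0 then \<phi> \<zeta> else \<phi> \<eta>"]
          exI[of _ "\<lambda>_. \<zeta>"] exI[of _ "\<lambda>_. \<eta>"]) simp
    then show ?thesis by blast
  qed
  fix x assume "x \<in> ?S"
  then obtain m f p a b where x: "x = (\<Sum>j<m. poincare_dist (a j) (b j))" and p: "p 0 = \<phi> \<zeta>" "p m = \<phi> \<eta>"
    and ch: "\<And>j. j < m \<Longrightarrow> analytic_disc D (f j) \<and> a j \<in> unit_disc \<and> b j \<in> unit_disc \<and>
             f j (a j) = p j \<and> f j (b j) = p (Suc j)" by blast
  have pD: "p j \<in> D" if "j \<le> m" for j
  proof (cases j)
    case 0 then show ?thesis using p \<phi> by (auto simp: analytic_disc_def)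
  next
    case (Suc i)
    then have "f i (b i) = p j" "analytic_disc D (f i)" "b i \<in> unit_disc" using ch[of i] that by auto
    then show ?thesis unfolding analytic_disc_def by (metis image_subset_iff)
  qed
  have "poincare_dist (r (p 0)) (r (p k)) \<le> (\<Sum>j<k. poincare_dist (a j) (b j))" if "k \<le> m" for k
    using that
  proof (induction k)
    case 0
    show ?case by (simp add: poincare_dist_def)
  next
    case (Suc k)
    then have k: "k < m" by simp
    note c = ch[OF k]
    have "poincare_dist (r (p 0)) (r (p (Suc k))) \<le> poincare_dist (r (p 0)) (r (p k)) + poincare_dist (r (p k)) (r (p (Suc k)))"
      using Suc by (intro poincare_dist_triangle r pD) auto
    also have "poincare_dist (r (p k)) (r (p (Suc k))) \<le> poincare_dist (a k) (b k)"
    proof -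
      have "(\<lambda>\<zeta>. r (f k \<zeta>)) ` unit_disc \<subseteq> unit_disc"
        using c r by (auto simp: analytic_disc_def image_subset_iff)
      from Schwarz_Pick[OF hol this, of "a k" "b k"] c show ?thesis by auto
    qed
    finally show ?case using Suc by simp
  qed
  from this[of m] show "poincare_dist (r (\<phi> \<zeta>)) (r (\<phi> \<eta>)) \<le> x" by (simp add: x p)
qed

context supporting_field
begin

lemma \<rho>_disc: "w \<in> D \<Longrightarrow> \<rho> w \<in> unit_disc" using \<rho>(1) by simp

lemma \<rho>_compose_holomorphic:
  assumes f: "analytic_disc D f" shows "(\<lambda>\<zeta>. \<rho> (f \<zeta>)) holomorphic_on unit_disc"
proof (rule holomorphic_onI)
  fix \<zeta> assume \<zeta>: "\<zeta> \<in> unit_disc"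
  then have "f \<zeta> \<in> D" using f unfolding analytic_disc_def by blast
  then obtain a where "(\<rho> has_derivative bdot a) (at (f \<zeta>))" using \<rho>_has_derivative by blast
  from compose_has_field_derivative[OF f \<zeta> this]
  show "(\<lambda>\<zeta>. \<rho> (f \<zeta>)) field_differentiable at \<zeta> within unit_disc"
    using field_differentiable_at_within field_differentiable_def by blast
qed

lemma \<phi>_in_D: "\<zeta> \<in> unit_disc \<Longrightarrow> \<phi> \<zeta> \<in> D"
  using \<phi> unfolding analytic_disc_def by blast

lemma complex_geodesic_\<phi>: "complex_geodesic D \<phi>"
  unfolding complex_geodesic_def
proof (intro conjI ballI \<phi> antisym)
  fix \<zeta> \<eta> assume *: "\<zeta> \<in> unit_disc" "\<eta> \<in> unit_disc"
  show "kobayashi_dist D (\<phi> \<zeta>) (\<phi> \<eta>) \<le> poincare_dist \<zeta> \<eta>" by (rule kobayashi_dist_disc_le[OF \<phi> *])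
  show "poincare_dist \<zeta> \<eta> \<le> kobayashi_dist D (\<phi> \<zeta>) (\<phi> \<eta>)"
    using poincare_le_kobayashi_dist[of D \<rho>, OF \<rho>_disc \<rho>_compose_holomorphic \<phi> *] * by (simp add: \<rho>_\<phi>)
qed

lemma lempert_projection_\<rho>: "lempert_projection D \<phi> (\<lambda>w. \<phi> (\<rho> w))"
  unfolding lempert_projection_def
proof (intro conjI ballI)
  show "holomorphic_map_on (\<lambda>w. \<phi> (\<rho> w)) D"
    unfolding holomorphic_map_on_def
  proof
    fix w assume w: "w \<in> D"
    obtain a where a: "(\<rho> has_derivative bdot a) (at w)" using \<rho>_has_derivative[OF w] by blast
    have "((\<lambda>w. \<phi> (\<rho> w)) has_derivative (\<lambda>u. bdot a u *s disc_deriv \<phi> (\<rho> w))) (at w)"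
      by (rule has_derivative_compose[OF a analytic_disc_has_derivative[OF \<phi> \<rho>_disc[OF w]]])
    then show "\<exists>L. ((\<lambda>w. \<phi> (\<rho> w)) has_derivative L) (at w) \<and> (\<forall>c v. L (c *s v) = c *s L v)"
      by (intro exI[of _ "\<lambda>u. bdot a u *s disc_deriv \<phi> (\<rho> w)"]) (simp add: vector_smult_assoc)
  qed
  show "(\<lambda>w. \<phi> (\<rho> w)) ` D = \<phi> ` unit_disc"
  proof
    show "(\<lambda>w. \<phi> (\<rho> w)) ` D \<subseteq> \<phi> ` unit_disc" using \<rho>_disc by blast
    show "\<phi> ` unit_disc \<subseteq> (\<lambda>w. \<phi> (\<rho> w)) ` D"
    proof
      fix w assume "w \<in> \<phi> ` unit_disc"
      then obtain \<zeta> where \<zeta>: "\<zeta> \<in> unit_disc" "w = \<phi> \<zeta>" by blast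
      then show "w \<in> (\<lambda>w. \<phi> (\<rho> w)) ` D"
        using \<phi>_in_D by (intro image_eqI[of _ _ "\<phi> \<zeta>"]) (simp_all add: \<rho>_\<phi>)
    qed
  qed
  show "\<phi> (\<rho> (\<phi> (\<rho> w))) = \<phi> (\<rho> w)" if "w \<in> D" for w using \<rho>(1)[OF that] by (simp add: \<rho>_\<phi>)
  show "\<phi> (\<rho> w) = w" if "w \<in> \<phi> ` unit_disc" for w using that by (auto simp: \<rho>_\<phi>)
  fix \<zeta> assume \<zeta>: "\<zeta> \<in> unit_disc"
  have "\<phi> (\<rho> w) = \<phi> \<zeta> \<longleftrightarrow> bdot (h \<zeta>) w = bdot (h \<zeta>) (\<phi> \<zeta>)" if w: "w \<in> D" for w
  proof -
    have "\<rho> w = \<zeta>" if "\<phi> (\<rho> w) = \<phi> \<zeta>"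
      using arg_cong[OF that, of \<rho>] \<rho>(1)[OF w] \<zeta> by (simp add: \<rho>_\<phi>)
    then have "\<phi> (\<rho> w) = \<phi> \<zeta> \<longleftrightarrow> \<rho> w = \<zeta>" by blast
    also have "\<dots> \<longleftrightarrow> g w \<zeta> = 0" using \<zeta> by (intro \<rho>_eq_iff w) auto
    also have "\<dots> \<longleftrightarrow> bdot (h \<zeta>) w = bdot (h \<zeta>) (\<phi> \<zeta>)" by (auto simp: g_def)
    finally show ?thesis .
  qed
  then have "{w \<in> D. \<phi> (\<rho> w) = \<phi> \<zeta>} = D \<inter> {w. (\<Sum>i\<in>UNIV. h \<zeta> $ i * w $ i) = bdot (h \<zeta>) (\<phi> \<zeta>)}"
    by (auto simp: bdot_def)
  moreover have "complex_hyperplane {w. (\<Sum>i\<in>UNIV. h \<zeta> $ i * w $ i) = bdot (h \<zeta>) (\<phi> \<zeta>)}"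
    unfolding complex_hyperplane_def using h_nonzero[of \<zeta>] \<zeta> by auto
  ultimately show "\<exists>H. complex_hyperplane H \<and> {w \<in> D. \<phi> (\<rho> w) = \<phi> \<zeta>} = D \<inter> H" by blast
qed

lemma lempert_device_\<rho>: "lempert_device D \<phi> (\<lambda>w. \<phi> (\<rho> w)) \<rho>"
  unfolding lempert_device_def
proof (intro conjI complex_geodesic_\<phi> lempert_projection_\<rho> ballI)
  fix w assume w: "w \<in> D"
  have "inj_on \<phi> unit_disc" by (rule inj_on_inverseI[of _ \<rho>]) (simp add: \<rho>_\<phi>)
  then show "\<rho> w = inv_into unit_disc \<phi> (\<phi> (\<rho> w))" using \<rho>_disc[OF w] by (simp add: inv_into_f_f)
qed

end

section \<open>Existence of extremal discs\<close>

text \<open>Montel's theorem is applied to one coordinate after the other, passing to a subsequence each time.\<close>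

lemma Montel_vector:
  fixes f :: "nat \<Rightarrow> complex \<Rightarrow> complex ^ 'n"
  assumes hol: "\<And>k i. (\<lambda>\<zeta>. f k \<zeta> $ i) holomorphic_on unit_disc"
    and bd: "\<And>k \<zeta>. \<zeta> \<in> unit_disc \<Longrightarrow> norm (f k \<zeta>) \<le> N"
  obtains g :: "complex \<Rightarrow> complex ^ 'n" and r :: "nat \<Rightarrow> nat" where "strict_mono r" "\<And>i. (\<lambda>\<zeta>. g \<zeta> $ i) holomorphic_on unit_disc"
    "\<And>\<zeta>. \<zeta> \<in> unit_disc \<Longrightarrow> (\<lambda>k. f (r k) \<zeta>) \<longlonglongrightarrow> g \<zeta>"
    "(\<lambda>k. disc_deriv (f (r k)) 0) \<longlonglongrightarrow> disc_deriv g 0"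
proof -
  have "\<exists>r g. strict_mono (r :: nat \<Rightarrow> nat) \<and> (\<forall>i\<in>I. g i holomorphic_on unit_disc \<and>
      (\<forall>K. compact K \<longrightarrow> K \<subseteq> unit_disc \<longrightarrow> uniform_limit K (\<lambda>k \<zeta>. f (r k) \<zeta> $ i) (g i) sequentially))"
    if "finite I" for I :: "'n set"
    using that
  proof (induction I rule: finite_induct)
    case empty
    show ?case using strict_mono_id by auto
  next
    case (insert j I)
    then obtain r g where r: "strict_mono (r :: nat \<Rightarrow> nat)"
      and g: "\<And>i. i \<in> I \<Longrightarrow> g i holomorphic_on unit_disc"
        "\<And>i K. i \<in> I \<Longrightarrow> compact K \<Longrightarrow> K \<subseteq> unit_disc \<Longrightarrow> uniform_limit K (\<lambda>k \<zeta>. f (r k) \<zeta> $ i) (g i) sequentially"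
      by blast
    obtain gj r' where r': "gj holomorphic_on unit_disc" "strict_mono (r' :: nat \<Rightarrow> nat)"
      "\<And>K. compact K \<Longrightarrow> K \<subseteq> unit_disc \<Longrightarrow> uniform_limit K ((\<lambda>k \<zeta>. f (r k) \<zeta> $ j) \<circ> r') gj sequentially"
    proof (rule Montel[of unit_disc "range (\<lambda>k \<zeta>. f (r k) \<zeta> $ j)" "\<lambda>k \<zeta>. f (r k) \<zeta> $ j"])
      show "\<exists>B. \<forall>h\<in>range (\<lambda>k \<zeta>. f (r k) \<zeta> $ j). \<forall>z\<in>K. cmod (h z) \<le> B" if "K \<subseteq> unit_disc" for K
        using that bd Finite_Cartesian_Product.norm_nth_le order_trans by (intro exI[of _ N]) blast
    qed (use hol in auto)
    define g' where "g' = g(j := gj)"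
    have "g' i holomorphic_on unit_disc \<and> (\<forall>K. compact K \<longrightarrow> K \<subseteq> unit_disc \<longrightarrow>
        uniform_limit K (\<lambda>k \<zeta>. f ((r \<circ> r') k) \<zeta> $ i) (g' i) sequentially)" if i: "i \<in> insert j I" for i
    proof (cases "i = j")
      case True
      then show ?thesis using r' by (simp add: g'_def o_def)
    next
      case False
      then have iI: "i \<in> I" using i by simp
      have "uniform_limit K (\<lambda>k \<zeta>. f ((r \<circ> r') k) \<zeta> $ i) (g i) sequentially"
        if K: "compact K" "K \<subseteq> unit_disc" for K
        unfolding uniform_limit_iff
      proof (intro allI impI)
        fix e :: real assume "e > 0"
        from eventually_subseq[OF r'(2) uniform_limitD[OF g(2)[OF iI K] this]]
        show "\<forall>\<^sub>F k in sequentially. \<forall>x\<in>K. dist (f ((r \<circ> r') k) x $ i) (g i x) < e" by simp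
      qed
      then show ?thesis using False g(1)[OF iI] by (simp add: g'_def)
    qed
    then show ?case using strict_mono_o[OF r r'(2)] by blast
  qed
  from this[OF finite_class.finite_UNIV] obtain r g where r: "strict_mono (r :: nat \<Rightarrow> nat)"
      and g: "\<And>i. g i holomorphic_on unit_disc"
        "\<And>i K. compact K \<Longrightarrow> K \<subseteq> unit_disc \<Longrightarrow> uniform_limit K (\<lambda>k \<zeta>. f (r k) \<zeta> $ i) (g i) sequentially"
    by blast
  show ?thesis
  proof (rule that[OF r, of "\<lambda>\<zeta>. \<chi> i. g i \<zeta>"])
    show "(\<lambda>\<zeta>. (\<chi> i. g i \<zeta>) $ i) holomorphic_on unit_disc" for i using g(1) by simp
    show "(\<lambda>k. f (r k) \<zeta>) \<longlonglongrightarrow> (\<chi> i. g i \<zeta>)" if "\<zeta> \<in> unit_disc" for \<zeta>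
    proof (rule vec_tendstoI)
      fix i
      have "uniform_limit {\<zeta>} (\<lambda>k \<zeta>. f (r k) \<zeta> $ i) (g i) sequentially" using that by (intro g(2)) auto
      then show "(\<lambda>k. f (r k) \<zeta> $ i) \<longlonglongrightarrow> (\<chi> i. g i \<zeta>) $ i"
        using tendsto_uniform_limitI by fastforce
    qed
    show "(\<lambda>k. disc_deriv (f (r k)) 0) \<longlonglongrightarrow> disc_deriv (\<lambda>\<zeta>. \<chi> i. g i \<zeta>) 0"
    proof (rule vec_tendstoI)
      fix i
      have "uniform_limit (cball 0 (1/2)) (\<lambda>k \<zeta>. f (r k) \<zeta> $ i) (g i) sequentially"
        by (intro g(2)) auto
      then have "uniform_limit (ball 0 (1/2)) (\<lambda>k \<zeta>. f (r k) \<zeta> $ i) (g i) sequentially"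
        by (rule uniform_limit_on_subset) auto
      moreover have "\<forall>\<^sub>F k in sequentially. (\<lambda>\<zeta>. f (r k) \<zeta> $ i) holomorphic_on ball 0 (1/2)"
        by (intro always_eventually allI holomorphic_on_subset[OF hol]) auto
      ultimately have "(\<lambda>k. deriv (\<lambda>\<zeta>. f (r k) \<zeta> $ i) 0) \<longlonglongrightarrow> deriv (g i) 0"
        by (rule deriv_complex_uniform_limit) auto
      then show "(\<lambda>k. disc_deriv (f (r k)) 0 $ i) \<longlonglongrightarrow> disc_deriv (\<lambda>\<zeta>. \<chi> i. g i \<zeta>) 0 $ i"
        by (simp add: disc_deriv_def)
    qed
  qed
qed

text \<open>A supporting functional at a boundary point in the image would attain its maximum along the disc and
  hence be constant, which is impossible at the interior point \<open>f 0\<close>.\<close>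

lemma disc_in_convex:
  fixes D :: "(complex ^ 'n) set"
  assumes D: "open D" "convex D" and f: "\<And>i. (\<lambda>\<zeta>. f \<zeta> $ i) holomorphic_on unit_disc"
    and cl: "\<And>\<zeta>. \<zeta> \<in> unit_disc \<Longrightarrow> f \<zeta> \<in> closure D" and f0: "f 0 \<in> D" and \<zeta>: "\<zeta> \<in> unit_disc"
  shows "f \<zeta> \<in> D"
proof (rule ccontr)
  assume "f \<zeta> \<notin> D"
  then have "\<exists>a b. a \<noteq> 0 \<and> (\<forall>x\<in>D. inner a x \<le> b) \<and> (\<forall>x\<in>{f \<zeta>}. inner a x \<ge> b)"
    using f0 by (intro separating_hyperplane_sets D) auto
  then obtain a b where ab: "a \<noteq> 0" "\<And>x. x \<in> D \<Longrightarrow> inner a x \<le> b" "inner a (f \<zeta>) \<ge> b" by auto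
  have "closed {x. inner a x \<le> b}" by (rule closed_halfspace_le)
  then have ab': "inner a x \<le> b" if "x \<in> closure D" for x
    using closure_minimal[of D "{x. inner a x \<le> b}"] ab(2) that by auto
  let ?p = "\<lambda>z. of_real b - bdot (\<chi> i. cnj (a $ i)) (f z)"
  have "Re (?p 0) = 0"
  proof (rule Re_zero_of_Re_nonneg[where p = ?p and \<zeta> = \<zeta>])
    show "?p holomorphic_on unit_disc" by (intro holomorphic_intros holomorphic_on_bdot f)
    show "0 \<le> Re (?p z)" if "cmod z < 1" for z
      using ab'[OF cl[of z]] that by (simp add: inner_eq_bdot)
    show "Re (?p \<zeta>) = 0" using ab(3) ab'[OF cl[OF \<zeta>]] by (simp add: inner_eq_bdot)
  qed (use \<zeta> in auto)
  then have eq: "inner a (f 0) = b" by (simp add: inner_eq_bdot)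
  obtain \<epsilon> where \<epsilon>: "\<epsilon> > 0" "ball (f 0) \<epsilon> \<subseteq> D" using D(1) f0 openE by blast
  let ?w = "f 0 + (\<epsilon> / (2 * norm a)) *\<^sub>R a"
  have "?w \<in> D" using \<epsilon> ab(1) by (auto intro!: subsetD[OF \<epsilon>(2)] simp: dist_norm)
  then have "inner a ?w \<le> b" by (rule ab(2))
  then have "\<epsilon> / (2 * norm a) * inner a a \<le> 0" using eq by (simp add: inner_add_right)
  moreover have "0 < \<epsilon> / (2 * norm a) * inner a a" using \<epsilon>(1) ab(1) by (intro mult_pos_pos) auto
  ultimately show False by simp
qed

text \<open>The derivatives \<open>t v\<close> are bounded by the Schwarz lemma in a coordinate in which \<open>v\<close> does not vanish, and a
  maximising sequence converges by Montel's theorem.\<close>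

lemma extremal_disc_exists:
  fixes D :: "(complex ^ 'n) set"
  assumes D: "open D" "convex D" "bounded D" "0 \<in> D" and v: "v \<noteq> 0"
  shows "\<exists>M \<phi>. extremal_disc D v M \<phi>"
proof -
  define \<Lambda> where "\<Lambda> = {t. \<exists>f. analytic_disc D f \<and> f 0 = 0 \<and> disc_deriv f 0 = of_real t *s v}"
  obtain N where N: "\<And>w. w \<in> D \<Longrightarrow> norm w \<le> N" using D(3) unfolding bounded_iff by blast
  have N0: "0 \<le> N" using N[OF D(4)] by simp
  define K where "K = N + 1"
  have K: "0 < K" "N < K" using N0 by (auto simp: K_def)
  obtain i where i: "v $ i \<noteq> 0" using v by (auto simp: vec_eq_iff)
  have upper: "t \<le> K / cmod (v $ i)" if t: "t \<in> \<Lambda>" for t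
  proof -
    obtain f where f: "analytic_disc D f" "f 0 = 0" "disc_deriv f 0 = of_real t *s v" using t by (auto simp: \<Lambda>_def)
    have hol: "(\<lambda>\<zeta>. f \<zeta> $ i) holomorphic_on unit_disc" using f(1) by (auto simp: analytic_disc_def)
    have "cmod (deriv (\<lambda>\<zeta>. f \<zeta> $ i / of_real K) 0) \<le> 1"
    proof (rule Schwarz_Lemma(2)[where \<xi> = 0])
      show "(\<lambda>\<zeta>. f \<zeta> $ i / of_real K) holomorphic_on ball 0 1"
        using K by (intro holomorphic_intros hol) auto
      show "cmod (f z $ i / of_real K) < 1" if "cmod z < 1" for z
      proof -
        have "f z \<in> D" using f(1) that by (auto simp: analytic_disc_def)
        then have "cmod (f z $ i) \<le> N" using N Finite_Cartesian_Product.norm_nth_le order_trans by blast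
        then show ?thesis using K by (simp add: norm_divide)
      qed
    qed (use f(2) in auto)
    moreover have "deriv (\<lambda>\<zeta>. f \<zeta> $ i / of_real K) 0 = deriv (\<lambda>\<zeta>. f \<zeta> $ i) 0 / of_real K"
      by (rule deriv_cdivide_right) (auto intro: holomorphic_on_imp_differentiable_at[OF hol])
    moreover have "deriv (\<lambda>\<zeta>. f \<zeta> $ i) 0 = of_real t * v $ i"
      using arg_cong[OF f(3), of "\<lambda>w. w $ i"] by (simp add: disc_deriv_def)
    ultimately have "\<bar>t\<bar> * cmod (v $ i) \<le> K"
      using K by (simp add: norm_divide norm_mult)
    then have "t * cmod (v $ i) \<le> K" by (meson abs_ge_self mult_right_mono norm_ge_zero order_trans)
    then show ?thesis using i by (simp add: field_simps)
  qed
  then have bdd: "bdd_above \<Lambda>" by (auto simp: bdd_above_def)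
  define M where "M = Sup \<Lambda>"
  have le_M: "t \<le> M" if "t \<in> \<Lambda>" for t unfolding M_def by (rule cSup_upper[OF that bdd])
  obtain \<epsilon> where \<epsilon>: "\<epsilon> > 0" "ball 0 \<epsilon> \<subseteq> D" using D(1,4) openE by blast
  have "\<epsilon> / norm v \<in> \<Lambda>"
  proof -
    let ?f = "\<lambda>\<zeta>. \<zeta> *s (of_real (\<epsilon> / norm v) *s v)"
    have "?f \<zeta> \<in> D" if "cmod \<zeta> < 1" for \<zeta>
      using that v \<epsilon>(1) by (intro subsetD[OF \<epsilon>(2)]) (simp add: norm_vector_scalar norm_divide norm_mult)
    then have "analytic_disc D ?f" by (auto simp: analytic_disc_def intro!: holomorphic_intros)
    moreover have "disc_deriv (\<lambda>\<zeta>. \<zeta> *s w) 0 = w" for w :: "complex ^ 'n"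
      by (simp add: disc_deriv_def vec_eq_iff)
    moreover have "?f 0 = 0" by simp
    ultimately show ?thesis unfolding \<Lambda>_def by blast
  qed
  then have ne: "\<Lambda> \<noteq> {}" and "\<epsilon> / norm v \<le> M" using le_M by auto
  moreover have "0 < \<epsilon> / norm v" using v \<epsilon>(1) by simp
  ultimately have M0: "0 < M" by linarith
  have "\<exists>t\<in>\<Lambda>. M - 1 / real (Suc k) < t" for k
    using less_cSup_iff[OF ne bdd, of "M - 1 / real (Suc k)"] by (simp add: M_def)
  then obtain t where t: "\<And>k. t k \<in> \<Lambda>" "\<And>k. M - 1 / real (Suc k) < t k" by metis
  then obtain f where f: "\<And>k. analytic_disc D (f k)" "\<And>k. f k 0 = 0"
    "\<And>k. disc_deriv (f k) 0 = of_real (t k) *s v" unfolding \<Lambda>_def by (auto simp: mem_Collect_eq) metis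
  have t_lim: "t \<longlonglongrightarrow> M"
  proof (rule tendsto_sandwich)
    show "(\<lambda>k. M - 1 / real (Suc k)) \<longlonglongrightarrow> M"
      using tendsto_diff[OF tendsto_const LIMSEQ_inverse_real_of_nat, of M] by (simp add: inverse_eq_divide)
    show "\<forall>\<^sub>F k in sequentially. M - 1 / real (Suc k) \<le> t k"
      by (intro always_eventually allI less_imp_le t)
    show "\<forall>\<^sub>F k in sequentially. t k \<le> M" by (intro always_eventually allI le_M t)
  qed (rule tendsto_const)
  have fD: "f k \<zeta> \<in> D" if "\<zeta> \<in> unit_disc" for k \<zeta>
    using f(1)[of k] that unfolding analytic_disc_def by blast
  obtain \<phi> r where r: "strict_mono r" and \<phi>: "\<And>i. (\<lambda>\<zeta>. \<phi> \<zeta> $ i) holomorphic_on unit_disc"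
    "\<And>\<zeta>. \<zeta> \<in> unit_disc \<Longrightarrow> (\<lambda>k. f (r k) \<zeta>) \<longlonglongrightarrow> \<phi> \<zeta>"
    "(\<lambda>k. disc_deriv (f (r k)) 0) \<longlonglongrightarrow> disc_deriv \<phi> 0"
  proof (rule Montel_vector[of f N])
    show "(\<lambda>\<zeta>. f k \<zeta> $ i) holomorphic_on unit_disc" for k i using f(1) by (auto simp: analytic_disc_def)
    show "norm (f k \<zeta>) \<le> N" if "\<zeta> \<in> unit_disc" for k \<zeta> using N fD that by blast
  qed blast
  have "\<phi> 0 = 0" using LIMSEQ_unique[OF \<phi>(2)[of 0]] by (simp add: f(2))
  moreover have "disc_deriv \<phi> 0 = of_real M *s v"
  proof -
    have "(\<lambda>k. t (r k)) \<longlonglongrightarrow> M" using LIMSEQ_subseq_LIMSEQ[OF t_lim r] by (simp add: o_def)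
    then have "(\<lambda>k. t (r k) *\<^sub>R v) \<longlonglongrightarrow> M *\<^sub>R v" by (intro tendsto_intros)
    then have "(\<lambda>k. disc_deriv (f (r k)) 0) \<longlonglongrightarrow> of_real M *s v" by (simp add: f(3) scaleR_eq_vector_scalar)
    from LIMSEQ_unique[OF \<phi>(3) this] show ?thesis .
  qed
  moreover have "analytic_disc D \<phi>"
  proof -
    have cl: "\<phi> \<zeta> \<in> closure D" if "\<zeta> \<in> unit_disc" for \<zeta>
      unfolding closure_sequential
      by (intro exI[of _ "\<lambda>k. f (r k) \<zeta>"] conjI allI fD[OF that] \<phi>(2)[OF that])
    have "\<phi> \<zeta> \<in> D" if "\<zeta> \<in> unit_disc" for \<zeta>
      by (rule disc_in_convex[where f = \<phi>, OF D(1,2) \<phi>(1) cl _ that])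
        (simp_all add: \<open>\<phi> 0 = 0\<close> D(4))
    then show ?thesis using \<phi>(1) by (auto simp: analytic_disc_def)
  qed
  ultimately have "extremal_disc D v M \<phi>"
  proof unfold_locales
    show "t \<le> M" if "analytic_disc D f" "f 0 = 0" "disc_deriv f 0 = of_real t *s v" for f t
      by (rule le_M) (use that in \<open>auto simp: \<Lambda>_def\<close>)
  qed (use D M0 in simp_all)
  then show ?thesis by blast
qed

section \<open>The Kobayashi metric and devices in a given direction\<close>

lemma kobayashi_metric_le:
  assumes "analytic_disc D f" "f 0 = z" "\<xi> *s disc_deriv f 0 = v"
  shows "kobayashi_metric D z v \<le> cmod \<xi>"
  unfolding kobayashi_metric_def
  by (rule cInf_lower) (use assms in \<open>auto intro!: bdd_belowI[of _ 0]\<close>)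

lemma analytic_disc_affine:
  fixes p u :: "complex ^ 'n"
  assumes "\<And>\<zeta>. cmod \<zeta> < 1 \<Longrightarrow> p + (\<zeta> * c) *s u \<in> D"
  shows "analytic_disc D (\<lambda>\<zeta>. p + (\<zeta> * c) *s u)"
  using assms by (auto simp: analytic_disc_def intro!: holomorphic_intros)

text \<open>The infimum is over a nonempty set because \<open>D\<close> contains a small affine disc; an infimum over the empty
  set would not admit the bound.\<close>

lemma kobayashi_metric_ge:
  assumes D: "open D" "z \<in> D"
    and le: "\<And>f \<xi>. analytic_disc D f \<Longrightarrow> f 0 = z \<Longrightarrow> \<xi> *s disc_deriv f 0 = v \<Longrightarrow> c \<le> cmod \<xi>"
  shows "c \<le> kobayashi_metric D z v"
  unfolding kobayashi_metric_def
proof (rule cInf_greatest)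
  obtain \<epsilon> where \<epsilon>: "\<epsilon> > 0" "ball z \<epsilon> \<subseteq> D" using D openE by blast
  define k where "k = \<epsilon> / (norm v + 1)"
  have pos: "0 < norm v + 1" using norm_ge_zero[of v] by linarith
  have k: "0 < k" using \<epsilon>(1) pos by (simp add: k_def)
  have k': "k * norm v < \<epsilon>" using \<epsilon>(1) pos by (simp add: k_def pos_divide_less_eq)
  let ?f = "\<lambda>\<zeta>. z + (\<zeta> * of_real k) *s v"
  have "?f \<zeta> \<in> D" if "cmod \<zeta> < 1" for \<zeta>
  proof (rule subsetD[OF \<epsilon>(2)])
    have "cmod \<zeta> * (k * norm v) \<le> 1 * (k * norm v)" using that k by (intro mult_right_mono) auto
    moreover have "dist z (?f \<zeta>) = cmod \<zeta> * (k * norm v)"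
      using k by (simp add: dist_norm norm_vector_scalar norm_mult)
    ultimately show "?f \<zeta> \<in> ball z \<epsilon>" using k' by (simp only: mem_ball)
  qed
  then have "analytic_disc D ?f" by (rule analytic_disc_affine)
  moreover have "of_real (1 / k) *s disc_deriv ?f 0 = v"
  proof -
    have "deriv (\<lambda>\<zeta>. z $ i + \<zeta> * of_real k * v $ i) 0 = of_real k * v $ i" for i
      by (rule DERIV_imp_deriv) (auto intro!: derivative_eq_intros)
    then show ?thesis using k by (simp add: disc_deriv_def vec_eq_iff)
  qed
  moreover have "?f 0 = z" by simp
  ultimately show "{cmod \<xi> |\<xi> f. analytic_disc D f \<and> f 0 = z \<and> \<xi> *s disc_deriv f 0 = v} \<noteq> {}" by blast
qed (use le in blast)

text \<open>After a translation of \<open>z\<close> to the origin the supporting field of an extremal disc provides the device.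
  Differentiating \<open>\<sigma> \<circ> \<phi> = id\<close> at the origin gives the last equation.\<close>

lemma lempert_device_exists:
  fixes D :: "(complex ^ 'n) set"
  assumes D: "open D" "convex D" "bounded D" and z: "z \<in> D" and v: "v \<noteq> 0"
  obtains \<phi> \<rho> \<sigma> M a where "0 < M" "lempert_device D \<phi> \<rho> \<sigma>" "analytic_disc D \<phi>" "\<phi> 0 = z"
    "disc_deriv \<phi> 0 = of_real M *s v" "\<sigma> z = 0"
    "\<And>w. w \<in> D \<Longrightarrow> \<sigma> w \<in> unit_disc"
    "\<And>f. analytic_disc D f \<Longrightarrow> (\<lambda>\<zeta>. \<sigma> (f \<zeta>)) holomorphic_on unit_disc"
    "(\<sigma> has_derivative bdot a) (at z)" "of_real M * bdot a v = 1"
proof -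
  define D' where "D' = (\<lambda>w. w - z) ` D"
  have D'_iff: "w \<in> D' \<longleftrightarrow> w + z \<in> D" for w by (force simp: D'_def)
  have "open D'" "convex D'" "bounded D'"
    using open_translation_subtract[OF D(1)] convex_translation_subtract[OF D(2)]
      bounded_translation_minus[OF D(3)] by (auto simp: D'_def)
  then obtain M \<psi> where "extremal_disc D' v M \<psi>"
    using extremal_disc_exists[of D' v] z v by (auto simp: D'_iff)
  then interpret E: extremal_disc D' v M \<psi> .
  obtain h C where "supporting_field D' \<psi> h C" using E.supporting_field_exists by blast
  then interpret S: supporting_field D' \<psi> h C .
  define \<phi> where "\<phi> \<zeta> = \<psi> \<zeta> + z" for \<zeta>
  have \<phi>: "analytic_disc D \<phi>"
    using E.\<phi>(1) by (auto simp: analytic_disc_def \<phi>_def D'_iff image_subset_iff intro!: holomorphic_intros)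
  interpret T: supporting_field D \<phi> h C
  proof
    show "- C * (1 - (cmod \<zeta>)\<^sup>2) \<le> Re (cnj \<zeta> * bdot (h \<zeta>) (\<phi> \<zeta> - w))" if "w \<in> D" "cmod \<zeta> < 1" for w \<zeta>
      using S.supp[of "w - z" \<zeta>] that by (simp add: D'_iff \<phi>_def algebra_simps)
  qed (use D convex_connected \<phi> S.hol_h S.h0 in auto)
  have \<phi>0: "\<phi> 0 = z" by (simp add: \<phi>_def E.\<phi>)
  have "(\<lambda>\<zeta>. \<psi> \<zeta> $ i) field_differentiable at 0" for i
    using E.\<phi>(1) by (intro holomorphic_on_imp_differentiable_at[of _ unit_disc]) (auto simp: analytic_disc_def)
  then have d: "disc_deriv \<phi> 0 = of_real M *s v"
    using E.\<phi>(3) by (simp add: disc_deriv_def \<phi>_def vec_eq_iff)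
  obtain a where a: "(T.\<rho> has_derivative bdot a) (at z)" using T.\<rho>_has_derivative[OF z] by blast
  have "((\<lambda>\<zeta>. T.\<rho> (\<phi> \<zeta>)) has_field_derivative bdot a (disc_deriv \<phi> 0)) (at 0)"
    by (rule compose_has_field_derivative[OF \<phi>]) (use a \<phi>0 in auto)
  then have "((\<lambda>\<zeta>. \<zeta>) has_field_derivative bdot a (disc_deriv \<phi> 0)) (at 0)"
    by (rule has_field_derivative_transform_within[where d = 1]) (auto simp: T.\<rho>_\<phi>)
  from DERIV_unique[OF this DERIV_ident] have "of_real M * bdot a v = 1" by (simp add: d)
  then show ?thesis
    using that[OF E.M T.lempert_device_\<rho> \<phi> \<phi>0 d _ T.\<rho>_disc T.\<rho>_compose_holomorphic a] T.\<rho>_\<phi>[of 0] \<phi>0 by simp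
qed

section \<open>1-Bloch domains are Lipschitz\<close>

text \<open>With \<open>t = tanh C\<close> the quotient of the metrics is at most the constant \<open>2 sqrt t / (1 + t)\<close> of
  \<open>image_contains_ball\<close>. The extremal disc bounds the metric of \<open>D\<close> from above by \<open>1 / M\<close>. For a disc \<open>f\<close>
  in \<open>X\<close>, the projection \<open>\<sigma>\<close> bounds the metric of \<open>X\<close> from below.\<close>

lemma lipschitz_of_one_bloch:
  fixes D X :: "(complex ^ 'n) set"
  assumes D: "open D" "convex D" "bounded D" and X: "subdomain X D" and bloch: "one_bloch D X"
  shows "lipschitz_subdomain D X"
proof -
  have XD: "X \<subseteq> D" and oX: "open X" using X by (auto simp: subdomain_def is_domain_def)
  obtain C where C: "C > 0" and U: "\<And>\<phi> \<rho> \<sigma>. lempert_device D \<phi> \<rho> \<sigma> \<Longrightarrow>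
        \<exists>U. bloch_subdomain poincare_dist unit_disc U \<and> \<sigma> ` X \<subseteq> U \<and>
             bloch_radius poincare_dist unit_disc U < ereal C"
    using bloch unfolding one_bloch_def by blast
  define t where "t = tanh C"
  have t: "0 < t" "t < 1" using C by (auto simp: t_def tanh_real_lt_1)
  define \<mu> where "\<mu> = 2 * sqrt t / (1 + t)"
  have "0 < (1 - sqrt t)\<^sup>2" using t by simp
  then have \<mu>: "0 < \<mu>" "\<mu> < 1" using t by (auto simp: \<mu>_def power2_eq_square algebra_simps)
  have ratio: "kobayashi_metric D z v / kobayashi_metric X z v \<le> \<mu>" if z: "z \<in> X" and v: "v \<noteq> 0" for z v
  proof -
    obtain \<phi> \<rho> \<sigma> M a where dev: "0 < M" "lempert_device D \<phi> \<rho> \<sigma>" "analytic_disc D \<phi>" "\<phi> 0 = z"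
      "disc_deriv \<phi> 0 = of_real M *s v" "\<sigma> z = 0"
      "\<And>w. w \<in> D \<Longrightarrow> \<sigma> w \<in> unit_disc"
      "\<And>f. analytic_disc D f \<Longrightarrow> (\<lambda>\<zeta>. \<sigma> (f \<zeta>)) holomorphic_on unit_disc"
      and a: "(\<sigma> has_derivative bdot a) (at z)" "of_real M * bdot a v = 1"
      by (rule lempert_device_exists[OF D subsetD[OF XD z] v]) blast
    have "kobayashi_metric D z v \<le> cmod (of_real (1 / M))"
      using dev(1) by (intro kobayashi_metric_le[OF dev(3,4)]) (simp add: dev(5) vec_eq_iff)
    then have upper: "kobayashi_metric D z v \<le> 1 / M" using dev(1) by (simp add: norm_divide)
    have lower: "1 / (M * \<mu>) \<le> kobayashi_metric X z v"
    proof (rule kobayashi_metric_ge[OF oX z])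
      fix f \<xi> assume f: "analytic_disc X f" "f 0 = z" "\<xi> *s disc_deriv f 0 = v"
      have fD: "analytic_disc D f" using f(1) XD by (auto simp: analytic_disc_def)
      define F where "F \<zeta> = \<sigma> (f \<zeta>)" for \<zeta>
      have "cmod (deriv F 0) \<le> \<mu>"
        unfolding \<mu>_def
      proof (rule image_contains_ball[OF _ _ _ t])
        show "F holomorphic_on unit_disc" unfolding F_def by (rule dev(8)[OF fD])
        show "F ` unit_disc \<subseteq> unit_disc"
          using dev(7) fD unfolding F_def analytic_disc_def by blast
        show "F 0 = 0" by (simp add: F_def f dev)
        show "\<not> ball 0 t \<subseteq> F ` unit_disc"
        proof
          assume sub: "ball 0 t \<subseteq> F ` unit_disc"
          obtain V where V: "\<sigma> ` X \<subseteq> V" "bloch_radius poincare_dist unit_disc V < ereal C"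
            using U[OF dev(2)] by blast
          have "F ` unit_disc \<subseteq> \<sigma> ` X" using f(1) by (auto simp: F_def analytic_disc_def)
          then have "ball 0 t \<subseteq> V" using sub V by blast
          moreover have "hyp_ball poincare_dist unit_disc 0 C \<subseteq> ball 0 t"
          proof
            fix w assume "w \<in> hyp_ball poincare_dist unit_disc 0 C"
            then have w: "cmod w < 1" "artanh (cmod w) < C" by (auto simp: hyp_ball_def)
            then have "tanh (artanh (cmod w)) < t" by (simp add: t_def)
            moreover have "-1 < cmod w" by (rule less_le_trans[OF _ norm_ge_zero]) simp
            ultimately show "w \<in> ball 0 t" using w by (simp add: tanh_artanh)
          qed
          ultimately have "hyp_ball poincare_dist unit_disc 0 C \<subseteq> V" by blast
          then have "ereal C \<le> bloch_radius poincare_dist unit_disc V"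
            unfolding bloch_radius_def using C by (intro SUP_upper) (auto intro!: bexI[of _ 0])
          then show False using V(2) by simp
        qed
      qed
      moreover have "deriv F 0 = bdot a (disc_deriv f 0)"
        unfolding F_def by (rule DERIV_imp_deriv, rule compose_has_field_derivative[OF fD]) (use a f in auto)
      ultimately have "cmod \<xi> * cmod (bdot a (disc_deriv f 0)) \<le> cmod \<xi> * \<mu>"
        by (intro mult_left_mono) auto
      also have "cmod \<xi> * cmod (bdot a (disc_deriv f 0)) = cmod (bdot a v)"
        by (simp add: f(3)[symmetric] norm_mult)
      finally have "M * cmod (bdot a v) \<le> M * (cmod \<xi> * \<mu>)" using dev(1) by (intro mult_left_mono) auto
      moreover have "M * cmod (bdot a v) = 1"
        using arg_cong[OF a(2), of cmod] dev(1) by (simp add: norm_mult)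
      ultimately show "1 / (M * \<mu>) \<le> cmod \<xi>" using dev(1) \<mu>(1) by (simp add: field_simps)
    qed
    have pos: "0 < 1 / (M * \<mu>)" using dev(1) \<mu>(1) by simp
    then have posX: "0 < kobayashi_metric X z v" using lower by linarith
    have "kobayashi_metric D z v / kobayashi_metric X z v \<le> (1 / M) / kobayashi_metric X z v"
      using upper posX by (intro divide_right_mono) auto
    also have "\<dots> \<le> (1 / M) / (1 / (M * \<mu>))"
      using lower pos posX dev(1) by (intro divide_left_mono mult_pos_pos) auto
    also have "\<dots> = \<mu>" using dev(1) by simp
    finally show ?thesis .
  qed
  have "hyp_lipschitz_const D X \<le> ereal \<mu>"
    unfolding hyp_lipschitz_const_def
  proof (rule SUP_least)
    fix p assume "p \<in> X \<times> (UNIV - {0 :: complex ^ 'n})"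
    then show "(case p of (z, v) \<Rightarrow> ereal (kobayashi_metric D z v / kobayashi_metric X z v)) \<le> ereal \<mu>"
      using ratio[of "fst p" "snd p"] by (cases p) auto
  qed
  also have "\<dots> < 1" using \<mu> by simp
  finally show ?thesis using X by (simp add: lipschitz_subdomain_def)
qed

section \<open>Lipschitz domains are c-Bloch\<close>

text \<open>The curves \<open>f(\<xi> t)\<close> and \<open>\<phi>(\<zeta>0 + t)\<close> start at the same point with the same velocity, so their
  distance is \<open>o(t)\<close>. A chain consisting of \<open>f\<close> and a short affine disc joins \<open>\<phi>(\<zeta>0)\<close> to \<open>\<phi>(\<zeta>0 + t)\<close>, and its
  length is at least the Poincare distance of \<open>\<zeta>0\<close> and \<open>\<zeta>0 + t\<close> because \<open>\<phi>\<close> is a geodesic. Dividing by \<open>t\<close>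
  gives the claim. The case \<open>\<xi> = 0\<close> is included; it shows that the derivative of \<open>\<phi>\<close> has no zeros.\<close>

lemma geodesic_infinitesimal:
  fixes D :: "(complex ^ 'n) set"
  assumes D: "open D" and geo: "complex_geodesic D \<phi>" and \<zeta>0: "\<zeta>0 \<in> unit_disc"
    and f: "analytic_disc D f" "f 0 = \<phi> \<zeta>0" "\<xi> *s disc_deriv f 0 = disc_deriv \<phi> \<zeta>0"
  shows "1 / (1 - (cmod \<zeta>0)\<^sup>2) \<le> cmod \<xi>"
proof -
  have \<phi>: "analytic_disc D \<phi>" using geo by (simp add: complex_geodesic_def)
  have \<zeta>01: "cmod \<zeta>0 < 1" using \<zeta>0 by simp
  have "\<phi> \<zeta>0 \<in> D" using \<phi> \<zeta>0 unfolding analytic_disc_def by blast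
  then obtain \<epsilon> where \<epsilon>: "\<epsilon> > 0" "ball (\<phi> \<zeta>0) \<epsilon> \<subseteq> D" using D openE by blast
  \<comment> \<open>Affine discs of radius \<open>r\<close> about points at distance less than \<open>r\<close> from \<open>\<phi> \<zeta>0\<close> lie in \<open>D\<close>.\<close>
  define r where "r = \<epsilon> / 2"
  have r: "r > 0" using \<epsilon> by (simp add: r_def)
  define P where "P t = f (\<xi> * of_real t)" for t :: real
  define Q where "Q t = \<phi> (\<zeta>0 + of_real t)" for t :: real
  define e where "e t = norm (P t - Q t)" for t
  have P0: "P 0 = \<phi> \<zeta>0" by (simp add: P_def f)
  have dP: "(P has_derivative (\<lambda>t. (\<xi> * of_real t) *s disc_deriv f 0)) (at 0)"
    unfolding P_def
    by (rule has_derivative_compose[where g = f and f = "\<lambda>t. \<xi> * of_real t" and g' = "\<lambda>t. t *s disc_deriv f 0"])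
      (use analytic_disc_has_derivative[OF f(1), of 0] in \<open>auto intro!: derivative_eq_intros\<close>)
  have dQ: "(Q has_derivative (\<lambda>t. of_real t *s disc_deriv \<phi> \<zeta>0)) (at 0)"
    unfolding Q_def
    by (rule has_derivative_compose[where g = \<phi> and f = "\<lambda>t. \<zeta>0 + of_real t" and g' = "\<lambda>t. t *s disc_deriv \<phi> \<zeta>0"])
      (use analytic_disc_has_derivative[OF \<phi> \<zeta>0] in \<open>auto intro!: derivative_eq_intros\<close>)
  have "(\<xi> * of_real t) *s disc_deriv f 0 = of_real t *s disc_deriv \<phi> \<zeta>0" for t
    by (simp only: f(3)[symmetric] vector_smult_assoc mult.commute)
  then have "((\<lambda>t. P t - Q t) has_derivative (\<lambda>t. 0)) (at 0)"
    using has_derivative_diff[OF dP dQ] by simp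
  then have "((\<lambda>t. e t / \<bar>t\<bar>) \<longlongrightarrow> 0) (at 0)"
    unfolding has_derivative_at by (simp add: P0 Q_def e_def)
  then have lim_e: "((\<lambda>t. e t / \<bar>t\<bar>) \<longlongrightarrow> 0) (at_right 0)"
    by (rule filterlim_mono) (auto simp: at_le)
  have cont_P: "(P \<longlongrightarrow> P 0) (at_right 0)"
    using has_derivative_continuous[OF dP] unfolding continuous_at
    by (rule filterlim_mono) (auto simp: at_le)
  have cont_Q: "(Q \<longlongrightarrow> Q 0) (at_right 0)"
    using has_derivative_continuous[OF dQ] unfolding continuous_at
    by (rule filterlim_mono) (auto simp: at_le)
  have PQ0: "Q 0 = P 0" by (simp add: P0 Q_def)
  have ev1: "\<forall>\<^sub>F t in at_right 0. 0 < t" by (auto simp: eventually_at_filter)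
  have ev2: "\<forall>\<^sub>F t in at_right 0. dist (P t) (P 0) < r" using tendstoD[OF cont_P r] .
  have "((\<lambda>t. cmod (\<zeta>0 + of_real t)) \<longlongrightarrow> cmod (\<zeta>0 + of_real 0)) (at_right 0)"
    by (intro tendsto_intros)
  then have ev3: "\<forall>\<^sub>F t in at_right (0::real). cmod (\<zeta>0 + of_real t) < 1"
    using \<zeta>01 by (intro order_tendstoD(2)) auto
  have "((\<lambda>t. cmod \<xi> * t + norm (P t - Q t) / r) \<longlongrightarrow> cmod \<xi> * 0 + norm (P 0 - Q 0) / r) (at_right 0)"
    using r by (intro tendsto_intros cont_P cont_Q) auto
  then have ev4: "\<forall>\<^sub>F t in at_right 0. cmod \<xi> * t + e t / r < 1"
    unfolding e_def by (intro order_tendstoD(2)) (auto simp: PQ0)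
  have "\<forall>\<^sub>F t in at_right 0. 1 / cmod (1 - cnj (\<zeta>0 + of_real t) * \<zeta>0) \<le> cmod \<xi> + (e t / \<bar>t\<bar>) / r"
    using ev1 ev2 ev3 ev4
  proof eventually_elim
    case (elim t)
    define A b where "A = cmod \<xi> * t" and "b = e t / r"
    have Ab: "0 \<le> A" "0 \<le> b" "A + b < 1" using elim r by (auto simp: A_def b_def e_def)
    have Ab1: "A < 1" "b < 1" using Ab by linarith+
    \<comment> \<open>If \<open>e t = 0\<close>, then \<open>G\<close> is constant and \<open>b = 0\<close>, so the chain below is still valid.\<close>
    define G where "G \<zeta> = P t + (\<zeta> * of_real (r / e t)) *s (Q t - P t)" for \<zeta>
    have GD: "G \<zeta> \<in> D" if "cmod \<zeta> < 1" for \<zeta>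
    proof (rule subsetD[OF \<epsilon>(2)])
      have "G \<zeta> - P t = (\<zeta> * of_real (r / e t)) *s (Q t - P t)"
        unfolding G_def by (rule add_diff_cancel_left')
      moreover have "norm (Q t - P t) = e t" by (simp add: e_def norm_minus_commute)
      ultimately have "dist (G \<zeta>) (P t) = cmod (\<zeta> * of_real (r / e t)) * e t"
        by (simp only: dist_norm norm_vector_scalar)
      also have "\<dots> = cmod \<zeta> * ((r / e t) * e t)"
        using r by (simp add: norm_mult norm_divide e_def)
      also have "\<dots> \<le> 1 * r" using that r by (intro mult_mono) auto
      finally have "dist (\<phi> \<zeta>0) (G \<zeta>) \<le> dist (P t) (P 0) + r"
        using dist_triangle[of "\<phi> \<zeta>0" "G \<zeta>" "P t"] by (simp add: P0 dist_commute)
      then show "G \<zeta> \<in> ball (\<phi> \<zeta>0) \<epsilon>" using elim by (simp add: r_def)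
    qed
    have G: "analytic_disc D G"
      using GD unfolding G_def[abs_def] by (rule analytic_disc_affine)
    have G0: "G 0 = P t" by (simp add: G_def)
    have Gb: "G (of_real b) = Q t"
    proof (cases "e t = 0")
      case True then show ?thesis by (simp add: G_def e_def)
    next
      case False
      then have "of_real b * of_real (r / e t) = (1 :: complex)" using r by (simp add: b_def)
      then show ?thesis by (simp add: G_def del: of_real_divide)
    qed
    define chain where "chain j = (if j = 0 then \<phi> \<zeta>0 else if j = 1 then P t else Q t)" for j :: nat
    have "kobayashi_dist D (\<phi> \<zeta>0) (Q t) \<le>
      (\<Sum>j<2. poincare_dist 0 ((\<lambda>j::nat. if j = 0 then \<xi> * of_real t else of_real b) j))"
      using elim Ab Ab1 G f(1)
      by (intro kobayashi_dist_le[of chain _ 2 _ D "\<lambda>j. if j = 0 then f else G" "\<lambda>_. 0"])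
        (auto simp: chain_def less_2_cases_iff G0 Gb f P_def A_def norm_mult)
    also have "\<dots> = artanh A + artanh b"
      using elim Ab by (simp add: numeral_2_eq_2 poincare_dist_commute[of 0] A_def norm_mult)
    also have "\<dots> = artanh ((A + b) / (1 + A * b))" using Ab by (intro artanh_add) auto
    finally have 1: "kobayashi_dist D (\<phi> \<zeta>0) (Q t) \<le> artanh ((A + b) / (1 + A * b))" .
    define N where "N = cmod (1 - cnj (\<zeta>0 + of_real t) * \<zeta>0)"
    have in_disc: "\<zeta>0 + of_real t \<in> unit_disc" using elim by simp
    have "kobayashi_dist D (\<phi> \<zeta>0) (Q t) = poincare_dist \<zeta>0 (\<zeta>0 + of_real t)"
      using geo \<zeta>0 in_disc by (simp add: complex_geodesic_def Q_def)
    also have "\<dots> = artanh (t / N)"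
      using elim by (simp add: poincare_dist_def norm_divide N_def)
    finally have 2: "artanh (t / N) \<le> artanh ((A + b) / (1 + A * b))" using 1 by simp
    have tN: "t / N < 1"
      using Moebius_in_disc[OF in_disc \<zeta>0] elim by (simp add: Moebius_function_simple norm_divide N_def)
    have nn: "0 \<le> (A + b) / (1 + A * b)" "0 \<le> t / N" using Ab elim by (auto simp: N_def)
    have le: "(A + b) / (1 + A * b) \<le> A + b"
      using Ab by (simp add: divide_le_eq mult_left_le add_pos_nonneg distrib_left)
    have "t / N \<le> (A + b) / (1 + A * b)"
    proof -
      have "-1 < t / N" "-1 < (A + b) / (1 + A * b)" "(A + b) / (1 + A * b) < 1"
        using nn le Ab by linarith+
      from artanh_le_iff[OF this(1) tN this(2,3)] 2 show ?thesis by blast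
    qed
    also note le
    finally have "(t / N) / t \<le> (A + b) / t" using elim by (intro divide_right_mono) auto
    then show ?case
      using elim r by (simp add: A_def b_def N_def add_divide_distrib mult.commute)
  qed
  moreover have "((\<lambda>t. 1 / cmod (1 - cnj (\<zeta>0 + of_real t) * \<zeta>0)) \<longlongrightarrow> 1 / cmod (1 - cnj (\<zeta>0 + of_real 0) * \<zeta>0)) (at_right 0)"
    using one_minus_cnj_mult_nonzero[OF \<zeta>01 \<zeta>01] by (intro tendsto_intros) auto
  moreover have "((\<lambda>t. cmod \<xi> + (e t / \<bar>t\<bar>) / r) \<longlongrightarrow> cmod \<xi> + 0 / r) (at_right 0)"
    using r by (intro tendsto_intros lim_e) auto
  ultimately have "1 / cmod (1 - cnj (\<zeta>0 + of_real 0) * \<zeta>0) \<le> cmod \<xi> + 0 / r"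
    by (intro tendsto_le[of "at_right (0::real)"]) auto
  moreover have "cmod (1 - cnj \<zeta>0 * \<zeta>0) = 1 - (cmod \<zeta>0)\<^sup>2"
  proof -
    have "1 - cnj \<zeta>0 * \<zeta>0 = of_real (1 - (cmod \<zeta>0)\<^sup>2)"
      by (simp only: of_real_diff of_real_1 complex_norm_square mult.commute)
    then show ?thesis using \<zeta>01 by (simp only: norm_of_real) (simp add: power_le_one)
  qed
  ultimately show ?thesis by simp
qed

text \<open>The radius \<open>R\<close> is chosen with \<open>tanh R > \<mu>\<close>, where \<open>\<mu> < 1\<close> bounds the quotient of the metrics. A hyperbolic disc of
  radius \<open>R\<close> inside the preimage of \<open>X\<close> would make this quotient at least \<open>tanh R\<close>.\<close>

lemma c_bloch_of_lipschitz:
  fixes D X :: "(complex ^ 'n) set"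
  assumes D: "open D" and X: "subdomain X D" and lip: "lipschitz_subdomain D X"
  shows "c_bloch D X"
proof -
  have XD: "X \<subseteq> D" and oX: "open X" using X by (auto simp: subdomain_def is_domain_def)
  have "hyp_lipschitz_const D X < 1" using lip by (simp add: lipschitz_subdomain_def)
  then obtain \<mu>0 where \<mu>0: "hyp_lipschitz_const D X < ereal \<mu>0" "ereal \<mu>0 < 1" using ereal_dense2 by blast
  define \<mu> where "\<mu> = max 0 \<mu>0"
  have \<mu>: "0 \<le> \<mu>" "\<mu> < 1" using \<mu>0(2) by (auto simp: \<mu>_def)
  have ratio: "kobayashi_metric D z v / kobayashi_metric X z v \<le> \<mu>" if "z \<in> X" "v \<noteq> 0" for z v
  proof -
    have "ereal (kobayashi_metric D z v / kobayashi_metric X z v) \<le> hyp_lipschitz_const D X"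
      unfolding hyp_lipschitz_const_def by (rule SUP_upper2[of "(z, v)"]) (use that in auto)
    also have "\<dots> \<le> ereal \<mu>" using \<mu>0(1) by (simp add: \<mu>_def less_imp_le order_trans[of _ "ereal \<mu>0"])
    finally show ?thesis by simp
  qed
  define R where "R = artanh \<mu> + 1"
  have R: "0 < R" using artanh_nonneg[OF \<mu>] by (simp add: R_def)
  define s where "s = tanh R"
  have s: "\<mu> < s" "0 < s" "s < 1"
  proof -
    have "tanh (artanh \<mu>) < s" by (simp add: s_def R_def)
    then show "\<mu> < s" using \<mu> by (simp add: tanh_artanh)
    show "0 < s" "s < 1" using R by (auto simp: s_def tanh_real_lt_1)
  qed
  have main: "\<exists>p\<in>unit_disc - {\<zeta> \<in> unit_disc. \<phi> \<zeta> \<in> X}. poincare_dist p \<zeta> < R"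
    if geo: "complex_geodesic D \<phi>" and \<zeta>: "\<zeta> \<in> unit_disc" for \<phi> \<zeta>
  proof (rule ccontr)
    assume "\<not> ?thesis"
    then have inX: "\<And>p. p \<in> unit_disc \<Longrightarrow> poincare_dist p \<zeta> < R \<Longrightarrow> \<phi> p \<in> X" by blast
    have \<phi>: "analytic_disc D \<phi>" using geo by (simp add: complex_geodesic_def)
    have z: "\<phi> \<zeta> \<in> X" using inX[OF \<zeta>] R by (simp add: poincare_dist_def)
    define l where "l = 1 - (cmod \<zeta>)\<^sup>2"
    have l: "l > 0" using \<zeta> by (simp add: l_def power_less_one_iff abs_square_less_1)
    define v where "v = disc_deriv \<phi> \<zeta>"
    have v0: "v \<noteq> 0"
    proof
      assume "v = 0"
      moreover have "analytic_disc D (\<lambda>_. \<phi> \<zeta>)" using z XD by (auto simp: analytic_disc_def)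
      ultimately have "1 / (1 - (cmod \<zeta>)\<^sup>2) \<le> cmod 0"
        by (intro geodesic_infinitesimal[OF D geo \<zeta>, of "\<lambda>_. \<phi> \<zeta>"]) (auto simp: v_def)
      then show False using l by (simp add: l_def)
    qed
    have lowD: "1 / l \<le> kobayashi_metric D (\<phi> \<zeta>) v"
      unfolding l_def v_def using z XD
      by (intro kobayashi_metric_ge[OF D] geodesic_infinitesimal[OF D geo \<zeta>]) auto
    have lowX: "1 / l \<le> kobayashi_metric X (\<phi> \<zeta>) v"
    proof (rule kobayashi_metric_ge[OF oX z])
      fix f \<xi> assume f: "analytic_disc X f" "f 0 = \<phi> \<zeta>" "\<xi> *s disc_deriv f 0 = v"
      have "analytic_disc D f" using f(1) XD by (auto simp: analytic_disc_def)
      from geodesic_infinitesimal[OF D geo \<zeta> this f(2) f(3)[unfolded v_def]]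
      show "1 / l \<le> cmod \<xi>" by (simp add: l_def)
    qed
    \<comment> \<open>\<open>m\<close> maps the unit disc onto the hyperbolic disc of radius \<open>R\<close> about \<open>\<zeta>\<close>.\<close>
    define m where "m \<tau> = Moebius_function 0 (- \<zeta>) (of_real s * \<tau>)" for \<tau>
    have s\<tau>: "of_real s * \<tau> \<in> unit_disc" if "\<tau> \<in> unit_disc" for \<tau> :: complex
      using that s norm_mult_less[of "of_real s" 1 \<tau> 1] by simp
    have m_disc: "m \<tau> \<in> unit_disc" if "\<tau> \<in> unit_disc" for \<tau>
      unfolding m_def using \<zeta> s\<tau>[OF that] by (intro Moebius_in_disc) auto
    have m_dist: "poincare_dist (m \<tau>) \<zeta> < R" if "\<tau> \<in> unit_disc" for \<tau>
    proof -
      have "Moebius_function 0 \<zeta> (m \<tau>) = of_real s * \<tau>"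
        unfolding m_def using \<zeta> s\<tau>[OF that] by (intro Moebius_function_compose) auto
      then have "poincare_dist (m \<tau>) \<zeta> = artanh (s * cmod \<tau>)"
        using s by (simp add: poincare_dist_Moebius norm_mult)
      also have "\<dots> < artanh s"
      proof -
        have "artanh x < artanh s" if "0 \<le> x" "x < s" for x
          using that s by (subst artanh_less_iff) auto
        then show ?thesis using s that by simp
      qed
      finally show ?thesis by (simp add: s_def artanh_tanh_real)
    qed
    have m_eq: "m \<tau> = (of_real s * \<tau> + \<zeta>) / (1 + cnj \<zeta> * (of_real s * \<tau>))" for \<tau>
      by (simp add: m_def Moebius_function_simple)
    have hol_m: "m holomorphic_on unit_disc"
    proof -
      have "Moebius_function 0 (- \<zeta>) \<circ> (\<lambda>\<tau>. of_real s * \<tau>) holomorphic_on unit_disc"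
        using \<zeta> s\<tau> by (intro holomorphic_on_compose_gen[where t = unit_disc] Moebius_function_holomorphic holomorphic_intros) auto
      then show ?thesis by (simp add: m_def[abs_def] o_def)
    qed
    have dm: "(m has_field_derivative of_real (s * l)) (at 0)"
    proof -
      have "\<zeta> * cnj \<zeta> = of_real ((cmod \<zeta>)\<^sup>2)" by (simp only: complex_norm_square)
      then have "1 - \<zeta> * cnj \<zeta> = of_real l" by (simp add: l_def)
      moreover have "of_real s - \<zeta> * (cnj \<zeta> * of_real s) = of_real s * (1 - \<zeta> * cnj \<zeta>)"
        by (simp add: right_diff_distrib)
      ultimately have "of_real s - \<zeta> * (cnj \<zeta> * of_real s) = of_real (s * l)" by simp
      moreover have "(m has_field_derivative (of_real s - \<zeta> * (cnj \<zeta> * of_real s))) (at 0)"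
        unfolding m_eq[abs_def] by (auto intro!: derivative_eq_intros)
      ultimately show ?thesis by simp
    qed
    define f where "f \<tau> = \<phi> (m \<tau>)" for \<tau>
    have comp: "(\<lambda>\<tau>. f \<tau> $ i) holomorphic_on unit_disc" for i
    proof -
      have "(\<lambda>\<zeta>. \<phi> \<zeta> $ i) \<circ> m holomorphic_on unit_disc"
        using \<phi> m_disc by (intro holomorphic_on_compose_gen[OF hol_m, of _ unit_disc]) (auto simp: analytic_disc_def)
      then show ?thesis by (simp add: f_def o_def)
    qed
    have fX: "analytic_disc X f"
      using comp inX[OF m_disc m_dist] by (auto simp: analytic_disc_def f_def)
    have f0: "f 0 = \<phi> \<zeta>" by (simp add: f_def m_eq)
    have df: "disc_deriv f 0 = of_real (s * l) *s v"
    proof -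
      have "deriv (\<lambda>\<tau>. f \<tau> $ i) 0 = v $ i * of_real (s * l)" for i
      proof (rule DERIV_imp_deriv)
        have "((\<lambda>\<zeta>. \<phi> \<zeta> $ i) has_field_derivative v $ i) (at (m 0))"
          using \<phi> holomorphic_derivI[OF _ open_ball \<zeta>, of "\<lambda>\<zeta>. \<phi> \<zeta> $ i"]
          by (simp add: analytic_disc_def v_def disc_deriv_def m_eq)
        from DERIV_chain2[OF this dm] show "((\<lambda>\<tau>. f \<tau> $ i) has_field_derivative v $ i * of_real (s * l)) (at 0)"
          by (simp add: f_def)
      qed
      then show ?thesis by (simp add: disc_deriv_def vec_eq_iff mult.commute)
    qed
    have "kobayashi_metric X (\<phi> \<zeta>) v \<le> cmod (of_real (1 / (s * l)))"
      using s l by (intro kobayashi_metric_le[OF fX f0]) (simp add: df vec_eq_iff)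
    then have upX: "kobayashi_metric X (\<phi> \<zeta>) v \<le> 1 / (s * l)" using s l by (simp add: norm_divide norm_mult)
    have pos: "0 < 1 / l" using l by simp
    then have posX: "0 < kobayashi_metric X (\<phi> \<zeta>) v" using lowX by linarith
    have "s = (1 / l) / (1 / (s * l))" using s l by simp
    also have "\<dots> \<le> (1 / l) / kobayashi_metric X (\<phi> \<zeta>) v"
      using upX posX pos s l by (intro divide_left_mono mult_pos_pos) auto
    also have "\<dots> \<le> kobayashi_metric D (\<phi> \<zeta>) v / kobayashi_metric X (\<phi> \<zeta>) v"
      using lowD posX by (intro divide_right_mono) auto
    also have "\<dots> \<le> \<mu>" by (rule ratio[OF z v0])
    finally show False using s by simp
  qed
  show ?thesis
    unfolding c_bloch_def
  proof (intro conjI X exI[of _ "R + 1"] allI impI)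
    show "0 < R + 1" using R by simp
    fix \<phi> \<rho> \<rho>t assume dev: "lempert_device D \<phi> \<rho> \<rho>t"
    then have geo: "complex_geodesic D \<phi>" by (simp add: lempert_device_def)
    define U where "U = {\<zeta> \<in> unit_disc. \<phi> \<zeta> \<in> X}"
    have "U \<subseteq> unit_disc" by (auto simp: U_def)
    from bloch_superdomain[OF this less_imp_le[OF R] main[OF geo, folded U_def]]
    obtain V where V: "bloch_subdomain poincare_dist unit_disc V" "U \<subseteq> V"
      "bloch_radius poincare_dist unit_disc V \<le> ereal (R + 1)"
      by blast
    have "\<rho>t ` (X \<inter> \<phi> ` unit_disc) \<subseteq> U"
    proof
      fix y assume "y \<in> \<rho>t ` (X \<inter> \<phi> ` unit_disc)"
      then obtain z where z: "z \<in> X" "z \<in> \<phi> ` unit_disc" "y = \<rho>t z" by blast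
      then have "y = inv_into unit_disc \<phi> z"
        using dev XD by (auto simp: lempert_device_def lempert_projection_def)
      then show "y \<in> U" using z inv_into_into[OF z(2)] f_inv_into_f[OF z(2)] by (simp add: U_def)
    qed
    then show "\<exists>U. bloch_subdomain poincare_dist unit_disc U \<and> \<rho>t ` (X \<inter> \<phi> ` unit_disc) \<subseteq> U \<and>
        bloch_radius poincare_dist unit_disc U \<le> ereal (R + 1)"
      using V by blast
  qed
qed

section \<open>The comparison of the three conditions\<close>

theorem proposition3p4:
  fixes D X :: "(complex ^ 'n) set"
  assumes "is_domain D" and "bounded D" and "convex D"
    and "subdomain X D"
  shows "(lipschitz_subdomain D X \<longrightarrow> c_bloch D X) \<and> (one_bloch D X \<longrightarrow> lipschitz_subdomain D X)"
  using assms c_bloch_of_lipschitz lipschitz_of_one_bloch by (auto simp: is_domain_def)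

end
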